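(* Let $K\neq0$, $\kappa=\sqrt{|K|}$, and let $A,B,C,D$ be four distinct points of an $\Re_K$ domain $(\mathcal M,\rho)$ such that $\rho(A,B)+\rho(B,C)+\rho(C,D)+\rho(D,A)<2\pi/\sqrt K$ if $K>0$. Then equality holds in $$\cos\kappa\rho(A,B)+\cos\kappa\rho(B,C)+\cos\kappa\rho(C,D)+\cos\kappa\rho(D,A)\le4\cos\tfrac{\kappa\rho(B,D)}{2}\cos\tfrac{\kappa\rho(A,C)}{2}\quad(K>0),$$ respectively in $$\cosh\kappa\rho(A,B)+\cosh\kappa\rho(B,C)+\cosh\kappa\rho(C,D)+\cosh\kappa\rho(D,A)\ge4\cosh\tfrac{\kappa\rho(B,D)}{2}\cosh\tfrac{\kappa\rho(A,C)}{2}\quad(K<0),$$ if and only if the geodesic convex hull of $\{A,B,C,D\}$ is isometric to a parallelogramoidal domain in $\mathbb S_K$, i.e. either a segment of a geodesic, or the closed convex domain bounded by a closed polygonal curve $A'B'C'D'A'$ (with $A,B,C,D$ corresponding to $A',B',C',D'$) such that $\operatorname{cosq}_K(\overrightarrow{A'D'},\overrightarrow{C'B'})=-1$ and $A'D'=B'C'$ (hence also $A'B'=C'D'$).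
   Context: $\mathbb S_K$: open hemisphere of radius $1/\sqrt K$ of the round 2-sphere ($K>0$) or hyperbolic plane of curvature $K$ ($K<0$). For points $A\neq P$, $B\neq Q$ with distances $x=AP$, $y=BQ$, $a=AB$, $b=PQ$, $d=PB$, $f=AQ$: for $K>0$, $$\operatorname{cosq}_K(\overrightarrow{AP},\overrightarrow{BQ})=\frac{\cos\kappa b+\cos\kappa x\cos\kappa y}{\sin\kappa x\sin\kappa y}-\frac{(\cos\kappa x+\cos\kappa d)(\cos\kappa y+\cos\kappa f)}{(1+\cos\kappa a)\sin\kappa x\sin\kappa y},$$ and for $K<0$, $$\operatorname{cosq}_K(\overrightarrow{AP},\overrightarrow{BQ})=\frac{(\cosh\kappa x+\cosh\kappa d)(\cosh\kappa y+\cosh\kappa f)}{(1+\cosh\kappa a)\sinh\kappa x\sinh\kappa y}-\frac{\cosh\kappa b+\cosh\kappa x\cosh\kappa y}{\sinh\kappa x\sinh\kappa y}.$$ $\Re_K$ domain: a metric space in which any two points are joined by a shortest (curve of length equal to their distance), in which (if $K>0$) every geodesic triangle has perimeter $<2\pi/\sqrt K$, and every geodesic triangle $ABC$ has sum of upper angles between its sides at its vertices at most $\angle_KBAC+\angle_KABC+\angle_KACB$, where $\angle_K$ is the angle of the comparison triangle with the same side lengths in $\mathbb S_K$ and the upper angle between shortests $\mathcal L,\mathcal N$ from $O$ is $\limsup\angle_0XOY$ as $X\to O$ in $\mathcal L\setminus\{O\}$, $Y\to O$ in $\mathcal N\setminus\{O\}$. Geodesic convex hull: $\mathcal G[P,Q]$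 is the set of points on shortests joining $P,Q$; $\mathcal G[\mathcal F]=\bigcup_{P,Q\in\mathcal F}\mathcal G[P,Q]$, $\mathcal G^0[\mathcal F]=\mathcal F$, $\mathcal G^{n+1}[\mathcal F]=\mathcal G[\mathcal G^n[\mathcal F]]$, hull $=\bigcup_n\mathcal G^n[\mathcal F]$.
   Formalization: In the segment case the vertex correspondence, cosq = -1 and A'D' = B'C' are also required (points 0,1,2,3 on a line refute the bare segment); the domain is taken as the geodesic convex hull of A',B',C',D', and the parenthetical A'B' = C'D' is not stated. *)

theory Defs
  imports "HOL-Analysis.Analysis"
begin

definition unit_partitions :: "real list set" where
  "unit_partitions = {ts. ts \<noteq> [] \<and> hd ts = 0 \<and> last ts = 1 \<and> sorted ts}"

definition curve_length :: "('a \<Rightarrow> 'a \<Rightarrow> real) \<Rightarrow> (real \<Rightarrow> 'a) \<Rightarrow> ereal" where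
  "curve_length d \<gamma> =
     (SUP ts \<in> unit_partitions.
        ereal (\<Sum>i < length ts - 1. d (\<gamma> (ts ! i)) (\<gamma> (ts ! Suc i))))"

definition curve_in :: "'a set \<Rightarrow> ('a \<Rightarrow> 'a \<Rightarrow> real) \<Rightarrow> (real \<Rightarrow> 'a) \<Rightarrow> bool" where
  "curve_in M d \<gamma> \<longleftrightarrow> \<gamma> ` {0..1} \<subseteq> M \<and>
     (\<forall>t\<in>{0..1}. \<forall>e>0. \<exists>\<delta>>0. \<forall>s\<in>{0..1}. \<bar>s - t\<bar> < \<delta> \<longrightarrow> d (\<gamma> s) (\<gamma> t) < e)"

definition shortest :: "'a set \<Rightarrow> ('a \<Rightarrow> 'a \<Rightarrow> real) \<Rightarrow> 'a \<Rightarrow> 'a \<Rightarrow> (real \<Rightarrow> 'a) \<Rightarrow> bool" where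
  "shortest M d P Q \<gamma> \<longleftrightarrow> curve_in M d \<gamma> \<and> \<gamma> 0 = P \<and> \<gamma> 1 = Q \<and>
     curve_length d \<gamma> = ereal (d P Q)"

definition geo_seg :: "'a set \<Rightarrow> ('a \<Rightarrow> 'a \<Rightarrow> real) \<Rightarrow> 'a \<Rightarrow> 'a \<Rightarrow> 'a set" where
  "geo_seg M d P Q = {X. \<exists>\<gamma>. shortest M d P Q \<gamma> \<and> X \<in> \<gamma> ` {0..1}}"

definition geo_step :: "'a set \<Rightarrow> ('a \<Rightarrow> 'a \<Rightarrow> real) \<Rightarrow> 'a set \<Rightarrow> 'a set" where
  "geo_step M d F = (\<Union>P\<in>F. \<Union>Q\<in>F. geo_seg M d P Q)"

definition geo_hull :: "'a set \<Rightarrow> ('a \<Rightarrow> 'a \<Rightarrow> real) \<Rightarrow> 'a set \<Rightarrow> 'a set" where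
  "geo_hull M d F = (\<Union>n. (geo_step M d ^^ n) F)"

definition angle0 :: "('a \<Rightarrow> 'a \<Rightarrow> real) \<Rightarrow> 'a \<Rightarrow> 'a \<Rightarrow> 'a \<Rightarrow> real" where
  "angle0 d Z X Y = arccos ((d Z X ^ 2 + d Z Y ^ 2 - d X Y ^ 2) / (2 * d Z X * d Z Y))"

text \<open>Upper angle at O between shortests (as point sets) L and N issuing from O:
  limsup of the Euclidean comparison angle as X, Y tend to O.\<close>
definition upper_angle :: "('a \<Rightarrow> 'a \<Rightarrow> real) \<Rightarrow> 'a \<Rightarrow> 'a set \<Rightarrow> 'a set \<Rightarrow> real" where
  "upper_angle d Z L N =
     Inf {Sup {angle0 d Z X Y | X Y. X \<in> L - {Z} \<and> Y \<in> N - {Z} \<and> d Z X < e \<and> d Z Y < e} | e. e > (0::real)}"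

text \<open>Angle in S_K of the comparison triangle with sides a, b adjacent to the
  angle and c opposite to it (K \<noteq> 0).\<close>
definition angleK :: "real \<Rightarrow> real \<Rightarrow> real \<Rightarrow> real \<Rightarrow> real" where
  "angleK K a b c = (let k = sqrt \<bar>K\<bar> in
     if K > 0 then arccos ((cos (k*c) - cos (k*a) * cos (k*b)) / (sin (k*a) * sin (k*b)))
     else arccos ((cosh (k*a) * cosh (k*b) - cosh (k*c)) / (sinh (k*a) * sinh (k*b))))"

definition RK_domain :: "real \<Rightarrow> 'a set \<Rightarrow> ('a \<Rightarrow> 'a \<Rightarrow> real) \<Rightarrow> bool" where
  "RK_domain K M d \<longleftrightarrow>
     Metric_space M d \<and>
     (\<forall>P\<in>M. \<forall>Q\<in>M. \<exists>\<gamma>. shortest M d P Q \<gamma>) \<and>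
     (K > 0 \<longrightarrow> (\<forall>A\<in>M. \<forall>B\<in>M. \<forall>C\<in>M. d A B + d B C + d C A < 2 * pi / sqrt K)) \<and>
     (\<forall>A\<in>M. \<forall>B\<in>M. \<forall>C\<in>M. \<forall>\<gamma>1 \<gamma>2 \<gamma>3.
        A \<noteq> B \<and> B \<noteq> C \<and> C \<noteq> A \<and>
        shortest M d A B \<gamma>1 \<and> shortest M d B C \<gamma>2 \<and> shortest M d C A \<gamma>3 \<longrightarrow>
        upper_angle d A (\<gamma>1 ` {0..1}) (\<gamma>3 ` {0..1})
        + upper_angle d B (\<gamma>1 ` {0..1}) (\<gamma>2 ` {0..1})
        + upper_angle d C (\<gamma>2 ` {0..1}) (\<gamma>3 ` {0..1})
        \<le> angleK K (d A B) (d A C) (d B C) + angleK K (d B A) (d B C) (d A C)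
           + angleK K (d C A) (d C B) (d A B))"

text \<open>For K > 0: open upper hemisphere of radius 1/sqrt K in R^3 with the intrinsic
  (great circle) metric. For K < 0: upper sheet of the hyperboloid
  x1^2 + x2^2 - x3^2 = 1/K with the hyperbolic metric of curvature K.\<close>
definition lorentz :: "real^3 \<Rightarrow> real^3 \<Rightarrow> real" where
  "lorentz x y = x$1 * y$1 + x$2 * y$2 - x$3 * y$3"

definition SK_set :: "real \<Rightarrow> (real^3) set" where
  "SK_set K = (if K > 0 then {x. norm x = 1 / sqrt K \<and> x$3 > 0}
               else {x. lorentz x x = 1 / K \<and> x$3 > 0})"

definition SK_dist :: "real \<Rightarrow> real^3 \<Rightarrow> real^3 \<Rightarrow> real" where
  "SK_dist K x y = (if K > 0 then arccos (K * (x \<bullet> y)) / sqrt K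
                    else arcosh (K * lorentz x y) / sqrt (- K))"

text \<open>cosq_K of the quadrilateral with x = AP, y = BQ, a = AB, b = PQ, d = PB, f = AQ.\<close>
definition cosq :: "real \<Rightarrow> real \<Rightarrow> real \<Rightarrow> real \<Rightarrow> real \<Rightarrow> real \<Rightarrow> real \<Rightarrow> real" where
  "cosq K x y a b dd f = (let k = sqrt \<bar>K\<bar> in
     if K > 0 then
       (cos (k*b) + cos (k*x) * cos (k*y)) / (sin (k*x) * sin (k*y))
       - (cos (k*x) + cos (k*dd)) * (cos (k*y) + cos (k*f)) / ((1 + cos (k*a)) * sin (k*x) * sin (k*y))
     else
       (cosh (k*x) + cosh (k*dd)) * (cosh (k*y) + cosh (k*f)) / ((1 + cosh (k*a)) * sinh (k*x) * sinh (k*y))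
       - (cosh (k*b) + cosh (k*x) * cosh (k*y)) / (sinh (k*x) * sinh (k*y)))"

definition cosqSK :: "real \<Rightarrow> real^3 \<Rightarrow> real^3 \<Rightarrow> real^3 \<Rightarrow> real^3 \<Rightarrow> real" where
  "cosqSK K A P B Q = (let \<rho> = SK_dist K in
     cosq K (\<rho> A P) (\<rho> B Q) (\<rho> A B) (\<rho> P Q) (\<rho> P B) (\<rho> A Q))"

end

(*
In the model plane, seen as the unit sphere or the unit hyperboloid of a quadratic form, the
inequality is the Cauchy-Schwarz inequality for A + C and B + D, with equality iff the midpoints
of the diagonals coincide. In an R_K domain one first shows, from the angle sums, that
(up to sign and scale) the cosine of the distance to a fixed point is at least as concave along
geodesics as in the model plane. Applied to the midpoint of AC this yields the inequality; equality
forces a common midpoint of the diagonals and opposite sides of equal length, so that A, B, C, D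
have the mutual distances of a parallelogram A'B'C'D' of the model plane. Ruling the two triangles
cut off by A'C' by the segments from B' and D' gives a nonexpanding map of the parallelogram into
the domain. For a fixed point the difference of the two cosines is then a nonnegative concave
function along geodesics, and such a function vanishes as soon as it vanishes at an interior point;
this shows first that distances to points of the diagonals are preserved, and then, prolonging the
rulings across AC, all distances.
*)
theory Submission
  imports Defs
begin

section \<open>Trigonometry of curvature K\<close>

text \<open>The hypothesis bounds only a sum of three upper angles, while the concavity needs a
  bound for a single one. If the angle at A exceeds its comparison angle, every triangle AXY with X,
  Y on the two sides has a definite deficit at X or at Y. By the first variation and the sine law, a
  deficit at X makes the comparison angle at A drop, as X moves towards A, at a rate of at least a
  constant over x = AX. Minimality would contradict this, but X and Y may run into A, so that no
  minimum need exist. A logarithmic penalty forces one; its slope m/x has the same scale, so one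
  small m works at all distances.

  Afterwards angles disappear: betweenness in the model plane is a linear relation between vectors,
  and \<open>ip\<close> of the distance to a fixed point is linear in them. Exactness of a distance
  spreads only from an interior point of a segment. This is why a ruling is prolonged beyond the
  diagonal, where its point on AC becomes interior, and why the sides, which are rulings ending at A
  or C, are reached by a limit. Collinear parallelograms are covered by the same argument.\<close>

locale ktrig =
  fixes K :: real
  assumes K0: "K \<noteq> 0"
begin

definition kap :: real where "kap = sqrt \<bar>K\<bar>"
definition eps :: real where "eps = sgn K"
definition cs :: "real \<Rightarrow> real" where "cs t = (if K > 0 then cos (kap * t) else cosh (kap * t))"
definition sn :: "real \<Rightarrow> real" where "sn t = (if K > 0 then sin (kap * t) else sinh (kap * t))"
text \<open>The value of the ambient quadratic form on two points of the model plane at distance t.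
  With the sign \<open>eps\<close> it decreases in t for both signs of K, so that each inequality
  has a single form.\<close>

definition ip :: "real \<Rightarrow> real" where "ip t = eps * cs t"
text \<open>The range of distances on which \<open>ip\<close> is injective; for K > 0 it is the
  range of the distances in the open hemisphere.\<close>

definition adm :: "real \<Rightarrow> bool" where "adm t \<longleftrightarrow> 0 \<le> t \<and> (K > 0 \<longrightarrow> kap * t < pi)"

lemma kap_pos: "kap > 0"
  using K0 by (simp add: kap_def)

lemma eps_cases: "(K > 0 \<and> eps = 1) \<or> (\<not> K > 0 \<and> eps = -1)"
  using K0 by (cases "K > 0") (auto simp: eps_def sgn_if)

lemma eps_sq [simp]: "eps * eps = 1" "eps * (eps * x) = x" "eps^2 = 1"
  using eps_cases by (auto simp: power2_eq_square)

lemma cs_add: "cs (a + b) = cs a * cs b - eps * sn a * sn b"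
  and sn_add: "sn (a + b) = sn a * cs b + cs a * sn b"
  using eps_cases
  by (auto simp: cs_def sn_def cos_add sin_add cosh_add sinh_add algebra_simps)

lemma cs_minus [simp]: "cs (- a) = cs a" and sn_minus [simp]: "sn (- a) = - sn a"
  by (auto simp: cs_def sn_def)

lemma cs_diff: "cs (a - b) = cs a * cs b + eps * sn a * sn b"
  and sn_diff: "sn (a - b) = sn a * cs b - cs a * sn b"
  using cs_add[of a "-b"] sn_add[of a "-b"] by simp_all

lemma cs_0 [simp]: "cs 0 = 1" and sn_0 [simp]: "sn 0 = 0"
  by (auto simp: cs_def sn_def)

lemma pyth: "cs t ^ 2 + eps * sn t ^ 2 = 1"
  using cs_diff[of t t] by (simp add: power2_eq_square)

lemma pyth': "sn t ^ 2 = eps * (1 - cs t ^ 2)"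
proof -
  have "eps * (1 - cs t ^ 2) = eps * (eps * sn t ^ 2)"
    using pyth[of t] by (metis add_diff_cancel_left')
  then show ?thesis by simp
qed

lemma cs_abs [simp]: "cs \<bar>a\<bar> = cs a"
  by (cases "a \<ge> 0") auto

lemma ip_abs [simp]: "ip \<bar>a\<bar> = ip a"
  by (simp add: ip_def)

lemma adm_nonneg: "adm t \<Longrightarrow> 0 \<le> t"
  by (simp add: adm_def)

lemma adm_mono: "adm t \<Longrightarrow> 0 \<le> s \<Longrightarrow> s \<le> t \<Longrightarrow> adm s"
  using kap_pos mult_left_mono[of s t kap] unfolding adm_def by linarith

lemma sn_pos: "adm t \<Longrightarrow> 0 < t \<Longrightarrow> sn t > 0"
  using kap_pos by (auto simp: adm_def sn_def sin_gt_zero)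

lemma sn_nonneg: "adm t \<Longrightarrow> sn t \<ge> 0"
  using sn_pos[of t] adm_nonneg[of t] by (cases "t = 0") auto

lemma ip_less: "adm t \<Longrightarrow> 0 \<le> s \<Longrightarrow> s < t \<Longrightarrow> ip t < ip s"
proof -
  assume a: "adm t" "0 \<le> s" "s < t"
  have l: "kap * s < kap * t" "0 \<le> kap * s" using a kap_pos by auto
  show ?thesis
  proof (cases "K > 0")
    case True
    then show ?thesis using a l eps_cases cos_monotone_0_pi[of "kap * s" "kap * t"]
      by (auto simp: ip_def cs_def adm_def)
  next
    case False
    then show ?thesis using a l eps_cases cosh_real_strict_mono[of "kap * s" "kap * t"]
      by (auto simp: ip_def cs_def)
  qed
qed

lemma ip_le_iff: "adm s \<Longrightarrow> adm t \<Longrightarrow> ip s \<le> ip t \<longleftrightarrow> t \<le> s"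
  using ip_less[of s t] ip_less[of t s] adm_nonneg[of s] adm_nonneg[of t]
  by (metis linorder_not_le order.order_iff_strict)

lemma ip_eq_iff: "adm s \<Longrightarrow> adm t \<Longrightarrow> ip s = ip t \<longleftrightarrow> t = s"
  by (metis ip_le_iff order_antisym order_refl)

lemma ip_0: "ip 0 = eps"
  by (simp add: ip_def)

lemma deriv_cs [derivative_intros]:
  assumes "(f has_real_derivative D) (at x within S)"
  shows "((\<lambda>x. cs (f x)) has_real_derivative (- eps * kap * sn (f x) * D)) (at x within S)"
proof -
  have "((\<lambda>x. cos (kap * f x)) has_real_derivative (- sin (kap * f x) * (kap * D))) (at x within S)"
    "((\<lambda>x. cosh (kap * f x)) has_real_derivative (sinh (kap * f x) * (kap * D))) (at x within S)"
    by (rule derivative_eq_intros assms refl | simp)+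
  then show ?thesis using eps_cases by (cases "K > 0") (simp_all add: cs_def sn_def algebra_simps)
qed

lemma deriv_sn [derivative_intros]:
  assumes "(f has_real_derivative D) (at x within S)"
  shows "((\<lambda>x. sn (f x)) has_real_derivative (kap * cs (f x) * D)) (at x within S)"
proof -
  have "((\<lambda>x. sin (kap * f x)) has_real_derivative (cos (kap * f x) * (kap * D))) (at x within S)"
    "((\<lambda>x. sinh (kap * f x)) has_real_derivative (cosh (kap * f x) * (kap * D))) (at x within S)"
    by (rule derivative_eq_intros assms refl | simp)+
  then show ?thesis by (cases "K > 0") (simp_all add: cs_def sn_def algebra_simps)
qed

lemma cont_cs [continuous_intros]: "continuous_on S f \<Longrightarrow> continuous_on S (\<lambda>x. cs (f x))"
proof (rule continuous_on_compose2[of UNIV cs])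
  show "continuous_on UNIV cs"
    by (rule DERIV_continuous_on[where D = "\<lambda>x. - eps * kap * sn x * 1"])
       (rule deriv_cs[OF DERIV_ident])
qed auto

lemma cont_sn [continuous_intros]: "continuous_on S f \<Longrightarrow> continuous_on S (\<lambda>x. sn (f x))"
proof (rule continuous_on_compose2[of UNIV sn])
  show "continuous_on UNIV sn"
    by (rule DERIV_continuous_on[where D = "\<lambda>x. kap * cs x * 1"])
       (rule deriv_sn[OF DERIV_ident])
qed auto

lemma cs_le_cosh: "cs t \<le> cosh (kap * t)"
  using cosh_real_ge_1[of "kap*t"] cos_le_one[of "kap*t"]
  by (auto simp: cs_def simp del: cosh_real_ge_1 cos_le_one)

text \<open>Mean value theorem, the derivative \<open>kap * cs\<close> being bounded by
  \<open>cosh\<close> for both signs of K. The constant reappears in the size of the penalty in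
  \<open>angle_comparison\<close>.\<close>

lemma sn_le: "0 \<le> t \<Longrightarrow> t \<le> a \<Longrightarrow> sn t \<le> kap * cosh (kap * a) * t"
proof (cases "t = 0")
  case False
  assume t: "0 \<le> t" "t \<le> a"
  have "\<exists>z. 0 < z \<and> z < t \<and> sn t - sn 0 = (t - 0) * (kap * cs z * 1)"
    by (rule MVT2) (use t False in \<open>auto intro!: derivative_eq_intros\<close>)
  then obtain z where z: "0 < z" "z < t" "sn t = t * (kap * cs z)" by auto
  have "cs z \<le> cosh (kap * z)" by (rule cs_le_cosh)
  also have "\<dots> \<le> cosh (kap * a)"
    using z t kap_pos by (subst cosh_real_nonneg_le_iff) auto
  finally have "t * (kap * cs z) \<le> t * (kap * cosh (kap * a))"
    using kap_pos t by (intro mult_left_mono) auto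
  then show ?thesis using z by (simp add: algebra_simps)
qed simp

text \<open>The cosine of the angle between the sides x and y of a triangle in the model
  plane with sides x, y, z.\<close>
definition rat :: "real \<Rightarrow> real \<Rightarrow> real \<Rightarrow> real" where
  "rat x y z = (cs z - cs x * cs y) / (eps * sn x * sn y)"

lemma angleK_rat: "angleK K x y z = arccos (rat x y z)"
proof (cases "K > 0")
  case True
  then show ?thesis using eps_cases by (auto simp: angleK_def rat_def Let_def cs_def sn_def kap_def)
next
  case False
  have "(cosh u * cosh v - cosh w) / (s * t) = (cosh w - cosh u * cosh v) / (- 1 * s * t)"
    for u v w s t :: real
    by (metis (no_types, opaque_lifting) minus_diff_eq minus_divide_divide mult_minus1 mult_minus_left)
  then show ?thesis using False eps_cases by (auto simp: angleK_def rat_def Let_def cs_def sn_def kap_def)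
qed

lemma rat_commute: "rat x y z = rat y x z"
  by (simp add: rat_def mult.commute mult.left_commute)

lemma rat_law: "sn x \<noteq> 0 \<Longrightarrow> sn y \<noteq> 0 \<Longrightarrow> ip z = eps * cs x * cs y + sn x * sn y * rat x y z"
  using eps_cases by (auto simp: rat_def ip_def field_simps)

text \<open>Once x + y passes pi / kap, monotonicity of \<open>ip\<close> is no longer available.
  The perimeter bound then places z below the reflection of x + y at pi / kap, where the cosine has
  the same value.\<close>

lemma ip_ge_sum:
  assumes "adm x" "adm y" "adm z" "z \<le> x + y" "K > 0 \<longrightarrow> kap * (x + y + z) < 2 * pi"
  shows "ip (x + y) \<le> ip z"
proof (cases "adm (x + y)")
  case True
  then show ?thesis using assms ip_le_iff[of "x+y" z] by auto
next
  case False
  then have K: "K > 0" "kap * (x + y) \<ge> pi" using assms by (auto simp: adm_def)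
  have z: "0 \<le> kap * z" using assms kap_pos by (auto simp: adm_def)
  have "cos (2 * pi - kap * (x + y)) \<le> cos (kap * z)"
    using K assms z by (intro cos_monotone_0_pi_le) (auto simp: algebra_simps)
  then show ?thesis using K eps_cases by (auto simp: ip_def cs_def cos_diff)
qed

text \<open>The ratio equals -1 at z = x + y and 1 at z = |x - y|, so both bounds are triangle
  inequalities read through the monotonicity of \<open>ip\<close>.\<close>

lemma rat_bounds:
  assumes "adm x" "adm y" "adm z" "0 < x" "0 < y" "z \<le> x + y" "x \<le> y + z" "y \<le> x + z"
    "K > 0 \<longrightarrow> kap * (x + y + z) < 2 * pi"
  shows "-1 \<le> rat x y z" "rat x y z \<le> 1"
proof -
  have p: "sn x * sn y > 0" using assms by (auto intro!: mult_pos_pos sn_pos)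
  have ne: "sn x \<noteq> 0" "sn y \<noteq> 0" using p by auto
  have "ip (x + y) \<le> ip z" using assms by (intro ip_ge_sum) auto
  then have "eps * cs x * cs y - sn x * sn y \<le> eps * cs x * cs y + sn x * sn y * rat x y z"
    using rat_law[OF ne, of z] by (simp add: ip_def cs_add algebra_simps)
  then have "sn x * sn y * (-1) \<le> sn x * sn y * rat x y z" by simp
  then show "-1 \<le> rat x y z" using p by (subst (asm) mult_le_cancel_left) auto
  have ad: "adm \<bar>x - y\<bar>"
    using assms adm_mono[of x "\<bar>x-y\<bar>"] adm_mono[of y "\<bar>x-y\<bar>"] adm_nonneg by (cases "x \<le> y") auto
  have "ip z \<le> ip \<bar>x - y\<bar>" using assms ad by (subst ip_le_iff) auto
  then have "eps * cs x * cs y + sn x * sn y * rat x y z \<le> eps * cs x * cs y + sn x * sn y"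
    using rat_law[OF ne, of z] by (simp add: ip_def cs_diff algebra_simps)
  then have "sn x * sn y * rat x y z \<le> sn x * sn y * 1" by simp
  then show "rat x y z \<le> 1" using p by (subst (asm) mult_le_cancel_left) auto
qed

text \<open>The projection formula. Its right-hand side is, up to \<open>kap\<close>, the derivative
  of \<open>ip z\<close> in the law of cosines when x shrinks at a fixed angle; this is its use in
  \<open>variation_bound\<close>.\<close>

lemma rat_proj:
  assumes "sn x \<noteq> 0" "sn y \<noteq> 0" "sn z \<noteq> 0"
  shows "sn z * rat x z y = sn x * cs y - cs x * sn y * rat x y z"
proof -
  have 1: "sn x * (sn z * rat x z y) = eps * (cs y - cs x * cs z)"
    using assms eps_cases by (auto simp: rat_def field_simps)
  have 2: "sn x * (sn y * rat x y z) = eps * (cs z - cs x * cs y)"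
    using assms eps_cases by (auto simp: rat_def field_simps)
  have "sn x * (sn x * cs y - cs x * sn y * rat x y z)
      = sn x ^ 2 * cs y - cs x * (sn x * (sn y * rat x y z))"
    by (simp add: power2_eq_square algebra_simps)
  also have "\<dots> = eps * (1 - cs x ^ 2) * cs y - cs x * (eps * (cs z - cs x * cs y))"
    unfolding 2 pyth' by simp
  also have "\<dots> = sn x * (sn z * rat x z y)"
    unfolding 1 by (simp add: power2_eq_square algebra_simps)
  finally show ?thesis using assms by simp
qed

text \<open>Squared and multiplied by \<open>sn x ^ 2\<close>, both sides become the Gram
  determinant of the triangle, which is symmetric in the three sides.\<close>

lemma rat_sine_law:
  assumes "sn x > 0" "sn y > 0" "sn z > 0" "\<bar>rat x y z\<bar> \<le> 1" "\<bar>rat x z y\<bar> \<le> 1"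
  shows "sn y * sin (arccos (rat x y z)) = sn z * sin (arccos (rat x z y))"
proof -
  have s: "(sn a * sqrt (1 - rat x a b ^ 2))^2 * sn x ^ 2
      = 1 - cs a ^ 2 - cs x ^ 2 - cs b ^ 2 + 2 * cs a * cs x * cs b"
    if "sn a > 0" "\<bar>rat x a b\<bar> \<le> 1" for a b
  proof -
    have e: "sn x * sn a * rat x a b = eps * (cs b - cs x * cs a)"
      using assms that eps_cases by (auto simp: rat_def field_simps)
    have "(sn a * sqrt (1 - rat x a b ^ 2))^2 * sn x ^ 2 = sn x ^ 2 * sn a ^ 2 - (sn x * sn a * rat x a b)^2"
      using that by (simp add: power_mult_distrib abs_square_le_1 algebra_simps)
    also have "\<dots> = eps^2 * (1 - cs x ^ 2) * (1 - cs a ^ 2) - eps^2 * (cs b - cs x * cs a)^2"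
      unfolding e pyth' by (simp add: power_mult_distrib power2_eq_square algebra_simps)
    finally show ?thesis by (simp add: power2_eq_square algebra_simps)
  qed
  have "(sn y * sqrt (1 - rat x y z ^ 2))^2 * sn x ^ 2 = (sn z * sqrt (1 - rat x z y ^ 2))^2 * sn x ^ 2"
    using s[of y z] s[of z y] assms by simp
  then have "(sn y * sqrt (1 - rat x y z ^ 2))^2 = (sn z * sqrt (1 - rat x z y ^ 2))^2"
    using assms by simp
  then have "sn y * sqrt (1 - rat x y z ^ 2) = sn z * sqrt (1 - rat x z y ^ 2)"
    using assms by (subst (asm) power2_eq_iff_nonneg) (auto simp: abs_square_le_1)
  then show ?thesis using assms by (simp add: sin_arccos_abs)
qed

end

section \<open>Shortest curves as isometric paths\<close>

text \<open>A \<open>shortest\<close> may stop and run at any speed. Parametrized by arc length it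
  is an isometric embedding of an interval, from which all distances can be read off.\<close>

definition isopath :: "'a set \<Rightarrow> ('a \<Rightarrow> 'a \<Rightarrow> real) \<Rightarrow> (real \<Rightarrow> 'a) \<Rightarrow> 'a \<Rightarrow> 'a \<Rightarrow> bool" where
  "isopath M d c P Q \<longleftrightarrow> c 0 = P \<and> c (d P Q) = Q \<and> c ` {0..d P Q} \<subseteq> M \<and>
     (\<forall>s\<in>{0..d P Q}. \<forall>t\<in>{0..d P Q}. d (c s) (c t) = \<bar>s - t\<bar>)"

context Metric_space
begin

lemma triangle_abs: "x \<in> M \<Longrightarrow> y \<in> M \<Longrightarrow> z \<in> M \<Longrightarrow> \<bar>d x z - d y z\<bar> \<le> d x y"
  using triangle[of x y z] triangle[of y x z] commute[of x y] by auto

lemma curve_length_ge: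
  assumes "ts \<in> unit_partitions"
  shows "ereal (\<Sum>i < length ts - 1. d (\<gamma> (ts ! i)) (\<gamma> (ts ! Suc i))) \<le> curve_length d \<gamma>"
  unfolding curve_length_def by (rule SUP_upper[OF assms])

lemma shortest_chain:
  assumes "shortest M d P Q \<gamma>" "0 \<le> s" "s \<le> t" "t \<le> 1"
  shows "d (\<gamma> s) (\<gamma> t) = d P (\<gamma> t) - d P (\<gamma> s)" "d P (\<gamma> t) + d (\<gamma> t) Q = d P Q"
proof -
  have M: "\<gamma> r \<in> M" if "0 \<le> r" "r \<le> 1" for r
    using assms that by (auto simp: shortest_def curve_in_def)
  have e: "\<gamma> 0 = P" "\<gamma> 1 = Q" "curve_length d \<gamma> = ereal (d P Q)"
    using assms by (auto simp: shortest_def)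
  \<comment> \<open>The length is the distance of the ends, so in this one partition the triangle
    inequalities must be equalities.\<close>
  have "[0, s, t, 1] \<in> unit_partitions" using assms by (auto simp: unit_partitions_def)
  from curve_length_ge[OF this, of \<gamma>]
  have 1: "d P (\<gamma> s) + d (\<gamma> s) (\<gamma> t) + d (\<gamma> t) Q \<le> d P Q"
    using e by (simp add: lessThan_Suc numeral_3_eq_3 algebra_simps)
  have PQ: "P \<in> M" "Q \<in> M" using M[of 0] M[of 1] e by auto
  have 2: "d P Q \<le> d P (\<gamma> t) + d (\<gamma> t) Q" "d P (\<gamma> t) \<le> d P (\<gamma> s) + d (\<gamma> s) (\<gamma> t)"
    using PQ M assms by (auto intro!: triangle)
  show "d (\<gamma> s) (\<gamma> t) = d P (\<gamma> t) - d P (\<gamma> s)" "d P (\<gamma> t) + d (\<gamma> t) Q = d P Q"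
    using 1 2 by auto
qed

lemma isopath_of_shortest:
  assumes "shortest M d P Q \<gamma>"
  shows "\<exists>c. isopath M d c P Q \<and> c ` {0..d P Q} = \<gamma> ` {0..1}"
proof -
  define g where "g = (\<lambda>t. d P (\<gamma> t))"
  have M: "\<gamma> r \<in> M" if "0 \<le> r" "r \<le> 1" for r
    using assms that by (auto simp: shortest_def curve_in_def)
  have e: "\<gamma> 0 = P" "\<gamma> 1 = Q" using assms by (auto simp: shortest_def)
  have PQ: "P \<in> M" "Q \<in> M" using M[of 0] M[of 1] e by auto
  have g01: "g 0 = 0" "g 1 = d P Q" using e PQ by (auto simp: g_def)
  have dg: "d (\<gamma> s) (\<gamma> t) = \<bar>g s - g t\<bar>" if "s \<in> {0..1}" "t \<in> {0..1}" for s t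
  proof (cases "s \<le> t")
    case True
    then show ?thesis using shortest_chain(1)[OF assms, of s t] that nonneg[of "\<gamma> s" "\<gamma> t"]
      by (auto simp: g_def)
  next
    case False
    then show ?thesis using shortest_chain(1)[OF assms, of t s] that nonneg[of "\<gamma> t" "\<gamma> s"]
        commute[of "\<gamma> s" "\<gamma> t"] by (auto simp: g_def)
  qed
  have gb: "0 \<le> g t" "g t \<le> d P Q" if "t \<in> {0..1}" for t
    using shortest_chain(2)[OF assms, of 0 t] that nonneg[of "\<gamma> t" Q] unfolding g_def
    by (metis nonneg, metis add_increasing2 atLeastAtMost_iff add.commute order_refl le_add_same_cancel1)
  have cont: "continuous_on {0..1} g"
    unfolding continuous_on_iff
  proof (intro ballI allI impI)
    fix x e :: real assume "x \<in> {0..1}" "0 < e"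
    then obtain \<delta> where "\<delta> > 0" "\<forall>s\<in>{0..1}. \<bar>s - x\<bar> < \<delta> \<longrightarrow> d (\<gamma> s) (\<gamma> x) < e"
      using assms unfolding shortest_def curve_in_def by blast
    then show "\<exists>\<delta>>0. \<forall>x'\<in>{0..1}. dist x' x < \<delta> \<longrightarrow> dist (g x') (g x) < e"
      using dg \<open>x \<in> {0..1}\<close> by (metis dist_real_def)
  qed
  \<comment> \<open>Any parameter at distance r from P will do: by \<open>dg\<close>,
    \<open>\<gamma>\<close> is constant wherever \<open>g\<close> is.\<close>
  define \<tau> where "\<tau> = (\<lambda>r. SOME t. t \<in> {0..1} \<and> g t = r)"
  have \<tau>: "\<tau> r \<in> {0..1} \<and> g (\<tau> r) = r" if "r \<in> {0..d P Q}" for r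
  proof -
    have "\<exists>t\<ge>0. t \<le> 1 \<and> g t = r"
      using that g01 cont by (intro IVT') auto
    then have "\<exists>t. t \<in> {0..1} \<and> g t = r" by auto
    then show ?thesis unfolding \<tau>_def by (rule someI_ex)
  qed
  define c where "c = (\<lambda>r. \<gamma> (\<tau> r))"
  have cg: "c (g t) = \<gamma> t" if "t \<in> {0..1}" for t
  proof -
    have "g t \<in> {0..d P Q}" using gb[OF that] by auto
    from \<tau>[OF this] have "d (\<gamma> (\<tau> (g t))) (\<gamma> t) = 0" "\<tau> (g t) \<in> {0..1}" using dg that by auto
    then show ?thesis using M that zero by (auto simp: c_def)
  qed
  have "isopath M d c P Q"
    unfolding isopath_def
  proof (intro conjI ballI)
    show "c 0 = P" "c (d P Q) = Q" using cg[of 0] cg[of 1] g01 e by auto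
    show "c ` {0..d P Q} \<subseteq> M" using \<tau> M by (auto simp: c_def)
    show "d (c s) (c t) = \<bar>s - t\<bar>" if "s \<in> {0..d P Q}" "t \<in> {0..d P Q}" for s t
      using \<tau>[OF that(1)] \<tau>[OF that(2)] dg by (auto simp: c_def)
  qed
  moreover have "c ` {0..d P Q} = \<gamma> ` {0..1}"
  proof
    show "c ` {0..d P Q} \<subseteq> \<gamma> ` {0..1}" using \<tau> by (force simp: c_def)
    show "\<gamma> ` {0..1} \<subseteq> c ` {0..d P Q}"
    proof
      fix X assume "X \<in> \<gamma> ` {0..1}"
      then obtain t where t: "t \<in> {0..1}" "X = \<gamma> t" by auto
      then show "X \<in> c ` {0..d P Q}" using cg[of t] gb[of t] by (metis atLeastAtMost_iff image_eqI)
    qed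
  qed
  ultimately show ?thesis by auto
qed

lemma isopath_image: "(\<lambda>t. c (d P Q * t)) ` {0..1} = c ` {0..d P Q}"
proof -
  have "(\<lambda>t. d P Q * t) ` {0..1} = {0..d P Q}"
    using order.order_iff_strict[of 0 "d P Q"] by (auto simp: image_mult_atLeastAtMost_if)
  then show ?thesis by (metis image_image)
qed

lemma shortest_of_isopath:
  assumes "isopath M d c P Q"
  shows "shortest M d P Q (\<lambda>t. c (d P Q * t))"
proof -
  define L where "L = d P Q"
  have L: "L \<ge> 0" by (simp add: L_def)
  have r: "L * t \<in> {0..L}" if "t \<in> {0..1}" for t
    using that L mult_left_le[of t L] by auto
  have iso: "d (c (L * s)) (c (L * t)) = L * \<bar>s - t\<bar>" if "s \<in> {0..1}" "t \<in> {0..1}" for s t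
  proof -
    have "d (c (L * s)) (c (L * t)) = \<bar>L * s - L * t\<bar>"
      using assms r[OF that(1)] r[OF that(2)] by (auto simp: isopath_def L_def)
    then show ?thesis using L by (simp add: abs_mult flip: right_diff_distrib)
  qed
  have sum: "(\<Sum>i < length ts - 1. d (c (L * ts ! i)) (c (L * ts ! Suc i))) = L"
    if "ts \<in> unit_partitions" for ts
  proof -
    have ts: "ts \<noteq> []" "ts ! 0 = 0" "ts ! (length ts - 1) = 1" "sorted ts"
      using that by (auto simp: unit_partitions_def hd_conv_nth last_conv_nth)
    have b: "ts ! i \<in> {0..1}" if "i < length ts" for i
      using sorted_nth_mono[OF ts(4), of 0 i] sorted_nth_mono[OF ts(4), of i "length ts - 1"] ts that
      by auto
    have "(\<Sum>i < length ts - 1. d (c (L * ts ! i)) (c (L * ts ! Suc i)))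
        = (\<Sum>i < length ts - 1. L * ts ! Suc i - L * ts ! i)"
    proof (rule sum.cong)
      fix i assume "i \<in> {..<length ts - 1}"
      then have i: "Suc i < length ts" by auto
      then have "ts ! i \<le> ts ! Suc i" using ts(4) by (intro sorted_nth_mono) auto
      then show "d (c (L * ts ! i)) (c (L * ts ! Suc i)) = L * ts ! Suc i - L * ts ! i"
        using iso[OF b b, of i "Suc i"] i by (simp add: algebra_simps abs_if)
    qed simp
    also have "\<dots> = L * ts ! (length ts - 1) - L * ts ! 0"
      by (rule sum_lessThan_telescope)
    finally show ?thesis using ts by simp
  qed
  have "[0, 1::real] \<in> unit_partitions" by (auto simp: unit_partitions_def)
  then have ne: "unit_partitions \<noteq> {}" by auto
  have len: "curve_length d (\<lambda>t. c (L * t)) = ereal L"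
    unfolding curve_length_def using sum ne by (simp cong: SUP_cong)
  have "curve_in M d (\<lambda>t. c (L * t))"
    unfolding curve_in_def
  proof (intro conjI ballI allI impI)
    show "(\<lambda>t. c (L * t)) ` {0..1} \<subseteq> M"
      using assms isopath_image[of c P Q] by (auto simp: isopath_def L_def)
    fix t e :: real assume t: "t \<in> {0..1}" and e: "0 < e"
    have "d (c (L * s)) (c (L * t)) < e" if "s \<in> {0..1}" "\<bar>s - t\<bar> < e / (L + 1)" for s
    proof -
      have "L * \<bar>s - t\<bar> \<le> (L + 1) * \<bar>s - t\<bar>" by (simp add: algebra_simps)
      also have "\<dots> < e" using that L by (simp add: pos_less_divide_eq mult.commute)
      finally show ?thesis using iso that t by simp
    qed
    then show "\<exists>\<delta>>0. \<forall>s\<in>{0..1}. \<bar>s - t\<bar> < \<delta> \<longrightarrow> d (c (L * s)) (c (L * t)) < e"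
      using e L by (intro exI[of _ "e / (L + 1)"]) auto
  qed
  then show ?thesis using len assms by (auto simp: shortest_def isopath_def L_def)
qed

lemma isopath_mem: "isopath M d c P Q \<Longrightarrow> 0 \<le> s \<Longrightarrow> s \<le> d P Q \<Longrightarrow> c s \<in> M"
  by (auto simp: isopath_def)

lemma isopath_dist: "isopath M d c P Q \<Longrightarrow> 0 \<le> s \<Longrightarrow> s \<le> d P Q \<Longrightarrow> 0 \<le> t \<Longrightarrow> t \<le> d P Q \<Longrightarrow>
    d (c s) (c t) = \<bar>s - t\<bar>"
  by (auto simp: isopath_def)

lemma isopath_ends: "isopath M d c P Q \<Longrightarrow> c 0 = P" "isopath M d c P Q \<Longrightarrow> c (d P Q) = Q"
  by (auto simp: isopath_def)

lemma isopath_dist_start: "isopath M d c P Q \<Longrightarrow> 0 \<le> s \<Longrightarrow> s \<le> d P Q \<Longrightarrow> d P (c s) = s"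
  and isopath_dist_end: "isopath M d c P Q \<Longrightarrow> 0 \<le> s \<Longrightarrow> s \<le> d P Q \<Longrightarrow> d (c s) Q = d P Q - s"
  using isopath_dist[of c P Q 0 s] isopath_dist[of c P Q s "d P Q"] isopath_ends[of c P Q] by auto

lemma isopath_sub:
  assumes "isopath M d c P Q" "0 \<le> s" "s \<le> t" "t \<le> d P Q"
  shows "isopath M d (\<lambda>r. c (s + r)) (c s) (c t)" "(\<lambda>r. c (s + r)) ` {0..t - s} = c ` {s..t}"
proof -
  have l: "d (c s) (c t) = t - s" using assms isopath_dist[OF assms(1), of s t] by auto
  have i: "(+) s ` {0..t - s} = {s..t}" by simp
  show im: "(\<lambda>r. c (s + r)) ` {0..t - s} = c ` {s..t}"
    unfolding i[symmetric] image_image by simp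
  show "isopath M d (\<lambda>r. c (s + r)) (c s) (c t)"
    unfolding isopath_def l im using assms isopath_mem[OF assms(1)] isopath_dist[OF assms(1)] by auto
qed

lemma isopath_rev:
  assumes "isopath M d c P Q"
  shows "isopath M d (\<lambda>r. c (d P Q - r)) Q P" "(\<lambda>r. c (d P Q - r)) ` {0..d P Q} = c ` {0..d P Q}"
proof -
  have i: "(\<lambda>r. d P Q - r) ` {0..d P Q} = {0..d P Q}" by (simp add: image_diff_atLeastAtMost)
  show im: "(\<lambda>r. c (d P Q - r)) ` {0..d P Q} = c ` {0..d P Q}"
    by (metis i image_image)
  show "isopath M d (\<lambda>r. c (d P Q - r)) Q P"
    unfolding isopath_def commute[of Q P] im
    using assms isopath_mem[OF assms(1)] isopath_dist[OF assms(1)] isopath_ends[OF assms(1)]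
    by auto
qed

lemma isopath_concat:
  assumes "isopath M d c P R" "isopath M d c' R Q" "d P R + d R Q = d P Q"
  shows "isopath M d (\<lambda>s. if s \<le> d P R then c s else c' (s - d P R)) P Q"
proof -
  let ?e = "\<lambda>s. if s \<le> d P R then c s else c' (s - d P R)"
  have PRQ: "P \<in> M" "Q \<in> M" "R \<in> M"
    using isopath_mem[OF assms(1), of 0] isopath_mem[OF assms(1), of "d P R"]
      isopath_mem[OF assms(2), of "d R Q"] isopath_ends[OF assms(1)] isopath_ends[OF assms(2)] by auto
  have mem: "?e s \<in> M" if "0 \<le> s" "s \<le> d P Q" for s
    using isopath_mem[OF assms(1)] isopath_mem[OF assms(2)] assms(3) that by auto
  have x: "d (?e s) (?e t) = t - s" if "0 \<le> s" "s \<le> t" "t \<le> d P Q" for s t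
  proof (cases "t \<le> d P R \<or> \<not> s \<le> d P R")
    case True
    then show ?thesis using isopath_dist[OF assms(1), of s t]
        isopath_dist[OF assms(2), of "s - d P R" "t - d P R"] that assms(3) by auto
  next
    case False
    have a: "d (c s) R = d P R - s" "d P (c s) = s"
      using isopath_dist_end[OF assms(1)] isopath_dist_start[OF assms(1)] False that by auto
    have b: "d R (c' (t - d P R)) = t - d P R" "d (c' (t - d P R)) Q = d P Q - t"
      using isopath_dist_end[OF assms(2)] isopath_dist_start[OF assms(2)] False that assms(3) by auto
    have m: "c s \<in> M" "c' (t - d P R) \<in> M" using mem[of s] mem[of t] False that by auto
    have "d (c s) (c' (t - d P R)) \<le> t - s"
      using triangle[OF m(1) PRQ(3) m(2)] a b by auto
    moreover have "d P Q \<le> d P (c s) + d (c s) (c' (t - d P R)) + d (c' (t - d P R)) Q"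
      using triangle[OF PRQ(1) m(1) PRQ(2)] triangle[OF m(1) m(2) PRQ(2)] by auto
    ultimately show ?thesis using a b False that by auto
  qed
  have "d (?e s) (?e t) = \<bar>s - t\<bar>" if "s \<in> {0..d P Q}" "t \<in> {0..d P Q}" for s t
    using x[of s t] x[of t s] commute[of "?e s" "?e t"] that by (cases "s \<le> t") auto
  moreover have "?e (d P Q) = Q"
  proof (cases "d P Q \<le> d P R")
    case True
    then have "d R Q = 0" using assms(3) nonneg[of R Q] by linarith
    then have "R = Q" "d P R = d P Q" using assms(3) PRQ by auto
    then show ?thesis using isopath_ends(2)[OF assms(1)] by simp
  next
    case False
    have "d P Q - d P R = d R Q" using assms(3) by simp
    then show ?thesis using isopath_ends[OF assms(2)] False by simp
  qed
  moreover have "?e 0 = P" using isopath_ends[OF assms(1)] by auto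
  moreover have "?e ` {0..d P Q} \<subseteq> M" using mem by (intro image_subsetI) simp
  ultimately show ?thesis unfolding isopath_def by blast
qed

text \<open>Replaces curves by betweenness: a point that gives equality in the triangle inequality
  lies on the concatenation of shortests leading to it, which is again a shortest.\<close>

lemma geo_seg_eq:
  assumes geo: "\<And>P Q. P \<in> M \<Longrightarrow> Q \<in> M \<Longrightarrow> \<exists>c. isopath M d c P Q"
    and PQ: "P \<in> M" "Q \<in> M"
  shows "geo_seg M d P Q = {X \<in> M. d P X + d X Q = d P Q}"
proof (intro equalityI subsetI)
  fix X assume "X \<in> geo_seg M d P Q"
  then obtain \<gamma> t where g: "shortest M d P Q \<gamma>" "t \<in> {0..1}" "X = \<gamma> t" by (auto simp: geo_seg_def)
  then show "X \<in> {X \<in> M. d P X + d X Q = d P Q}"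
    using shortest_chain(2)[OF g(1), of t t] by (auto simp: shortest_def curve_in_def)
next
  fix X assume X: "X \<in> {X \<in> M. d P X + d X Q = d P Q}"
  then obtain c c' where c: "isopath M d c P X" "isopath M d c' X Q" using geo PQ by blast
  have e: "isopath M d (\<lambda>s. if s \<le> d P X then c s else c' (s - d P X)) P Q"
    using isopath_concat[OF c] X by auto
  have "X \<in> (\<lambda>s. if s \<le> d P X then c s else c' (s - d P X)) ` {0..d P Q}"
  proof (rule image_eqI[of _ _ "d P X"])
    have "d P X \<le> d P Q" using X nonneg[of X Q] by (auto simp del: nonneg)
    then show "d P X \<in> {0..d P Q}" by simp
  qed (use isopath_ends[OF c(1)] in auto)
  then show "X \<in> geo_seg M d P Q"
    using shortest_of_isopath[OF e] unfolding isopath_image[symmetric] geo_seg_def by blast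
qed

end

section \<open>Upper angles and the first variation inequality\<close>

text \<open>The addition formula with sin u \<le> u and 1 - cos u \<le> u^2/2. The remainder is
  quadratic in L and therefore drops out of the derivative taken in
  \<open>minimal_bound\<close>.\<close>

lemma cos_le_taylor:
  fixes a b L :: real
  assumes "0 \<le> a" "a \<le> pi" "0 \<le> b" "b \<le> pi" "a - L \<le> b" "0 \<le> L"
  shows "cos b \<le> cos a + L * sin a + L\<^sup>2 / 2"
proof (cases "a \<le> b")
  case True
  then have "cos b \<le> cos a" using assms by (intro cos_monotone_0_pi_le) auto
  moreover have "0 \<le> L * sin a" using assms by (intro mult_nonneg_nonneg sin_ge_zero) auto
  moreover have "0 \<le> L\<^sup>2 / 2" by simp
  ultimately show ?thesis by linarith
next
  case False
  define u where "u = a - b"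
  have u: "0 \<le> u" "u \<le> L" using False assms by (auto simp: u_def)
  have "sin (u/2)^2 \<le> (u/2)^2"
    using abs_sin_x_le_abs_x[of "u/2"] unfolding abs_le_square_iff .
  then have c: "1 - cos u \<le> u\<^sup>2/2"
    using cos_double_sin[of "u/2"] by (simp add: power_divide)
  have "\<bar>cos a\<bar> * (1 - cos u) \<le> 1 * (1 - cos u)" by (intro mult_right_mono) auto
  moreover have "- cos a * (1 - cos u) \<le> \<bar>cos a\<bar> * (1 - cos u)" by (intro mult_right_mono) auto
  ultimately have 1: "cos a * cos u \<le> cos a + (1 - cos u)" by (simp add: algebra_simps)
  have 2: "sin u * sin a \<le> L * sin a"
    using u assms sin_x_le_x[of u] by (intro mult_right_mono sin_ge_zero) auto
  have 3: "u\<^sup>2 \<le> L\<^sup>2" using u by (intro power_mono) auto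
  have "cos b = cos a * cos u + sin a * sin u"
    using cos_diff[of a u] by (simp add: u_def)
  then show ?thesis using 1 2 3 c by (simp add: mult.commute)
qed

text \<open>The gain has to be proportional to sin t, not merely positive, because the loss caused
  by the penalty in \<open>minimal_bound\<close> is proportional to the same sine.\<close>

lemma cos_gap:
  fixes s t e :: real
  assumes "0 \<le> s" "s \<le> t - e" "t \<le> pi" "0 < e"
  shows "cos t + sin (e/2) / 2 * sin t < cos s"
proof -
  \<comment> \<open>The midpoint of the interval from t - e to t: the cosines of its ends differ by
    2 sin v sin (e/2), so it suffices that sin t < 4 sin v.\<close>
  define v where "v = t - e/2"
  have v: "0 < v" "v < pi" "t = v + e/2" "t - e = v - e/2" using assms by (auto simp: v_def field_simps)
  have sv: "sin v > 0" using v by (intro sin_gt_zero) auto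
  have se: "sin (e/2) > 0" using assms by (intro sin_gt_zero) auto
  have st: "sin t / 2 < 2 * sin v"
  proof (cases "v \<ge> pi/2")
    case True
    have "cos (v - pi/2) \<ge> cos (t - pi/2)" using True assms v by (intro cos_monotone_0_pi_le) auto
    then have "sin t \<le> sin v" by (simp add: cos_diff)
    then show ?thesis using sv by simp
  next
    case False
    have "sin (t/2) \<le> sin v" using False assms v by (intro sin_monotone_2pi_le) auto
    moreover have "sin t \<le> 2 * sin (t/2)"
      using sin_double[of "t/2"] mult_left_mono[OF cos_le_one[of "t/2"], of "2 * sin (t/2)"]
        sin_ge_zero[of "t/2"] assms by auto
    ultimately show ?thesis using sv by linarith
  qed
  have "cos (t - e) - cos t = 2 * sin v * sin (e/2)"
    unfolding v(4) unfolding v(3) by (simp add: cos_add cos_diff)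
  moreover have "sin t / 2 * sin (e/2) < 2 * sin v * sin (e/2)"
    using st se by (intro mult_strict_right_mono) auto
  moreover have "cos (t - e) \<le> cos s" using assms by (intro cos_monotone_0_pi_le) auto
  ultimately show ?thesis by (simp add: algebra_simps)
qed

context Metric_space
begin

text \<open>Ensures that the sets of angles in \<open>upper_angle\<close> are nonempty at every
  scale, without which their real suprema would carry no information.\<close>

definition accum :: "'a \<Rightarrow> 'a set \<Rightarrow> bool" where
  "accum Z S \<longleftrightarrow> S \<subseteq> M \<and> (\<forall>e>0. \<exists>X\<in>S - {Z}. d Z X < e)"

lemma angle0_bounds:
  assumes "Z \<in> M" "X \<in> M" "Y \<in> M" "X \<noteq> Z" "Y \<noteq> Z"
  shows "\<bar>(d Z X ^ 2 + d Z Y ^ 2 - d X Y ^ 2) / (2 * d Z X * d Z Y)\<bar> \<le> 1"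
proof -
  have p: "d Z X > 0" "d Z Y > 0" using assms by (auto simp: mdist_pos_less)
  have "d X Y \<le> d Z X + d Z Y" "\<bar>d Z X - d Z Y\<bar> \<le> d X Y"
    using triangle[of X Z Y] triangle_abs[of X Y Z] commute[of X Z] commute[of Y Z] assms
    by simp_all
  from power_mono[OF this(1), of 2] power_mono[OF this(2), of 2]
  have "d X Y ^ 2 \<le> (d Z X + d Z Y)^2" "\<bar>d Z X - d Z Y\<bar>^2 \<le> d X Y ^ 2"
    by simp_all
  then have "\<bar>d Z X ^ 2 + d Z Y ^ 2 - d X Y ^ 2\<bar> \<le> 2 * d Z X * d Z Y"
    by (auto simp: power2_eq_square algebra_simps)
  then show ?thesis using p by (simp add: abs_mult)
qed

lemma angle0_range:
  assumes "Z \<in> M" "X \<in> M" "Y \<in> M" "X \<noteq> Z" "Y \<noteq> Z"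
  shows "0 \<le> angle0 d Z X Y" "angle0 d Z X Y \<le> pi"
  unfolding angle0_def using angle0_bounds[OF assms] unfolding abs_le_iff
  by (intro arccos_lbound arccos_ubound; linarith)+

lemma angle_set:
  assumes "Z \<in> M" "accum Z S" "accum Z N" "e > 0"
  defines "T \<equiv> {angle0 d Z X Y | X Y. X \<in> S - {Z} \<and> Y \<in> N - {Z} \<and> d Z X < e \<and> d Z Y < e}"
  shows "T \<noteq> {}" "T \<subseteq> {0..pi}" "bdd_above T" "0 \<le> Sup T" "Sup T \<le> pi"
proof -
  have "\<exists>X\<in>S - {Z}. d Z X < e" "\<exists>Y\<in>N - {Z}. d Z Y < e"
    using assms(2-4) unfolding accum_def by simp_all
  then obtain X Y where "X \<in> S - {Z}" "d Z X < e" "Y \<in> N - {Z}" "d Z Y < e" by auto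
  then show ne: "T \<noteq> {}" unfolding T_def by blast
  show sub: "T \<subseteq> {0..pi}"
  proof
    fix t assume "t \<in> T"
    then obtain X Y where "t = angle0 d Z X Y" "X \<in> S - {Z}" "Y \<in> N - {Z}" unfolding T_def by blast
    then show "t \<in> {0..pi}" using angle0_range[OF assms(1), of X Y] assms(2,3) unfolding accum_def by auto
  qed
  then show bdd: "bdd_above T" by (meson bdd_above.unfold atLeastAtMost_iff subset_iff)
  obtain t where "t \<in> T" using ne by auto
  then show "0 \<le> Sup T" using sub cSup_upper[OF _ bdd, of t] by force
  show "Sup T \<le> pi" using sub ne by (intro cSup_least) auto
qed

lemma upper_angle_le_Sup:
  assumes "Z \<in> M" "accum Z S" "accum Z N" "e > 0"
  shows "upper_angle d Z S N
    \<le> Sup {angle0 d Z X Y | X Y. X \<in> S - {Z} \<and> Y \<in> N - {Z} \<and> d Z X < e \<and> d Z Y < e}"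
  unfolding upper_angle_def
proof (rule cInf_lower)
  show "bdd_below {Sup {angle0 d Z X Y | X Y. X \<in> S - {Z} \<and> Y \<in> N - {Z} \<and> d Z X < e \<and> d Z Y < e} | e. e > 0}"
    using angle_set(4)[OF assms(1-3)] by (intro bdd_belowI[of _ 0]) auto
qed (use assms in blast)

lemma upper_angle_ge:
  assumes "\<And>e. e > 0 \<Longrightarrow>
    v \<le> Sup {angle0 d Z X Y | X Y. X \<in> S - {Z} \<and> Y \<in> N - {Z} \<and> d Z X < e \<and> d Z Y < e}"
  shows "v \<le> upper_angle d Z S N"
  unfolding upper_angle_def
proof (rule cInf_greatest)
  show "{Sup {angle0 d Z X Y | X Y. X \<in> S - {Z} \<and> Y \<in> N - {Z} \<and> d Z X < e \<and> d Z Y < e} | e. e > (0::real)} \<noteq> {}"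
    by (auto intro: exI[of _ 1])
qed (use assms in auto)

lemma upper_angle_range:
  assumes "Z \<in> M" "accum Z S" "accum Z N"
  shows "0 \<le> upper_angle d Z S N" "upper_angle d Z S N \<le> pi"
  using upper_angle_ge[of 0 Z S N] angle_set(4,5)[OF assms] upper_angle_le_Sup[OF assms, of 1]
  by (auto intro: order_trans[OF _ angle_set(5)[OF assms, of 1]])

text \<open>Only points near the vertex enter the limsup, so enlarging the sets beyond a fixed
  radius, or shrinking them there, has no influence.\<close>

lemma upper_angle_germ_le:
  assumes "Z \<in> M" "accum Z S" "accum Z N" "accum Z S'" "accum Z N'" "e0 > 0"
    "\<And>X. X \<in> S \<Longrightarrow> d Z X < e0 \<Longrightarrow> X \<in> S'" "\<And>X. X \<in> N \<Longrightarrow> d Z X < e0 \<Longrightarrow> X \<in> N'"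
  shows "upper_angle d Z S N \<le> upper_angle d Z S' N'"
proof (rule upper_angle_ge)
  fix e :: real assume "e > 0"
  then have m: "min e e0 > 0" using assms by auto
  have "upper_angle d Z S N
    \<le> Sup {angle0 d Z X Y | X Y. X \<in> S - {Z} \<and> Y \<in> N - {Z} \<and> d Z X < min e e0 \<and> d Z Y < min e e0}"
    using assms m by (intro upper_angle_le_Sup)
  also have "\<dots> \<le> Sup {angle0 d Z X Y | X Y. X \<in> S' - {Z} \<and> Y \<in> N' - {Z} \<and> d Z X < e \<and> d Z Y < e}"
    using angle_set(1)[OF assms(1-3) m] angle_set(3)[OF assms(1,4,5) \<open>e > 0\<close>]
  proof (rule cSup_subset_mono)
    show "{angle0 d Z X Y | X Y. X \<in> S - {Z} \<and> Y \<in> N - {Z} \<and> d Z X < min e e0 \<and> d Z Y < min e e0}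
      \<subseteq> {angle0 d Z X Y | X Y. X \<in> S' - {Z} \<and> Y \<in> N' - {Z} \<and> d Z X < e \<and> d Z Y < e}"
      using assms(7,8) by auto
  qed
  finally show "upper_angle d Z S N
    \<le> Sup {angle0 d Z X Y | X Y. X \<in> S' - {Z} \<and> Y \<in> N' - {Z} \<and> d Z X < e \<and> d Z Y < e}" .
qed

lemma upper_angle_commute: 
  assumes "Z \<in> M" "S \<subseteq> M" "N \<subseteq> M"
  shows "upper_angle d Z S N = upper_angle d Z N S"
proof -
  have a: "angle0 d Z X Y = angle0 d Z Y X" for X Y
    unfolding angle0_def commute[of X Y] by (simp add: algebra_simps)
  have "{angle0 d Z X Y | X Y. X \<in> S - {Z} \<and> Y \<in> N - {Z} \<and> d Z X < e \<and> d Z Y < e}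
      = {angle0 d Z X Y | X Y. X \<in> N - {Z} \<and> Y \<in> S - {Z} \<and> d Z X < e \<and> d Z Y < e}" for e
    using a by (auto 0 3)
  then show ?thesis unfolding upper_angle_def by simp
qed

lemma isopath_in: "isopath M d c P Q \<Longrightarrow> P \<in> M \<and> Q \<in> M"
  using isopath_mem[of c P Q 0] isopath_mem[of c P Q "d P Q"] isopath_ends[of c P Q] by auto

lemma isopath_point_ne: 
  assumes "isopath M d c P Q" "0 < s" "s \<le> d P Q"
  shows "c s \<noteq> P"
proof
  assume "c s = P"
  then have "d P P = s" using isopath_dist_start[OF assms(1), of s] assms by auto
  then show False using assms isopath_in[OF assms(1)] by auto
qed

lemma accum_isopath:
  assumes "isopath M d c P Q" "0 < s" "s \<le> d P Q"
  shows "accum P (c ` {0..s})"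
  unfolding accum_def
proof (intro conjI allI impI)
  show "c ` {0..s} \<subseteq> M" using isopath_mem[OF assms(1)] assms by auto
  fix e :: real assume "e > 0"
  define r where "r = min s (e/2)"
  have r: "0 < r" "r \<le> s" "r < e" using \<open>e > 0\<close> assms by (auto simp: r_def)
  then show "\<exists>X\<in>c ` {0..s} - {P}. d P X < e"
    using isopath_point_ne[OF assms(1), of r] isopath_dist_start[OF assms(1), of r] assms
    by (intro bexI[of _ "c r"]) auto
qed

lemma upper_angle_restrict:
  assumes c: "isopath M d c P Q" "0 < s" "s \<le> d P Q" and c': "isopath M d c' P Q'" "0 < s'" "s' \<le> d P Q'"
  shows "upper_angle d P (c ` {0..d P Q}) (c' ` {0..d P Q'}) \<le> upper_angle d P (c ` {0..s}) (c' ` {0..s'})"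
proof (rule upper_angle_germ_le)
  show "0 < min s s'" using assms by auto
  show "X \<in> c ` {0..s}" if "X \<in> c ` {0..d P Q}" "d P X < min s s'" for X
    using that isopath_dist_start[OF c(1)] by force
  show "X \<in> c' ` {0..s'}" if "X \<in> c' ` {0..d P Q'}" "d P X < min s s'" for X
    using that isopath_dist_start[OF c'(1)] by force
qed (use assms isopath_in[OF c(1)] accum_isopath[OF c(1)] accum_isopath[OF c'(1)]
    accum_isopath[OF c(1) order_less_le_trans[OF c(2,3)] order_refl]
    accum_isopath[OF c'(1) order_less_le_trans[OF c'(2,3)] order_refl] in auto)

text \<open>The limsup controls pairs of points whose distances to X are small independently of each
  other. So a point \<open>e r\<close> can be kept fixed on one side while h tends to 0 on the
  other; the Euclidean law of cosines bounds \<open>d (c h) (e r)\<close>, and the rest of the way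
  to C is a triangle inequality.\<close>

lemma first_variation:
  assumes c: "isopath M d c X A" and e: "isopath M d e X C" and ne: "X \<noteq> A" "X \<noteq> C"
    and k: "k < cos (upper_angle d X (c ` {0..d X A}) (e ` {0..d X C}))"
  shows "\<exists>\<delta>>0. \<delta> \<le> d X A \<and> (\<forall>h. 0 < h \<and> h < \<delta> \<longrightarrow> d (c h) C \<le> d X C - h * k)"
proof -
  have M: "X \<in> M" "A \<in> M" "C \<in> M" using isopath_in[OF c] isopath_in[OF e] by auto
  have pos: "d X A > 0" "d X C > 0" using M ne by (auto simp: mdist_pos_less)
  define \<xi> where "\<xi> = upper_angle d X (c ` {0..d X A}) (e ` {0..d X C})"
  have acc: "accum X (c ` {0..d X A})" "accum X (e ` {0..d X C})"
    using accum_isopath[OF c pos(1)] accum_isopath[OF e pos(2)] by auto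
  have \<xi>: "0 \<le> \<xi>" "\<xi> \<le> pi" using upper_angle_range[OF M(1) acc] by (auto simp: \<xi>_def)
  show ?thesis
  proof (cases "k < -1")
    case True
    have "d (c h) C \<le> d X C - h * k" if "0 < h" "h < d X A" for h
    proof -
      have "d (c h) C \<le> d (c h) X + d X C" "d (c h) X = h"
        using triangle[of "c h" X C] isopath_mem[OF c] isopath_dist_start[OF c, of h] that M
          commute[of X "c h"] by auto
      moreover have "h * k \<le> h * (-1)" using True that by (intro mult_left_mono) auto
      ultimately show ?thesis by auto
    qed
    then show ?thesis using pos by (intro exI[of _ "d X A"]) auto
  next
    case False
    \<comment> \<open>The part between m and \<open>cos \<xi>\<close> yields a scale s at which all
      comparison angles stay below arccos m; the part between k and m absorbs the second-order
      error.\<close>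
    define m where "m = (k + cos \<xi>) / 2"
    have m: "-1 \<le> m" "m \<le> 1" "m < cos \<xi>" "k < m"
      using False k cos_le_one[of \<xi>] unfolding m_def \<xi>_def[symmetric] by (simp_all del: cos_le_one)
    have "arccos (cos \<xi>) < arccos m" using m by (intro arccos_less_arccos) auto
    then have "\<xi> < arccos m" using \<xi> by (simp add: arccos_cos)
    then have "\<exists>v\<in>{Sup {angle0 d X U V | U V. U \<in> c ` {0..d X A} - {X} \<and> V \<in> e ` {0..d X C} - {X} \<and> d X U < s \<and> d X V < s} | s. s > 0}. v < arccos m"
      using cInf_lessD[of "{Sup {angle0 d X U V | U V. U \<in> c ` {0..d X A} - {X} \<and> V \<in> e ` {0..d X C} - {X} \<and> d X U < s \<and> d X V < s} | s. s > 0}" "arccos m"]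
      unfolding \<xi>_def upper_angle_def using zero_less_one by blast
    then obtain s where s: "s > 0"
      "Sup {angle0 d X U V | U V. U \<in> c ` {0..d X A} - {X} \<and> V \<in> e ` {0..d X C} - {X} \<and> d X U < s \<and> d X V < s} < arccos m"
      by blast
    define r where "r = min (s/2) (d X C)"
    have r: "0 < r" "r < s" "r \<le> d X C" using s pos by (auto simp: r_def)
    \<comment> \<open>The last bound makes the error h^2 / (2 r) at most h (m - k).\<close>
    define \<delta> where "\<delta> = min (min (d X A) s) (2 * r * (m - k))"
    have "d (c h) C \<le> d X C - h * k" if h: "0 < h" "h < \<delta>" for h
    proof -
      have hb: "h < d X A" "h < s" "h < 2 * r * (m - k)" using h by (auto simp: \<delta>_def)
      have d1: "d X (c h) = h" "d X (e r) = r" "d (e r) C = d X C - r"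
        using isopath_dist_start[OF c, of h] isopath_dist_start[OF e, of r] isopath_dist_end[OF e, of r] h hb r
        by auto
      have ne': "c h \<noteq> X" "e r \<noteq> X" using isopath_point_ne[OF c, of h] isopath_point_ne[OF e, of r] h hb r by auto
      have M': "c h \<in> M" "e r \<in> M" using isopath_mem[OF c, of h] isopath_mem[OF e, of r] h hb r by auto
      have "angle0 d X (c h) (e r) \<le> Sup {angle0 d X U V | U V. U \<in> c ` {0..d X A} - {X} \<and> V \<in> e ` {0..d X C} - {X} \<and> d X U < s \<and> d X V < s}"
      proof (intro cSup_upper)
        have "c h \<in> c ` {0..d X A} - {X}" "e r \<in> e ` {0..d X C} - {X}" "d X (c h) < s" "d X (e r) < s"
          using ne' d1 h hb r by auto
        then show "angle0 d X (c h) (e r) \<in> {angle0 d X U V | U V. U \<in> c ` {0..d X A} - {X} \<and> V \<in> e ` {0..d X C} - {X} \<and> d X U < s \<and> d X V < s}"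
          by blast
      qed (rule angle_set(3)[OF M(1) acc s(1)])
      then have "angle0 d X (c h) (e r) < arccos m" using s by linarith
      then have "m \<le> (h^2 + r^2 - d (c h) (e r)^2) / (2 * h * r)"
        using angle0_bounds[OF M(1) M' ne'] m d1
        unfolding angle0_def by (smt (verit) arccos_le_arccos abs_le_iff)
      then have q: "d (c h) (e r)^2 \<le> h^2 + r^2 - 2 * h * r * m"
        using h r by (simp add: pos_le_divide_eq algebra_simps)
      \<comment> \<open>Explicit upper bound for the root of h^2 + r^2 - 2 h r m: the square of u
        exceeds this by a square.\<close>
      define u where "u = r - h * m + h^2 / (2 * r)"
      have "u^2 = h^2 + r^2 - 2 * h * r * m + (h^2/(2*r) - h*m)^2"
        using r by (simp add: u_def power2_eq_square field_simps)
      then have "d (c h) (e r)^2 \<le> u^2" using q by (smt (verit) zero_le_power2)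
      moreover have "u \<ge> 0"
      proof -
        have "r - h + h^2/(2*r) = ((r - h)^2 + r^2) / (2 * r)" using r by (simp add: power2_eq_square field_simps)
        also have "\<dots> \<ge> 0" using r by auto
        finally have "r - h + h^2/(2*r) \<ge> 0" .
        moreover have "h * m \<le> h * 1" using h m by (intro mult_left_mono) auto
        ultimately show ?thesis by (simp add: u_def)
      qed
      ultimately have "d (c h) (e r) \<le> u" by (rule power2_le_imp_le)
      moreover have "h^2 / (2 * r) \<le> h * (m - k)"
      proof -
        have "h * h \<le> h * (2 * r * (m - k))" using hb h by (intro mult_left_mono) auto
        then show ?thesis using r by (simp add: power2_eq_square field_simps)
      qed
      moreover have "d (c h) C \<le> d (c h) (e r) + d (e r) C" using M M' by (intro triangle)
      ultimately show ?thesis using d1 by (simp add: u_def algebra_simps)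
    qed
    moreover have "\<delta> > 0" "\<delta> \<le> d X A" using pos s r m by (auto simp: \<delta>_def)
    ultimately show ?thesis by blast
  qed
qed

end

section \<open>Comparison of angles\<close>

lemma le_of_all_less: "(\<And>k. k < (a::real) \<Longrightarrow> k \<le> b) \<Longrightarrow> a \<le> b"
  by (rule dense_le) auto

context ktrig
begin

lemma rat_degenerate:
  assumes "sn x \<noteq> 0" "sn y \<noteq> 0"
  shows "rat x y (x + y) = -1" "rat x y (x - y) = 1" "rat x y (y - x) = 1"
  using assms eps_cases by (auto simp: rat_def cs_add cs_diff mult.commute)

text \<open>The two sides of \<open>ev\<close> agree at h = 0 by the law of cosines. Hence their
  difference, being nonnegative for small h > 0, has a nonnegative derivative at 0, which
  \<open>rat_proj\<close> expresses through the angle between x and z.\<close>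

lemma variation_bound:
  assumes "0 < x" "sn x > 0" "sn y > 0" "sn z > 0" "0 < \<delta>"
    and w: "w 0 = rat x y z" "(w has_real_derivative W) (at 0)"
    and ev: "\<And>h. 0 < h \<Longrightarrow> h < \<delta> \<Longrightarrow> ip (z - h * k) \<le> eps * cs (x - h) * cs y + sn (x - h) * sn y * w h"
  shows "k \<le> rat x z y + sn x * sn y * W / (kap * sn z)"
proof -
  define f where "f = (\<lambda>h. eps * cs (x - h) * cs y + sn (x - h) * sn y * w h - ip (z - h * k))"
  define D where "D = kap * (sn x * cs y - cs x * sn y * rat x y z) + sn x * sn y * W - kap * k * sn z"
  have der: "(f has_real_derivative D) (at 0)"
    unfolding f_def ip_def
    by (rule derivative_eq_intros refl w(2) | simp; fail)+
       (simp add: D_def w(1) algebra_simps)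
  have f0: "f 0 = 0"
    using rat_law[of x y z] assms by (simp add: f_def)
  have "D \<ge> 0"
  proof (rule ccontr)
    assume "\<not> D \<ge> 0"
    then obtain e where e: "e > 0" "\<forall>h>0. h < e \<longrightarrow> f (0 + h) < f 0"
      using DERIV_neg_dec_right[OF der] by auto
    define h where "h = min (e/2) (\<delta>/2)"
    have h: "0 < h" "h < e" "h < \<delta>" using e assms by (auto simp: h_def)
    have "f h \<ge> 0" using ev[OF h(1,3)] by (simp add: f_def)
    then show False using e h f0 by auto
  qed
  moreover have "D = kap * sn z * (rat x z y + sn x * sn y * W / (kap * sn z) - k)"
  proof -
    have p: "sn x * cs y - cs x * sn y * rat x y z = sn z * rat x z y"
      using rat_proj[of x y z] assms by simp
    show ?thesis unfolding D_def p using kap_pos assms(4) by (simp add: field_simps)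
  qed
  moreover have "kap * sn z > 0" using kap_pos assms by simp
  ultimately have "0 \<le> rat x z y + sn x * sn y * W / (kap * sn z) - k"
    using zero_le_mult_iff[of "kap * sn z"] by auto
  then show ?thesis by simp
qed

end

section \<open>Upper angles and comparison angles in an R_K domain\<close>

locale rk_space = ktrig K + Metric_space M d for K and M :: "'a set" and d +
  assumes RK: "RK_domain K M d"
begin

lemma isopath_exists: "P \<in> M \<Longrightarrow> Q \<in> M \<Longrightarrow> \<exists>c. isopath M d c P Q"
  using RK isopath_of_shortest unfolding RK_domain_def by meson

lemma perimeter:
  assumes "A \<in> M" "B \<in> M" "C \<in> M" "K > 0"
  shows "kap * (d A B + d B C + d C A) < 2 * pi"
proof -
  have "d A B + d B C + d C A < 2 * pi / sqrt K" using RK assms unfolding RK_domain_def by blast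
  then show ?thesis using assms kap_pos by (simp add: kap_def pos_less_divide_eq mult.commute)
qed

lemma adm_dist: "A \<in> M \<Longrightarrow> B \<in> M \<Longrightarrow> adm (d A B)"
  using perimeter[of A B A] commute[of A B] by (auto simp: adm_def)

lemma rat_dist_bounds:
  assumes "A \<in> M" "B \<in> M" "C \<in> M" "A \<noteq> B" "A \<noteq> C"
  shows "\<bar>rat (d A B) (d A C) (d B C)\<bar> \<le> 1"
proof -
  have "0 < d A B" "0 < d A C" using assms by (auto simp: mdist_pos_less)
  moreover have "d B C \<le> d A B + d A C" "d A B \<le> d A C + d B C" "d A C \<le> d A B + d B C"
    using triangle[of B A C] triangle[of A C B] triangle[of A B C] commute[of A B] commute[of B C] assms by auto
  moreover have "K > 0 \<longrightarrow> kap * (d A B + d A C + d B C) < 2 * pi"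
    using perimeter[OF assms(1-3)] commute[of A C] by (simp add: algebra_simps)
  ultimately have "-1 \<le> rat (d A B) (d A C) (d B C)" "rat (d A B) (d A C) (d B C) \<le> 1"
    using rat_bounds[of "d A B" "d A C" "d B C"] adm_dist assms by blast+
  then show ?thesis by auto
qed

lemma angle_sum:
  assumes "isopath M d c1 A B" "isopath M d c2 B C" "isopath M d c3 C A" "A \<noteq> B" "B \<noteq> C" "C \<noteq> A"
  shows "upper_angle d A (c1 ` {0..d A B}) (c3 ` {0..d C A})
      + upper_angle d B (c1 ` {0..d A B}) (c2 ` {0..d B C})
      + upper_angle d C (c2 ` {0..d B C}) (c3 ` {0..d C A})
    \<le> arccos (rat (d A B) (d A C) (d B C)) + arccos (rat (d B A) (d B C) (d A C))
      + arccos (rat (d C A) (d C B) (d A B))"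
proof -
  have "A \<in> M" "B \<in> M" "C \<in> M" using isopath_in assms by auto
  then show ?thesis
    using RK assms(4-6) shortest_of_isopath[OF assms(1)] shortest_of_isopath[OF assms(2)] shortest_of_isopath[OF assms(3)]
    unfolding RK_domain_def angleK_rat isopath_image[symmetric] by blast
qed

text \<open>Moving X to \<open>c h\<close>, the first variation bounds the new distance to Y from
  above, while w bounds the cosine of the new comparison angle at A and thus, through the law of
  cosines, the same distance from below. Since \<open>first_variation\<close> only reaches slopes k
  strictly below the cosine, the conclusion is a limit over k.\<close>

lemma variation_compare:
  assumes c: "isopath M d c X A" and e: "isopath M d e X Y" and ne: "X \<noteq> A" "X \<noteq> Y" "A \<noteq> Y"
    and w: "w 0 = rat (d X A) (d A Y) (d X Y)" "(w has_real_derivative W) (at 0)" and "0 < \<delta>"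
    and le: "\<And>h. 0 < h \<Longrightarrow> h < \<delta> \<Longrightarrow> h < d X A \<Longrightarrow> rat (d X A - h) (d A Y) (d (c h) Y) \<le> w h"
  shows "cos (upper_angle d X (c ` {0..d X A}) (e ` {0..d X Y}))
    \<le> rat (d X A) (d X Y) (d A Y) + sn (d X A) * sn (d A Y) * W / (kap * sn (d X Y))"
proof (rule le_of_all_less)
  fix k assume k: "k < cos (upper_angle d X (c ` {0..d X A}) (e ` {0..d X Y}))"
  define x y z where "x = d X A" and "y = d A Y" and "z = d X Y"
  have M: "X \<in> M" "A \<in> M" "Y \<in> M" using isopath_in[OF c] isopath_in[OF e] by auto
  have pos: "0 < x" "0 < y" "0 < z" using ne M by (auto simp: mdist_pos_less x_def y_def z_def)
  have adm: "adm x" "adm y" "adm z" using adm_dist M by (auto simp: x_def y_def z_def)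
  have snp: "sn x > 0" "sn y > 0" "sn z > 0" using pos adm sn_pos by auto
  from first_variation[OF c e ne(1,2) k]
  obtain \<delta>1 where d1: "\<delta>1 > 0" "\<delta>1 \<le> x" "\<And>h. 0 < h \<Longrightarrow> h < \<delta>1 \<Longrightarrow> d (c h) Y \<le> z - h * k"
    by (auto simp: x_def z_def)
  \<comment> \<open>For negative k the bound z - h k exceeds z; it has to stay in the range where
    \<open>ip\<close> is monotone.\<close>
  have "\<exists>\<delta>2>0. \<forall>h. 0 < h \<and> h < \<delta>2 \<and> K > 0 \<longrightarrow> kap * (z - h * k) < pi"
  proof (cases "K > 0")
    case True
    have "kap * z < pi" using adm(3) True by (simp add: adm_def)
    then have "z < pi / kap" using kap_pos by (simp add: pos_less_divide_eq mult.commute)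
    then have p: "(pi / kap - z) / (\<bar>k\<bar> + 1) > 0" by (intro divide_pos_pos) auto
    have "kap * (z - h * k) < pi" if "0 < h" "h < (pi / kap - z) / (\<bar>k\<bar> + 1)" for h
    proof -
      have "h * (\<bar>k\<bar> + 1) < pi / kap - z" using that by (simp add: pos_less_divide_eq)
      moreover have "- (h * k) \<le> h * (\<bar>k\<bar> + 1)"
        using that mult_left_mono[of "- k" "\<bar>k\<bar> + 1" h] by auto
      ultimately have "z - h * k < pi / kap" by linarith
      then show ?thesis using kap_pos by (simp add: pos_less_divide_eq mult.commute)
    qed
    then show ?thesis using p by blast
  qed (auto intro: exI[of _ 1])
  then obtain \<delta>2 where d2: "\<delta>2 > 0" "\<And>h. 0 < h \<Longrightarrow> h < \<delta>2 \<Longrightarrow> K > 0 \<Longrightarrow> kap * (z - h * k) < pi" by blast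
  have "k \<le> rat x z y + sn x * sn y * W / (kap * sn z)"
  proof (rule variation_bound[of x y z "min \<delta> (min \<delta>1 \<delta>2)" w])
    show "0 < min \<delta> (min \<delta>1 \<delta>2)" using d1 d2 \<open>0 < \<delta>\<close> by auto
    fix h assume h: "0 < h" "h < min \<delta> (min \<delta>1 \<delta>2)"
    then have hx: "h < x" using d1 by auto
    define z' where "z' = d (c h) Y"
    have M': "c h \<in> M" using isopath_mem[OF c, of h] h hx by (auto simp: x_def)
    have snh: "sn (x - h) > 0" using adm_mono[OF adm(1), of "x - h"] h hx sn_pos[of "x - h"] by auto
    have z'z: "z' \<le> z - h * k" "0 \<le> z'" using d1 h by (auto simp: z'_def)
    have "adm (z - h * k)" using z'z d2(2)[of h] h by (auto simp: adm_def)
    then have "ip (z - h * k) \<le> ip z'"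
      using z'z adm_dist[of "c h" Y] M M' by (subst ip_le_iff) (auto simp: z'_def)
    also have "ip z' = eps * cs (x - h) * cs y + sn (x - h) * sn y * rat (x - h) y z'"
      using rat_law[of "x - h" y z'] snh snp by simp
    also have "\<dots> \<le> eps * cs (x - h) * cs y + sn (x - h) * sn y * w h"
      using le[of h] h hx snh snp
      by (intro add_left_mono mult_left_mono) (auto simp: x_def y_def z'_def)
    finally show "ip (z - h * k) \<le> eps * cs (x - h) * cs y + sn (x - h) * sn y * w h" .
  qed (use pos snp w in \<open>auto simp: x_def y_def z_def\<close>)
  then show "k \<le> rat (d X A) (d X Y) (d A Y) + sn (d X A) * sn (d A Y) * W / (kap * sn (d X Y))"
    by (simp add: x_def y_def z_def)
qed

text \<open>At a point where the comparison angle at \<open>A\<close>, penalised by a logarithm, cannot be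
  decreased by moving along the side, the first variation bounds the angle at that point
  from below by almost the comparison angle.\<close>
lemma minimal_bound:
  assumes c: "isopath M d c X A" and e: "isopath M d e X Y" and ne: "X \<noteq> A" "X \<noteq> Y" "A \<noteq> Y"
    and m: "0 \<le> m" and H: "d X A \<le> H"
    and min: "\<And>h. 0 < h \<Longrightarrow> h < d X A \<Longrightarrow>
      arccos (rat (d X A) (d A Y) (d X Y)) - m * (ln (d X A) - ln (d X A - h))
        \<le> arccos (rat (d X A - h) (d A Y) (d (c h) Y))"
  shows "cos (upper_angle d X (c ` {0..d X A}) (e ` {0..d X Y}))
    \<le> rat (d X A) (d X Y) (d A Y) + m * cosh (kap * H) * sin (arccos (rat (d X A) (d X Y) (d A Y)))"
proof -
  define x y z where "x = d X A" and "y = d A Y" and "z = d X Y"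
  have M: "X \<in> M" "A \<in> M" "Y \<in> M" using isopath_in[OF c] isopath_in[OF e] by auto
  have pos: "0 < x" "0 < y" "0 < z" using ne M by (auto simp: mdist_pos_less x_def y_def z_def)
  have adm: "adm x" "adm y" "adm z" using adm_dist M by (auto simp: x_def y_def z_def)
  have snp: "sn x > 0" "sn y > 0" "sn z > 0" using pos adm sn_pos by auto
  have r1: "\<bar>rat x y z\<bar> \<le> 1" "\<bar>rat x z y\<bar> \<le> 1"
    using rat_dist_bounds[of A X Y] rat_dist_bounds[of X A Y] M ne commute[of A X]
    by (auto simp: x_def y_def z_def)
  define L where "L = (\<lambda>h. m * (ln x - ln (x - h)))"
  define s where "s = sin (arccos (rat x y z))"
  have "cos (upper_angle d X (c ` {0..d X A}) (e ` {0..d X Y}))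
    \<le> rat (d X A) (d X Y) (d A Y) + sn (d X A) * sn (d A Y) * (m / x * s) / (kap * sn (d X Y))"
  \<comment> \<open>By minimality the comparison angle at A drops by at most \<open>L h\<close>, the
    increase of the penalty; \<open>cos_le_taylor\<close> turns this into a differentiable bound for
    its cosine.\<close>
  proof (rule variation_compare[OF c e ne, where w = "\<lambda>h. rat x y z + L h * s + (L h)\<^sup>2 / 2" and \<delta> = 1])
    show "((\<lambda>h. rat x y z + L h * s + (L h)\<^sup>2 / 2) has_real_derivative m / x * s) (at 0)"
      unfolding L_def using pos(1) by (auto intro!: derivative_eq_intros simp: field_simps)
    fix h assume h: "0 < h" "h < d X A"
    define q' where "q' = rat (x - h) y (d (c h) Y)"
    have M': "c h \<in> M" using isopath_mem[OF c, of h] h by (auto simp: x_def)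
    have dA: "d (c h) A = x - h" using isopath_dist_end[OF c, of h] h by (auto simp: x_def)
    then have neA: "A \<noteq> c h" using h M by (auto simp: x_def)
    have q': "\<bar>q'\<bar> \<le> 1"
      using rat_dist_bounds[of A "c h" Y] M M' ne neA dA commute[of A "c h"] by (auto simp: q'_def y_def)
    have L: "L h \<ge> 0" using m h by (auto simp: L_def x_def intro!: mult_nonneg_nonneg)
    have "arccos (rat x y z) - L h \<le> arccos q'"
      using min[of h] h by (auto simp: x_def y_def z_def L_def q'_def)
    then have "cos (arccos q') \<le> cos (arccos (rat x y z)) + L h * s + (L h)\<^sup>2 / 2"
      unfolding s_def using L q' r1
      by (intro cos_le_taylor) (auto simp: arccos_lbound arccos_ubound abs_le_iff)
    then show "rat (d X A - h) (d A Y) (d (c h) Y) \<le> rat x y z + L h * s + (L h)\<^sup>2 / 2"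
      using q' r1 by (auto simp: cos_arccos_abs q'_def x_def y_def)
  qed (auto simp: L_def x_def y_def z_def)
  \<comment> \<open>The sine law replaces the sine of the angle at A by that of the angle at X and
    cancels \<open>sn z\<close>, so the error is proportional to the sine that occurs in
    \<open>cos_gap\<close>.\<close>
  also have "sn (d X A) * sn (d A Y) * (m / x * s) / (kap * sn (d X Y))
    = m * (sn x / (kap * x)) * (sn y * s) / sn z"
    using pos kap_pos snp by (simp add: x_def y_def z_def field_simps)
  also have "\<dots> = m * (sn x / (kap * x)) * sin (arccos (rat x z y))"
    unfolding s_def rat_sine_law[OF snp r1] using snp by simp
  also have "m * (sn x / (kap * x)) * sin (arccos (rat x z y)) \<le> m * cosh (kap * H) * sin (arccos (rat x z y))"
  proof (intro mult_right_mono mult_left_mono)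
    have "sn x \<le> kap * cosh (kap * x) * x" using sn_le[of x x] pos by simp
    then have "sn x / (kap * x) \<le> cosh (kap * x)" using pos kap_pos by (simp add: field_simps)
    also have "\<dots> \<le> cosh (kap * H)"
      using H pos kap_pos by (subst cosh_real_nonneg_le_iff) (auto simp: x_def)
    finally show "sn x / (kap * x) \<le> cosh (kap * H)" .
    show "0 \<le> sin (arccos (rat x z y))"
      using r1 by (intro sin_ge_zero arccos_lbound arccos_ubound) (auto simp: abs_le_iff)
  qed (rule m)
  finally show ?thesis by (simp add: x_def y_def z_def)
qed

end

context rk_space
begin

text \<open>Insert the midpoint N of p and take the triangle A N X. Its comparison angles are 0, pi,
  0, and the straight angle at N already uses up pi. Uniqueness of shortests is not yet known, and
  this serves the case in \<open>angle_comparison\<close> where two sides meet again.\<close>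

lemma bigon_angle:
  assumes p: "isopath M d p A X" and q: "isopath M d q A X" and ne: "A \<noteq> X"
  shows "upper_angle d A (p ` {0..d A X}) (q ` {0..d A X}) \<le> 0"
proof -
  define L N where "L = d A X" and "N = p (L / 2)"
  have M: "A \<in> M" "X \<in> M" using isopath_in[OF p] by auto
  have L: "L > 0" "L/2 > 0" using ne M by (auto simp: L_def mdist_pos_less)
  have N: "N \<in> M" using isopath_mem[OF p, of "L/2"] L by (auto simp: N_def L_def)
  have dd: "d A N = L/2" "d N X = L/2" "d A X = L"
    using isopath_dist_start[OF p, of "L/2"] isopath_dist_end[OF p, of "L/2"] L by (auto simp: N_def L_def)
  have ne': "A \<noteq> N" "N \<noteq> X" using dd L M by auto
  have p1: "isopath M d p A N"
    using isopath_sub(1)[OF p, of 0 "L/2"] isopath_ends[OF p] L by (simp add: N_def L_def)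
  have p2: "isopath M d (\<lambda>r. p (L/2 + r)) N X" and im2: "(\<lambda>r. p (L/2 + r)) ` {0..L/2} = p ` {L/2..L}"
    using isopath_sub[OF p, of "L/2" L] isopath_ends[OF p] L by (auto simp: N_def L_def)
  note q' = isopath_rev[OF q]
  note p1' = isopath_rev[OF p1]
  have q3: "isopath M d (\<lambda>r. q (L - r)) X A" "(\<lambda>r. q (L - r)) ` {0..L} = q ` {0..L}"
    using q' by (simp_all add: L_def)
  have accN: "accum N (p ` {0..L/2})" "accum N (p ` {L/2..L})"
    using accum_isopath[OF p1'(1), of "L/2"] p1'(2) accum_isopath[OF p2, of "L/2"] im2 L dd commute[of N A]
    by simp_all
  have accX: "accum X (p ` {L/2..L})" "accum X (q ` {0..L})"
    using accum_isopath[OF isopath_rev(1)[OF p2], of "L/2"] isopath_rev(2)[OF p2] im2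
      accum_isopath[OF q3(1), of L] q3(2) L dd commute[of N X] commute[of A X]
    by simp_all
  \<comment> \<open>Points at distance r from N on either side are 2 r apart, so the Euclidean angle
    pi occurs at every scale.\<close>
  have angN: "pi \<le> upper_angle d N (p ` {0..L/2}) (p ` {L/2..L})"
  proof (rule upper_angle_ge)
    fix e :: real assume e: "e > 0"
    define r where "r = min (L/2) (e/2)"
    have r: "0 < r" "r \<le> L/2" "r < e" using e L by (auto simp: r_def)
    have dr: "d N (p (L/2 - r)) = r" "d N (p (L/2 + r)) = r" "d (p (L/2 - r)) (p (L/2 + r)) = 2 * r"
      using isopath_dist[OF p, of "L/2" "L/2 - r"] isopath_dist[OF p, of "L/2" "L/2 + r"]
        isopath_dist[OF p, of "L/2 - r" "L/2 + r"] r by (auto simp: N_def L_def)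
    have neN: "p (L/2 - r) \<noteq> N" "p (L/2 + r) \<noteq> N" using dr r N by auto
    have mem: "p (L/2 - r) \<in> p ` {0..L/2} - {N}" "p (L/2 + r) \<in> p ` {L/2..L} - {N}"
      using neN r by auto
    have a: "angle0 d N (p (L/2 - r)) (p (L/2 + r)) = pi"
    proof -
      have "(r\<^sup>2 + r\<^sup>2 - (2 * r)\<^sup>2) / (2 * r * r) = -1" using r by (simp add: power2_eq_square field_simps)
      then show ?thesis unfolding angle0_def dr by simp
    qed
    show "pi \<le> Sup {angle0 d N U V | U V. U \<in> p ` {0..L/2} - {N} \<and> V \<in> p ` {L/2..L} - {N} \<and> d N U < e \<and> d N V < e}"
    proof (rule cSup_upper)
      show "pi \<in> {angle0 d N U V | U V. U \<in> p ` {0..L/2} - {N} \<and> V \<in> p ` {L/2..L} - {N} \<and> d N U < e \<and> d N V < e}"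
        using a mem dr r by (metis (mono_tags, lifting) mem_Collect_eq)
    qed (rule angle_set(3)[OF N accN e])
  qed
  have angX: "0 \<le> upper_angle d X (p ` {L/2..L}) (q ` {0..L})"
    using upper_angle_range[OF M(2) accX] by simp
  have snz: "sn L \<noteq> 0" "sn (L/2) \<noteq> 0"
    using sn_pos[of L] sn_pos[of "L/2"] adm_dist[of A X] adm_dist[of A N] M N L dd by auto
  have r: "rat (L/2) L (L/2) = 1" "rat (L/2) (L/2) L = -1" "rat L (L/2) (L/2) = 1"
    using rat_degenerate(1)[OF snz(2,2)] rat_degenerate(3)[OF snz(2,1)] rat_degenerate(2)[OF snz(1,2)] by simp_all
  have "upper_angle d A (p ` {0..L/2}) (q ` {0..L}) + upper_angle d N (p ` {0..L/2}) (p ` {L/2..L})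
      + upper_angle d X (p ` {L/2..L}) (q ` {0..L}) \<le> 0 + pi + 0"
    using angle_sum[OF p1 p2 q3(1) ne'] ne im2 q3(2) dd commute[of N A] commute[of X N] commute[of X A] r
    by simp
  moreover have "upper_angle d A (p ` {0..L}) (q ` {0..L}) \<le> upper_angle d A (p ` {0..L/2}) (q ` {0..L})"
    using upper_angle_restrict[OF p, of "L/2" q X L] q L dd(3) by simp
  ultimately show ?thesis using angN angX by (simp add: L_def)
qed

text \<open>Angle sums leave a deficit of e at X or Y in every triangle A X Y. At a minimum of the
  penalised comparison angle, \<open>minimal_bound\<close> says that the angle at either point is
  almost at least its comparison angle, and \<open>cos_gap\<close> makes the two
  incompatible.\<close>

lemma angle_comparison:
  assumes c1: "isopath M d c1 A B" and c2: "isopath M d c2 A C" and ne: "A \<noteq> B" "A \<noteq> C"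
  shows "upper_angle d A (c1 ` {0..d A B}) (c2 ` {0..d A C}) \<le> arccos (rat (d A B) (d A C) (d B C))"
proof (rule ccontr)
  define a b where "a = d A B" and "b = d A C"
  define \<alpha> where "\<alpha> = upper_angle d A (c1 ` {0..a}) (c2 ` {0..b})"
  define \<phi> where "\<phi> = (\<lambda>x y. arccos (rat x y (d (c1 x) (c2 y))))"
  assume "\<not> ?thesis"
  then have lt: "\<phi> a b < \<alpha>"
    using isopath_ends[OF c1] isopath_ends[OF c2] by (simp add: \<phi>_def \<alpha>_def a_def b_def)
  have M: "A \<in> M" "B \<in> M" "C \<in> M" using isopath_in[OF c1] isopath_in[OF c2] by auto
  have pos: "a > 0" "b > 0" using M ne by (auto simp: a_def b_def mdist_pos_less)
  have mem: "c1 x \<in> M" "c2 y \<in> M" "d A (c1 x) = x" "d A (c2 y) = y"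
    if "0 \<le> x" "x \<le> a" "0 \<le> y" "y \<le> b" for x y
    using isopath_mem[OF c1] isopath_mem[OF c2] isopath_dist_start[OF c1] isopath_dist_start[OF c2] that
    by (auto simp: a_def b_def)
  have rb: "\<bar>rat x y (d (c1 x) (c2 y))\<bar> \<le> 1" if "0 < x" "x \<le> a" "0 < y" "y \<le> b" for x y
  proof -
    have "A \<noteq> c1 x" "A \<noteq> c2 y" using mem[of x y] that M by auto
    then show ?thesis using rat_dist_bounds[of A "c1 x" "c2 y"] mem[of x y] that M by auto
  qed
  have \<phi>b: "0 \<le> \<phi> x y" "\<phi> x y \<le> pi" if "0 < x" "x \<le> a" "0 < y" "y \<le> b" for x y
    using rb[OF that] by (auto simp: \<phi>_def arccos_lbound arccos_ubound abs_le_iff)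
  have acc: "accum A (c1 ` {0..a})" "accum A (c2 ` {0..b})"
    using accum_isopath[OF c1, of a] accum_isopath[OF c2, of b] pos by (auto simp: a_def b_def)
  have \<alpha>pi: "\<alpha> \<le> pi" using upper_angle_range[OF M(1) acc] by (simp add: \<alpha>_def)
  define e where "e = (\<alpha> - \<phi> a b) / 2"
  have e: "0 < e" "e \<le> pi / 2" using lt \<alpha>pi \<phi>b[of a b] pos by (auto simp: e_def)
  define H where "H = a + b"
  \<comment> \<open>Chosen so that the loss \<open>m * cosh (kap * H)\<close> in
    \<open>minimal_bound\<close> equals the gain in \<open>cos_gap\<close>, which is strict.\<close>
  define m where "m = sin (e/2) / 2 / cosh (kap * H)"
  have mH: "m * cosh (kap * H) = sin (e/2) / 2" using cosh_real_pos[of "kap * H"] by (simp add: m_def)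
  have mpos: "m > 0" using e by (auto simp: m_def intro!: divide_pos_pos sin_gt_zero)
  \<comment> \<open>The penalty vanishes at (a, b) and is infinite at the vertex. Its slope m / x is
    harmless since \<open>sn x\<close> is at most a multiple of x.\<close>
  define G where "G = (\<lambda>x y. \<phi> x y + m * (ln a - ln x) + m * (ln b - ln y))"
  obtain x y where xy: "0 < x" "x \<le> a" "0 < y" "y \<le> b"
    and min: "\<And>x' y'. 0 < x' \<Longrightarrow> x' \<le> a \<Longrightarrow> 0 < y' \<Longrightarrow> y' \<le> b \<Longrightarrow> G x y \<le> G x' y'"
  proof -
    \<comment> \<open>Below t a or t b a single penalty is at least pi + 1, more than the value pi
      that bounds G at (a, b); so the minimum over the compact square is one over all pairs.\<close>
    define t where "t = exp (- ((pi + 1) / m))"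
    have t: "0 < t" "t < 1" using mpos pi_gt_zero by (auto simp: t_def add_pos_pos intro!: divide_pos_pos)
    have ta: "0 < t * a" "t * a \<le> a" "0 < t * b" "t * b \<le> b"
      using t pos by (auto simp: mult_le_cancel_right1)
    define S where "S = {t * a..a} \<times> {t * b..b}"
    have "continuous_on S (\<lambda>z. d (c1 (fst z)) (c2 (snd z)))"
      unfolding continuous_on_iff
    proof (intro ballI allI impI)
      fix z \<epsilon> assume z: "z \<in> S" and "0 < (\<epsilon>::real)"
      have "dist (d (c1 (fst z')) (c2 (snd z'))) (d (c1 (fst z)) (c2 (snd z))) < \<epsilon>"
        if z': "z' \<in> S" "dist z' z < \<epsilon> / 2" for z'
      proof -
        have r: "0 \<le> fst z" "fst z \<le> a" "0 \<le> snd z" "snd z \<le> b" "0 \<le> fst z'" "fst z' \<le> a" "0 \<le> snd z'" "snd z' \<le> b"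
          using z z' ta by (auto simp: S_def)
        have m': "c1 (fst z) \<in> M" "c2 (snd z) \<in> M" "c1 (fst z') \<in> M" "c2 (snd z') \<in> M"
          using mem r by auto
        have "d (c1 (fst z')) (c1 (fst z)) = \<bar>fst z' - fst z\<bar>" "d (c2 (snd z')) (c2 (snd z)) = \<bar>snd z' - snd z\<bar>"
          using isopath_dist[OF c1] isopath_dist[OF c2] r by (auto simp: a_def b_def)
        moreover have "\<bar>fst z' - fst z\<bar> < \<epsilon>/2" "\<bar>snd z' - snd z\<bar> < \<epsilon>/2"
          using z'(2) dist_fst_le[of z' z] dist_snd_le[of z' z] by (auto simp: dist_real_def)
        moreover have "\<bar>d (c1 (fst z')) (c2 (snd z')) - d (c1 (fst z)) (c2 (snd z'))\<bar> \<le> d (c1 (fst z')) (c1 (fst z))"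
          "\<bar>d (c2 (snd z')) (c1 (fst z)) - d (c2 (snd z)) (c1 (fst z))\<bar> \<le> d (c2 (snd z')) (c2 (snd z))"
          using triangle_abs m' by blast+
        ultimately show ?thesis
          using commute[of "c2 (snd z')" "c1 (fst z)"] commute[of "c2 (snd z)" "c1 (fst z)"]
          unfolding dist_real_def by linarith
      qed
      then show "\<exists>\<delta>>0. \<forall>z'\<in>S. dist z' z < \<delta> \<longrightarrow>
          dist (d (c1 (fst z')) (c2 (snd z'))) (d (c1 (fst z)) (c2 (snd z))) < \<epsilon>"
        using \<open>0 < \<epsilon>\<close> by (intro exI[of _ "\<epsilon>/2"]) auto
    qed
    moreover have "eps * sn (fst z) * sn (snd z) \<noteq> 0" if "z \<in> S" for z
    proof -
      have "sn (fst z) > 0" "sn (snd z) > 0"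
        using that ta adm_mono[OF adm_dist[OF M(1,2)], of "fst z"] adm_mono[OF adm_dist[OF M(1,3)], of "snd z"]
        by (auto simp: S_def a_def b_def intro!: sn_pos)
      then show ?thesis using eps_cases by auto
    qed
    ultimately have "continuous_on S (\<lambda>z. rat (fst z) (snd z) (d (c1 (fst z)) (c2 (snd z))))"
      unfolding rat_def by (intro continuous_intros) auto
    then have "continuous_on S (\<lambda>z. \<phi> (fst z) (snd z))"
      unfolding \<phi>_def using rb ta by (intro continuous_on_arccos) (auto simp: S_def abs_le_iff dest!: spec)
    then have cont: "continuous_on S (\<lambda>z. G (fst z) (snd z))"
      unfolding G_def using ta by (intro continuous_intros) (auto simp: S_def)
    have "compact S" "S \<noteq> {}" using ta by (auto simp: S_def intro!: compact_Times)
    from continuous_attains_inf[OF this cont] obtain z where z: "z \<in> S"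
      "\<And>z'. z' \<in> S \<Longrightarrow> G (fst z) (snd z) \<le> G (fst z') (snd z')" by blast
    have Gab: "G (fst z) (snd z) \<le> pi" using z(2)[of "(a, b)"] ta \<phi>b[of a b] pos by (auto simp: S_def G_def)
    show thesis
    proof (rule that[of "fst z" "snd z"])
      fix x' y' assume x': "0 < x'" "x' \<le> a" and y': "0 < y'" "y' \<le> b"
      show "G (fst z) (snd z) \<le> G x' y'"
      proof (cases "(x', y') \<in> S")
        case True
        then show ?thesis using z(2)[of "(x', y')"] by simp
      next
        case False
        have far: "pi + 1 \<le> m * (ln v - ln u)" if "0 < u" "u < t * v" "0 < v" for u v
        proof -
          have "ln u \<le> ln (t * v)" using that by simp
          also have "\<dots> = ln t + ln v" using that t by (simp add: ln_mult)
          also have "ln t = - ((pi + 1) / m)" by (simp add: t_def)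
          finally have "(pi + 1) / m \<le> ln v - ln u" by simp
          then show ?thesis using mpos by (simp add: pos_divide_le_eq mult.commute)
        qed
        have "0 \<le> m * (ln a - ln x')" "0 \<le> m * (ln b - ln y')" using x' y' mpos by auto
        moreover have "pi + 1 \<le> m * (ln a - ln x') \<or> pi + 1 \<le> m * (ln b - ln y')"
          using False x' y' far[of x' a] far[of y' b] pos by (auto simp: S_def)
        ultimately show ?thesis using Gab \<phi>b(1)[OF x' y'] unfolding G_def by linarith
      qed
    qed (use z(1) ta in \<open>auto simp: S_def\<close>)
  qed
  define X Y where "X = c1 x" and "Y = c2 y"
  have XY: "X \<in> M" "Y \<in> M" "d A X = x" "d A Y = y" "d X A = x" "d Y A = y"
    using mem[of x y] xy commute by (auto simp: X_def Y_def)
  have neA: "X \<noteq> A" "Y \<noteq> A" using XY xy M by auto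
  have \<phi>le: "\<phi> x y \<le> \<phi> a b"
  proof -
    have "0 \<le> m * (ln a - ln x)" "0 \<le> m * (ln b - ln y)" using xy mpos by auto
    then show ?thesis using min[of a b] pos unfolding G_def by auto
  qed
  have p: "isopath M d c1 A X" and q: "isopath M d c2 A Y"
    using isopath_sub(1)[OF c1, of 0 x] isopath_sub(1)[OF c2, of 0 y] xy isopath_ends[OF c1] isopath_ends[OF c2]
    by (auto simp: X_def Y_def a_def b_def)
  have \<alpha>le: "\<alpha> \<le> upper_angle d A (c1 ` {0..x}) (c2 ` {0..y})"
    unfolding \<alpha>_def a_def b_def
    using upper_angle_restrict[OF c1 _ _ c2, of x y] xy by (auto simp: a_def b_def)
  show False
  \<comment> \<open>Without a triangle A X Y the angle sum says nothing; the two sides then bound a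
    bigon.\<close>
  proof (cases "X = Y")
    case True
    then have "x = y" using XY by auto
    then have "\<alpha> \<le> 0" using \<alpha>le bigon_angle[OF p, of c2] q True neA XY by auto
    then show False using lt \<phi>b(1)[of a b] pos by auto
  next
    case False
    obtain g where g: "isopath M d g X Y" using isopath_exists XY by blast
    have g': "isopath M d (\<lambda>r. g (d X Y - r)) Y X" "(\<lambda>r. g (d X Y - r)) ` {0..d X Y} = g ` {0..d X Y}"
      using isopath_rev[OF g] by auto
    have p': "isopath M d (\<lambda>r. c1 (x - r)) X A" "(\<lambda>r. c1 (x - r)) ` {0..x} = c1 ` {0..x}"
      using isopath_rev[OF p] XY by auto
    have q': "isopath M d (\<lambda>r. c2 (y - r)) Y A" "(\<lambda>r. c2 (y - r)) ` {0..y} = c2 ` {0..y}"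
      using isopath_rev[OF q] XY by auto
    define z where "z = d X Y"
    have dYX: "d Y X = z" using commute by (simp add: z_def)
    define \<xi> \<eta> where "\<xi> = upper_angle d X (c1 ` {0..x}) (g ` {0..z})"
      and "\<eta> = upper_angle d Y (c2 ` {0..y}) (g ` {0..z})"
    define \<xi>0 \<eta>0 where "\<xi>0 = arccos (rat x z y)" and "\<eta>0 = arccos (rat y z x)"
    have zpos: "z > 0" using False XY by (auto simp: z_def mdist_pos_less)
    have sub: "g ` {0..z} \<subseteq> M" "c2 ` {0..y} \<subseteq> M" "c1 ` {0..x} \<subseteq> M"
      using isopath_mem[OF g] isopath_mem[OF p] isopath_mem[OF q] XY by (auto simp: z_def)
    have r: "\<bar>rat x z y\<bar> \<le> 1" "\<bar>rat y z x\<bar> \<le> 1"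
      using rat_dist_bounds[of X A Y] rat_dist_bounds[of Y A X] XY M neA False dYX by (auto simp: z_def)
    have acc2: "accum X (c1 ` {0..x})" "accum X (g ` {0..z})" "accum Y (c2 ` {0..y})" "accum Y (g ` {0..z})"
      using accum_isopath[OF p'(1), of x] accum_isopath[OF q'(1), of y] accum_isopath[OF g, of z]
        accum_isopath[OF g'(1), of z] p'(2) q'(2) g'(2) XY xy zpos dYX by (auto simp: z_def)
    have rng: "0 \<le> \<xi>" "0 \<le> \<eta>" "\<xi>0 \<le> pi" "\<eta>0 \<le> pi"
      using upper_angle_range[OF XY(1) acc2(1,2)] upper_angle_range[OF XY(2) acc2(3,4)] r
      by (auto simp: \<xi>_def \<eta>_def \<xi>0_def \<eta>0_def arccos_ubound abs_le_iff)
    have "upper_angle d A (c1 ` {0..x}) (c2 ` {0..y}) + \<xi> + \<eta> \<le> \<phi> x y + \<xi>0 + \<eta>0"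
      using angle_sum[OF p g q'(1)] neA False XY dYX q'(2) rat_commute[of z y x]
        upper_angle_commute[OF XY(2) sub(1,2)]
      by (auto simp: \<xi>_def \<eta>_def \<xi>0_def \<eta>0_def \<phi>_def z_def X_def Y_def)
    moreover have "2 * e = \<alpha> - \<phi> a b" by (simp add: e_def)
    \<comment> \<open>The excess at A is at least 2 e, as the comparison angle at the minimum does
      not exceed the one at (a, b); hence one of the two remaining vertices lacks e.\<close>
    ultimately have "\<xi> \<le> \<xi>0 - e \<or> \<eta> \<le> \<eta>0 - e" using \<alpha>le \<phi>le by linarith
    then show False
    proof
      assume "\<xi> \<le> \<xi>0 - e"
      then have "cos \<xi>0 + sin (e/2) / 2 * sin \<xi>0 < cos \<xi>" using rng e by (intro cos_gap) auto
      moreover have "cos \<xi> \<le> cos \<xi>0 + m * cosh (kap * H) * sin \<xi>0"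
      proof -
        have "cos (upper_angle d X ((\<lambda>r. c1 (x - r)) ` {0..d X A}) (g ` {0..d X Y}))
          \<le> rat (d X A) (d X Y) (d A Y) + m * cosh (kap * H) * sin (arccos (rat (d X A) (d X Y) (d A Y)))"
        proof (rule minimal_bound[OF p'(1) g neA(1) False])
          fix h assume h: "0 < h" "h < d X A"
          have "G x y \<le> G (x - h) y" using min[of "x - h" y] h XY xy by auto
          then have "\<phi> x y - m * (ln x - ln (x - h)) \<le> \<phi> (x - h) y" unfolding G_def by (simp add: algebra_simps)
          then show "arccos (rat (d X A) (d A Y) (d X Y)) - m * (ln (d X A) - ln (d X A - h))
            \<le> arccos (rat (d X A - h) (d A Y) (d (c1 (x - h)) Y))"
            using XY by (simp add: \<phi>_def X_def[symmetric] Y_def[symmetric])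
        qed (use neA mpos xy pos XY in \<open>auto simp: H_def\<close>)
        then show ?thesis using XY p'(2) r by (simp add: \<xi>_def \<xi>0_def z_def cos_arccos_abs)
      qed
      ultimately show False unfolding mH by simp
    next
      assume "\<eta> \<le> \<eta>0 - e"
      then have "cos \<eta>0 + sin (e/2) / 2 * sin \<eta>0 < cos \<eta>" using rng e by (intro cos_gap) auto
      moreover have "cos \<eta> \<le> cos \<eta>0 + m * cosh (kap * H) * sin \<eta>0"
      proof -
        have "cos (upper_angle d Y ((\<lambda>r. c2 (y - r)) ` {0..d Y A}) ((\<lambda>r. g (d X Y - r)) ` {0..d Y X}))
          \<le> rat (d Y A) (d Y X) (d A X) + m * cosh (kap * H) * sin (arccos (rat (d Y A) (d Y X) (d A X)))"
        proof (rule minimal_bound[OF q'(1) g'(1) neA(2) False[symmetric]])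
          fix h assume h: "0 < h" "h < d Y A"
          have "G x y \<le> G x (y - h)" using min[of x "y - h"] h XY xy by auto
          then have "\<phi> x y - m * (ln y - ln (y - h)) \<le> \<phi> x (y - h)" unfolding G_def by (simp add: algebra_simps)
          then show "arccos (rat (d Y A) (d A X) (d Y X)) - m * (ln (d Y A) - ln (d Y A - h))
            \<le> arccos (rat (d Y A - h) (d A X) (d (c2 (y - h)) X))"
            using XY rat_commute commute[of Y X] commute[of X "c2 (y - h)"]
            by (simp add: \<phi>_def X_def[symmetric] Y_def[symmetric])
        qed (use neA mpos xy pos XY in \<open>auto simp: H_def\<close>)
        then show ?thesis using XY q'(2) g'(2) r dYX by (simp add: \<eta>_def \<eta>0_def z_def cos_arccos_abs)
      qed
      ultimately show False unfolding mH by simp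
    qed
  qed
qed

end

section \<open>Concavity along geodesics\<close>

context rk_space
begin

text \<open>By the law of cosines the claim says that the comparison angle at P of the triangle P,
  \<open>c x\<close>, Y does not decrease with x. If it did, then at a suitable X moving back
  towards P would, by the first variation, make the upper angle at X larger than its comparison
  angle, against \<open>angle_comparison\<close>.\<close>

lemma cat_inequality:
  assumes M: "P \<in> M" "Q \<in> M" "R \<in> M" "Y \<in> M" and PRQ: "d P R + d R Q = d P Q"
  shows "sn (d R Q) * ip (d Y P) + sn (d P R) * ip (d Y Q) \<le> sn (d P Q) * ip (d Y R)"
proof (cases "P = R \<or> R = Q")
  case True
  then show ?thesis using M by auto
next
  case False
  define a s where "a = d P Q" and "s = d P R"
  have pos: "0 < s" "s < a" "d R Q = a - s"
    using False M PRQ by (auto simp: a_def s_def mdist_pos_less simp flip: PRQ)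
  obtain c1 c2 where "isopath M d c1 P R" "isopath M d c2 R Q" using isopath_exists M by meson
  note con = isopath_concat[OF this PRQ]
  define c where "c = (\<lambda>s. if s \<le> d P R then c1 s else c2 (s - d P R))"
  have c: "isopath M d c P Q" using con by (simp add: c_def)
  have cs': "c s = R" "c a = Q" "c 0 = P"
    using isopath_ends[OF \<open>isopath M d c1 P R\<close>] isopath_ends[OF c] by (auto simp: c_def s_def a_def)
  show ?thesis
  \<comment> \<open>If the geodesic passes through Y, the variation argument has no triangle at that
    point. There the claim is an identity between addition formulas.\<close>
  proof (cases "\<exists>t\<ge>0. t \<le> a \<and> c t = Y")
    case True
    then obtain t where t: "0 \<le> t" "t \<le> a" "Y = c t" by auto
    have dd: "d Y P = t" "d Y Q = a - t" "d Y R = \<bar>t - s\<bar>"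
      using isopath_dist[OF c, of t 0] isopath_dist[OF c, of t a] isopath_dist[OF c, of t s] t pos cs'
      by (auto simp: a_def)
    have "sn (a - s) * cs t + sn s * cs (a - t) = sn a * cs (t - s)"
    proof -
      have "sn (a - s) * cs t + sn s * cs (a - t) - sn a * cs (t - s)
        = sn s * cs a * (-1 + 1) * cs t + sn s * eps * sn a * sn t - sn a * eps * sn t * sn s"
        by (simp add: sn_diff cs_diff algebra_simps)
      then show ?thesis by (simp add: algebra_simps)
    qed
    then have "eps * (sn (a - s) * cs t + sn s * cs (a - t)) = eps * (sn a * cs (t - s))" by simp
    then show ?thesis
      unfolding a_def[symmetric] s_def[symmetric] pos(3) dd ip_def by (simp add: distrib_left mult.left_commute)
  next
    case False
    define y where "y = d P Y"
    define r where "r = (\<lambda>x. rat x y (d (c x) Y))"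
    have neY: "c x \<noteq> Y" if "0 \<le> x" "x \<le> a" for x using False that by auto
    have mem: "c x \<in> M" if "0 \<le> x" "x \<le> a" for x using isopath_mem[OF c] that by (auto simp: a_def)
    have PY: "P \<noteq> Y" using neY[of 0] cs' pos by auto
    have snp: "sn x > 0" if "0 < x" "x \<le> a" for x
      using adm_mono[OF adm_dist[OF M(1,2)], of x] that by (auto simp: a_def intro!: sn_pos)
    have sny: "sn y > 0" using adm_dist[OF M(1,4)] PY M by (auto simp: y_def mdist_pos_less intro!: sn_pos)
    have mono: "r a \<le> r s"
    proof (rule ccontr)
      assume "\<not> r a \<le> r s"
      then have rr: "r s < r a" by simp
      \<comment> \<open>Half the mean slope of r: after subtracting \<open>\<mu> * x\<close> the
        value at a still exceeds the one at s, so the maximum is not at s and can be approached from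
        its left.\<close>
      define \<mu> where "\<mu> = (r a - r s) / (2 * (a - s))"
      have \<mu>: "\<mu> > 0" "\<mu> * (a - s) < r a - r s" using rr pos by (auto simp: \<mu>_def field_simps)
      have "continuous_on {s..a} (\<lambda>x. d (c x) Y)"
        unfolding continuous_on_iff
      proof (intro ballI allI impI)
        fix x \<epsilon> assume x: "x \<in> {s..a}" and "0 < (\<epsilon>::real)"
        have "dist (d (c x') Y) (d (c x) Y) < \<epsilon>" if "x' \<in> {s..a}" "dist x' x < \<epsilon>" for x'
          using isopath_dist[OF c, of x' x] triangle_abs[of "c x'" "c x" Y] mem[of x'] mem[of x] x that pos M
          by (auto simp: dist_real_def a_def)
        then show "\<exists>\<delta>>0. \<forall>x'\<in>{s..a}. dist x' x < \<delta> \<longrightarrow> dist (d (c x') Y) (d (c x) Y) < \<epsilon>"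
          using \<open>0 < \<epsilon>\<close> by blast
      qed
      moreover have "eps * sn x * sn y \<noteq> 0" if "x \<in> {s..a}" for x
        using snp[of x] sny that pos eps_cases by auto
      ultimately have "continuous_on {s..a} (\<lambda>x. r x - \<mu> * x)"
        unfolding r_def rat_def by (intro continuous_intros) auto
      then obtain x where x: "x \<in> {s..a}" and max: "\<And>x'. x' \<in> {s..a} \<Longrightarrow> r x' - \<mu> * x' \<le> r x - \<mu> * x"
        using continuous_attains_sup[of "{s..a}" "\<lambda>x. r x - \<mu> * x"] pos by auto
      have "x \<noteq> s" using max[of a] \<mu> pos by (auto simp: algebra_simps)
      then have xs: "s < x" "x \<le> a" "0 < x" using x pos by auto
      define X where "X = c x"
      have X: "X \<in> M" "d P X = x" "d X P = x" "X \<noteq> P" "X \<noteq> Y"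
        using mem[of x] isopath_dist_start[OF c, of x] commute[of X P] xs neY[of x] M by (auto simp: X_def a_def)
      have p: "isopath M d c P X" using isopath_sub(1)[OF c, of 0 x] xs cs' by (auto simp: X_def a_def)
      have p': "isopath M d (\<lambda>r. c (x - r)) X P" using isopath_rev(1)[OF p] X by auto
      obtain e where e: "isopath M d e X Y" using isopath_exists X M by blast
      have snz: "sn (d X Y) > 0" using adm_dist[of X Y] X M by (auto simp: mdist_pos_less intro!: sn_pos)
      define \<xi> where "\<xi> = upper_angle d X ((\<lambda>r. c (x - r)) ` {0..d X P}) (e ` {0..d X Y})"
      have rb: "\<bar>rat x (d X Y) y\<bar> \<le> 1" using rat_dist_bounds[of X P Y] X M by (auto simp: y_def)
      have "cos \<xi> \<le> rat (d X P) (d X Y) (d P Y) + sn (d X P) * sn (d P Y) * (- \<mu>) / (kap * sn (d X Y))"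
        unfolding \<xi>_def
      proof (rule variation_compare[OF p' e X(4,5) PY, where w = "\<lambda>h. r x - \<mu> * h" and \<delta> = "x - s"])
        show "((\<lambda>h. r x - \<mu> * h) has_real_derivative - \<mu>) (at 0)"
          by (auto intro!: derivative_eq_intros)
        fix h assume h: "0 < h" "h < x - s"
        then show "rat (d X P - h) (d P Y) (d (c (x - h)) Y) \<le> r x - \<mu> * h"
          using max[of "x - h"] xs X by (auto simp: r_def y_def algebra_simps)
      qed (use xs X in \<open>auto simp: r_def y_def X_def\<close>)
      also have "\<dots> < rat x (d X Y) y"
        using \<mu> snp[of x] xs sny snz kap_pos X by (simp add: y_def)
      also have "\<dots> = cos (arccos (rat x (d X Y) y))" using rb by (simp add: cos_arccos_abs)
      also have "\<dots> \<le> cos \<xi>"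
      proof (rule cos_monotone_0_pi_le)
        show "\<xi> \<le> arccos (rat x (d X Y) y)"
          using angle_comparison[OF p' e] X by (auto simp: \<xi>_def y_def)
        show "0 \<le> \<xi>"
          using upper_angle_range[OF X(1) accum_isopath[OF p', of "d X P"] accum_isopath[OF e, of "d X Y"]] X xs M
          by (auto simp: \<xi>_def mdist_pos_less)
        show "arccos (rat x (d X Y) y) \<le> pi" using rb by (intro arccos_ubound) auto
      qed
      finally show False by simp
    qed
    have 1: "ip (d Y R) = eps * cs s * cs y + sn s * sn y * r s"
      and 2: "ip (d Y Q) = eps * cs a * cs y + sn a * sn y * r a"
      using rat_law[of s y "d (c s) Y"] rat_law[of a y "d (c a) Y"] snp[of s] snp[of a] sny pos cs' commute
      by (auto simp: r_def)
    have "sn (a - s) * ip (d Y P) + sn s * ip (d Y Q) = sn a * eps * cs s * cs y + sn s * sn a * sn y * r a"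
      unfolding 2 using commute[of Y P] by (simp add: ip_def y_def[symmetric] sn_diff algebra_simps)
    also have "\<dots> \<le> sn a * eps * cs s * cs y + sn s * sn a * sn y * r s"
      using mono snp[of s] snp[of a] sny pos by (intro add_left_mono mult_left_mono) auto
    also have "\<dots> = sn a * ip (d Y R)" unfolding 1 by (simp add: algebra_simps)
    finally show ?thesis using pos by (simp add: a_def s_def)
  qed
qed

end

text \<open>All that remains of the R_K condition. The model plane satisfies it too, with equality
  in \<open>cat\<close>, so facts on betweenness hold on both sides.\<close>

locale cat_space = ktrig K + Metric_space M d for K and M :: "'a set" and d +
  assumes dist_adm: "P \<in> M \<Longrightarrow> Q \<in> M \<Longrightarrow> adm (d P Q)"
    and geodesic: "P \<in> M \<Longrightarrow> Q \<in> M \<Longrightarrow> \<exists>c. isopath M d c P Q"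
    and cat: "P \<in> M \<Longrightarrow> Q \<in> M \<Longrightarrow> R \<in> M \<Longrightarrow> Y \<in> M \<Longrightarrow> d P R + d R Q = d P Q \<Longrightarrow>
      sn (d R Q) * ip (d Y P) + sn (d P R) * ip (d Y Q) \<le> sn (d P Q) * ip (d Y R)"
begin

lemma geo_seg_between:
  "P \<in> M \<Longrightarrow> Q \<in> M \<Longrightarrow> geo_seg M d P Q = {X \<in> M. d P X + d X Q = d P Q}"
  using geo_seg_eq[OF geodesic] by blast

text \<open>Concavity with Y = R' itself: the model interpolates the value \<open>ip 0\<close> at R,
  so \<open>ip (d R' R)\<close> is at least that.\<close>

lemma between_unique:
  assumes M: "P \<in> M" "Q \<in> M" "R \<in> M" "R' \<in> M"
    and b: "d P R + d R Q = d P Q" "d P R' + d R' Q = d P Q" and eq: "d P R = d P R'"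
  shows "R = R'"
proof (cases "P = Q")
  case True
  then have "d P R = 0" "d P R' = 0" using b M commute[of R Q] commute[of R' Q] by auto
  then show ?thesis using M zero by metis
next
  case False
  define s t where "s = d P R" and "t = d R Q"
  have st: "d R' Q = t" "d P Q = s + t" "d P R' = s" using b eq by (auto simp: s_def t_def)
  have "d P Q > 0" using False M by (simp add: mdist_pos_less)
  then have snp: "sn (s + t) > 0" using sn_pos[OF dist_adm[OF M(1,2)]] st(2) by simp
  have "sn t * ip (d R' P) + sn s * ip (d R' Q) \<le> sn (s + t) * ip (d R' R)"
    using cat[OF M b(1)] st by (simp add: s_def t_def)
  then have "eps * (sn t * cs s + sn s * cs t) \<le> sn (s + t) * ip (d R' R)"
    using st commute[of R' P] by (simp add: ip_def algebra_simps)
  then have "sn (s + t) * eps \<le> sn (s + t) * ip (d R' R)" by (simp add: sn_add algebra_simps)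
  then have "ip 0 \<le> ip (d R' R)" using snp by (simp add: ip_0)
  then have "d R' R \<le> 0" using ip_le_iff[of 0 "d R' R"] dist_adm[of R' R] M kap_pos by (simp add: adm_def)
  then have "d R' R = 0" using nonneg[of R' R] by linarith
  then show ?thesis using M by auto
qed

lemma point_at:
  assumes "P \<in> M" "Q \<in> M" "0 \<le> s" "s \<le> d P Q"
  shows "\<exists>R\<in>M. d P R = s \<and> d R Q = d P Q - s"
proof -
  obtain c where c: "isopath M d c P Q" using geodesic assms by blast
  show ?thesis
    using isopath_mem[OF c] isopath_dist_start[OF c] isopath_dist_end[OF c] assms
    by (intro bexI[of _ "c s"]) auto
qed

end

sublocale rk_space \<subseteq> cat_space
  by unfold_locales (use adm_dist isopath_exists cat_inequality in auto)

section \<open>The model plane\<close>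


lemma shortest_cong:
  assumes "\<And>x y. x \<in> M \<Longrightarrow> y \<in> M \<Longrightarrow> d x y = d' x y"
  shows "shortest M d P Q \<gamma> \<longleftrightarrow> shortest M d' P Q \<gamma>"
proof (cases "\<gamma> ` {0..1} \<subseteq> M")
  case True
  then have m: "\<gamma> t \<in> M" if "t \<in> {0..1}" for t using that by auto
  have "(\<Sum>i < length ts - 1. d (\<gamma> (ts ! i)) (\<gamma> (ts ! Suc i))) = (\<Sum>i < length ts - 1. d' (\<gamma> (ts ! i)) (\<gamma> (ts ! Suc i)))"
    if "ts \<in> unit_partitions" for ts
  proof (rule sum.cong)
    have ts: "ts \<noteq> []" "ts ! 0 = 0" "ts ! (length ts - 1) = 1" "sorted ts"
      using that by (auto simp: unit_partitions_def hd_conv_nth last_conv_nth)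
    have b: "ts ! i \<in> {0..1}" if "i < length ts" for i
      using sorted_nth_mono[OF ts(4), of 0 i] sorted_nth_mono[OF ts(4), of i "length ts - 1"] ts that
      by auto
    fix i assume "i \<in> {..<length ts - 1}"
    then show "d (\<gamma> (ts ! i)) (\<gamma> (ts ! Suc i)) = d' (\<gamma> (ts ! i)) (\<gamma> (ts ! Suc i))"
      using m b by (intro assms) auto
  qed simp
  then have "curve_length d \<gamma> = curve_length d' \<gamma>" unfolding curve_length_def by (simp cong: SUP_cong)
  moreover have "curve_in M d \<gamma> = curve_in M d' \<gamma>"
    unfolding curve_in_def using assms m by (simp del: atLeastAtMost_iff cong: ball_cong)
  moreover have "d P Q = d' P Q" if "\<gamma> 0 = P" "\<gamma> 1 = Q" using assms m[of 0] m[of 1] that by auto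
  ultimately show ?thesis by (auto simp: shortest_def)
qed (auto simp: shortest_def curve_in_def)

text \<open>Allows passing from \<open>SK_dist\<close> to a function that agrees with it on the
  plane and satisfies the axioms of a metric everywhere.\<close>

lemma geo_hull_cong:
  assumes "\<And>x y. x \<in> M \<Longrightarrow> y \<in> M \<Longrightarrow> d x y = d' x y"
  shows "geo_hull M d F = geo_hull M d' F"
proof -
  have "geo_seg M d P Q = geo_seg M d' P Q" for P Q
    unfolding geo_seg_def using shortest_cong[of M d d', OF assms] by auto
  then have "geo_step M d = geo_step M d'" by (auto simp: geo_step_def fun_eq_iff)
  then show ?thesis by (simp add: geo_hull_def)
qed

section \<open>The quadratic form and the geodesics of the model plane\<close>

context ktrig
begin

text \<open>Scaled by \<open>kap\<^sup>2\<close> so that points of the plane have square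
  \<open>eps\<close> and the form of two points is \<open>ip\<close> of their distance.\<close>

definition form :: "real^3 \<Rightarrow> real^3 \<Rightarrow> real" where
  "form x y = kap\<^sup>2 * (x$1 * y$1 + x$2 * y$2 + eps * (x$3 * y$3))"

lemma form_commute: "form x y = form y x"
  by (simp add: form_def algebra_simps)

lemma form_linear [simp]:
  "form (x + y) z = form x z + form y z" "form z (x + y) = form z x + form z y"
  "form (x - y) z = form x z - form y z" "form z (x - y) = form z x - form z y"
  "form (r *\<^sub>R x) z = r * form x z" "form z (r *\<^sub>R x) = r * form z x"
  by (auto simp: form_def algebra_simps)

lemma kap_sq: "kap\<^sup>2 = \<bar>K\<bar>"
  by (simp add: kap_def)

lemma inner_3: "(x :: real^3) \<bullet> y = x$1 * y$1 + x$2 * y$2 + x$3 * y$3"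
  by (simp add: inner_vec_def sum_3)

lemma form_K_pos: "K > 0 \<Longrightarrow> form x y = K * (x \<bullet> y)"
  using eps_cases kap_sq by (auto simp: form_def inner_3)

lemma form_K_neg: "\<not> K > 0 \<Longrightarrow> form x y = - K * lorentz x y"
  using eps_cases kap_sq K0 by (auto simp: form_def lorentz_def)

lemma SK_set_iff: "x \<in> SK_set K \<longleftrightarrow> form x x = eps \<and> x$3 > 0"
proof (cases "K > 0")
  case True
  have "norm x = 1 / sqrt K \<longleftrightarrow> norm x ^ 2 = (1 / sqrt K)^2"
    using True by (subst power2_eq_iff_nonneg) auto
  also have "\<dots> \<longleftrightarrow> K * (x \<bullet> x) = 1"
    using True by (simp add: power2_norm_eq_inner power_divide field_simps)
  finally show ?thesis using True eps_cases by (auto simp: SK_set_def form_K_pos)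
next
  case False
  then show ?thesis using eps_cases K0 by (auto simp: SK_set_def form_K_neg field_simps)
qed

text \<open>The Gram determinant is the determinant of the form times a square.\<close>
lemma gram:
  "0 \<le> eps * (form u u * form v v * form w w + 2 * form u v * form v w * form u w
     - form u u * (form v w)\<^sup>2 - form v v * (form u w)\<^sup>2 - form w w * (form u v)\<^sup>2)"
proof -
  define D where "D = u$1 * (v$2 * w$3 - v$3 * w$2) - u$2 * (v$1 * w$3 - v$3 * w$1) + u$3 * (v$1 * w$2 - v$2 * w$1)"
  have "eps * (form u u * form v v * form w w + 2 * form u v * form v w * form u w
     - form u u * (form v w)\<^sup>2 - form v v * (form u w)\<^sup>2 - form w w * (form u v)\<^sup>2) = (kap^3 * D)\<^sup>2"
  proof (cases "K > 0")
    case True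
    then have e: "eps = 1" using eps_cases by auto
    show ?thesis unfolding form_def D_def e by algebra
  next
    case False
    then have e: "eps = -1" using eps_cases by auto
    show ?thesis unfolding form_def D_def e by algebra
  qed
  then show ?thesis by simp
qed

text \<open>For K > 0 this is positivity of the form on x + y and x - y, the former being nonzero
  because the open hemisphere has no antipodes. For K < 0 it is the reversed Cauchy-Schwarz
  inequality.\<close>

lemma SK_form_range:
  assumes "x \<in> SK_set K" "y \<in> SK_set K"
  shows "K > 0 \<Longrightarrow> -1 < form x y" "form x y \<le> eps"
    "form x y = eps \<longleftrightarrow> x = y"
proof -
  have x: "form x x = eps" "x$3 > 0" and y: "form y y = eps" "y$3 > 0" using assms by (auto simp: SK_set_iff)
  have pos: "-1 < form x y" "form x y \<le> 1" "form x y = 1 \<longleftrightarrow> x = y" if K: "K > 0"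
  proof -
    have e: "eps = 1" using K eps_cases by auto
    have "(x + y)$3 \<noteq> 0" using x y by simp
    then have "x + y \<noteq> 0" by (metis zero_index)
    then have "form (x + y) (x + y) > 0" using K by (simp add: form_K_pos del: form_linear)
    then show "-1 < form x y" using x y e form_commute[of x y] by simp
    have "form (x - y) (x - y) \<ge> 0" using K by (simp add: form_K_pos del: form_linear)
    then show "form x y \<le> 1" using x y e form_commute[of x y] by simp
    have "form x y = 1 \<longleftrightarrow> form (x - y) (x - y) = 0" using x y e form_commute[of x y] by auto
    also have "\<dots> \<longleftrightarrow> x = y" using K by (simp add: form_K_pos del: form_linear)
    finally show "form x y = 1 \<longleftrightarrow> x = y" .
  qed
  have neg: "form x y \<le> -1" "form x y = -1 \<longleftrightarrow> x = y" if K: "\<not> K > 0"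
  proof -
    have e: "eps = -1" using K eps_cases by auto
    define k where "k = 1 / kap\<^sup>2"
    have k: "k > 0" using kap_pos by (simp add: k_def)
    define N where "N = x$1 * y$1 + x$2 * y$2"
    have X: "(x$3)^2 = (x$1)^2 + (x$2)^2 + k" and Y: "(y$3)^2 = (y$1)^2 + (y$2)^2 + k"
      using x y e kap_pos by (auto simp: form_def k_def power2_eq_square field_simps)
    \<comment> \<open>A Lagrange identity that exhibits the defect in the reversed inequality as a
      sum of squares, and hence also the case of equality.\<close>
    have id: "(x$3 * y$3)^2 - (N + k)^2 = (x$1 * y$2 - x$2 * y$1)^2 + k * ((x$1 - y$1)^2 + (x$2 - y$2)^2)"
      unfolding power_mult_distrib X Y N_def by (simp add: power2_eq_square algebra_simps)
    then have "(N + k)^2 \<le> (x$3 * y$3)^2" using k by (smt (verit) mult_nonneg_nonneg zero_le_power2)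
    then have le: "N + k \<le> x$3 * y$3" using x y by (meson abs_le_square_iff abs_le_D1 abs_of_pos mult_pos_pos order_trans power2_le_imp_le less_imp_le)
    have f: "form x y = kap\<^sup>2 * (N - x$3 * y$3)" by (simp add: form_def e N_def)
    have "kap\<^sup>2 * (N - x$3 * y$3) \<le> kap\<^sup>2 * (- k)" using le by (intro mult_left_mono) auto
    then show "form x y \<le> -1" using kap_pos unfolding f by (simp add: k_def)
    show "form x y = -1 \<longleftrightarrow> x = y"
    proof
      assume "form x y = -1"
      then have "N + k = x$3 * y$3" using kap_pos unfolding f k_def by (simp add: field_simps)
      then have "(x$1 * y$2 - x$2 * y$1)^2 + k * ((x$1 - y$1)^2 + (x$2 - y$2)^2) = 0" using id by simp
      then have "k * ((x$1 - y$1)^2 + (x$2 - y$2)^2) = 0"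
        using k by (smt (verit) mult_nonneg_nonneg zero_le_power2)
      then have "(x$1 - y$1)^2 + (x$2 - y$2)^2 = 0" using k by simp
      then have c: "x$1 = y$1" "x$2 = y$2" by (auto simp: sum_power2_eq_zero_iff)
      then have "(x$3)^2 = (y$3)^2" using X Y by simp
      then have "x$3 = y$3" using x y by (simp add: power2_eq_iff_nonneg)
      then show "x = y" using c by (simp add: vec_eq_iff forall_3)
    qed (use x e in auto)
  qed
  show "K > 0 \<Longrightarrow> -1 < form x y" using pos by auto
  show "form x y \<le> eps" "form x y = eps \<longleftrightarrow> x = y" using pos neg eps_cases by auto
qed

lemma SK_dist_ip:
  assumes "x \<in> SK_set K" "y \<in> SK_set K"
  shows "adm (SK_dist K x y)" "ip (SK_dist K x y) = form x y"
proof -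
  note r = SK_form_range[OF assms]
  have "adm (SK_dist K x y) \<and> ip (SK_dist K x y) = form x y"
  proof (cases "K > 0")
    case True
    then have f: "K * (x \<bullet> y) = form x y" "-1 < form x y" "form x y \<le> 1"
      using r eps_cases by (auto simp: form_K_pos)
    have k: "kap = sqrt K" "sqrt K > 0" using True by (auto simp: kap_def)
    have D: "kap * SK_dist K x y = arccos (form x y)" "0 \<le> SK_dist K x y"
      using True k f by (auto simp: SK_dist_def arccos_lbound)
    have "arccos (form x y) < pi" using f arccos_less_arccos[of "-1" "form x y"] by simp
    then show ?thesis using D True f eps_cases by (auto simp: adm_def ip_def cs_def cos_arccos)
  next
    case False
    then have f: "K * lorentz x y = - form x y" "1 \<le> - form x y"
      using r eps_cases by (auto simp: form_K_neg)
    have k: "kap = sqrt (- K)" "sqrt (- K) > 0" using False K0 by (auto simp: kap_def)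
    have D: "kap * SK_dist K x y = arcosh (- form x y)" "0 \<le> SK_dist K x y"
      using False k f by (auto simp: SK_dist_def)
    then show ?thesis using False f eps_cases by (auto simp: adm_def ip_def cs_def)
  qed
  then show "adm (SK_dist K x y)" "ip (SK_dist K x y) = form x y" by auto
qed

text \<open>\<open>SK_dist\<close> is unspecified outside of \<open>SK_set\<close>, whereas the locale
  \<open>Metric_space\<close> asks for a function that is nonnegative everywhere.\<close>
definition skd :: "real^3 \<Rightarrow> real^3 \<Rightarrow> real" where
  "skd x y = (if x \<in> SK_set K \<and> y \<in> SK_set K then SK_dist K x y else 0)"

lemma skd_ip:
  assumes "x \<in> SK_set K" "y \<in> SK_set K"
  shows "adm (skd x y)" "ip (skd x y) = form x y"
  using SK_dist_ip[OF assms] assms by (auto simp: skd_def)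

lemma skd_eqI:
  "x \<in> SK_set K \<Longrightarrow> y \<in> SK_set K \<Longrightarrow> adm t \<Longrightarrow> form x y = ip t \<Longrightarrow> skd x y = t"
  using skd_ip[of x y] ip_eq_iff[of t "skd x y"] by simp

text \<open>The triangle inequality is nonnegativity of the Gram determinant, which equals (sn a sn
  b)^2 - (cs c - cs a cs b)^2. If a + b is not admissible, it already exceeds every
  distance.\<close>

lemma SK_metric: "Metric_space (SK_set K) (skd)"
proof
  show "0 \<le> skd x y" for x y
    using SK_dist_ip(1)[of x y] by (auto simp: skd_def adm_def)
  show "skd x y = skd y x" for x y
    by (simp add: skd_def SK_dist_def lorentz_def inner_commute mult.commute)
  show "skd x y = 0 \<longleftrightarrow> x = y" if "x \<in> SK_set K" "y \<in> SK_set K" for x y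
  proof -
    have "skd x y = 0 \<longleftrightarrow> ip 0 = ip (skd x y)"
      using skd_ip(1)[OF that] kap_pos ip_eq_iff[of 0 "skd x y"] by (auto simp: adm_def)
    then show ?thesis using skd_ip(2)[OF that] SK_form_range(3)[OF that] by (auto simp: ip_0)
  qed
  show "skd x z \<le> skd x y + skd y z"
    if "x \<in> SK_set K" "y \<in> SK_set K" "z \<in> SK_set K" for x y z
  proof -
    define a b c where "a = skd x y" and "b = skd y z" and "c = skd x z"
    have adm: "adm a" "adm b" "adm c" and ip: "form x y = ip a" "form y z = ip b" "form x z = ip c"
      using skd_ip that by (auto simp: a_def b_def c_def)
    have u: "form x x = eps" "form y y = eps" "form z z = eps" using that by (auto simp: SK_set_iff)
    have "c \<le> a + b"
    proof (cases "adm (a + b)")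
      case True
      have "0 \<le> eps * (eps * eps * eps + 2 * (eps * cs a) * (eps * cs b) * (eps * cs c)
        - eps * (eps * cs b)^2 - eps * (eps * cs c)^2 - eps * (eps * cs a)^2)"
        using gram[of x y z] unfolding u ip by (simp add: ip_def)
      also have "\<dots> = 1 + 2 * cs a * cs b * cs c - (cs a)^2 - (cs b)^2 - (cs c)^2"
        using eps_cases by (auto simp: algebra_simps)
      also have "\<dots> = (eps * (1 - cs a ^ 2)) * (eps * (1 - cs b ^ 2)) - (cs c - cs a * cs b)^2"
        using eps_cases by (auto simp: power2_eq_square algebra_simps)
      also have "\<dots> = (sn a * sn b)^2 - (eps * (cs c - cs a * cs b))^2"
        using eps_cases unfolding pyth'[symmetric] by (auto simp: power_mult_distrib)
      finally have "(eps * (cs c - cs a * cs b))^2 \<le> (sn a * sn b)^2" by simp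
      then have "\<bar>eps * (cs c - cs a * cs b)\<bar> \<le> sn a * sn b"
        using sn_nonneg[OF adm(1)] sn_nonneg[OF adm(2)]
        unfolding abs_le_square_iff[symmetric] by (simp add: abs_mult)
      then have "ip (a + b) \<le> ip c" by (simp add: ip_def cs_add algebra_simps abs_le_iff)
      then show ?thesis using ip_le_iff True adm by blast
    next
      case False
      then have "K > 0" "kap * (a + b) \<ge> pi" using adm by (auto simp: adm_def)
      then have "kap * c < kap * (a + b)" using adm by (auto simp: adm_def)
      then show ?thesis using kap_pos by simp
    qed
    then show ?thesis by (simp add: a_def b_def c_def)
  qed
qed

text \<open>Spherical linear interpolation: the unit-speed arc in the plane spanned by P and Q. For
  P = Q the denominator is 0 and the value is useless, hence the assumption P \<noteq> Q
  below.\<close>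

definition skpath :: "real^3 \<Rightarrow> real^3 \<Rightarrow> real \<Rightarrow> real^3" where
  "skpath P Q s = (sn (skd P Q - s) / sn (skd P Q)) *\<^sub>R P + (sn s / sn (skd P Q)) *\<^sub>R Q"

lemma skpath_form: 
  assumes "P \<in> SK_set K" "Q \<in> SK_set K" "P \<noteq> Q"
  shows "form (skpath P Q s) (skpath P Q t) = ip (s - t)"
proof -
  define L where "L = skd P Q"
  interpret S: Metric_space "SK_set K" skd by (rule SK_metric)
  have L: "L > 0" "adm L" using S.mdist_pos_less assms skd_ip by (auto simp: L_def)
  have snL: "sn L > 0" using L sn_pos by auto
  have f: "form P P = eps" "form Q Q = eps" "form P Q = eps * cs L" "form Q P = eps * cs L"
    using assms skd_ip(2)[of P Q] form_commute[of Q P] by (auto simp: SK_set_iff L_def ip_def)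
  have "form (skpath P Q s) (skpath P Q t) * (sn L)^2
    = eps * (sn (L - s) * sn (L - t) + sn s * sn t + (sn (L - s) * sn t + sn s * sn (L - t)) * cs L)"
    using snL unfolding skpath_def L_def[symmetric] by (simp add: f power2_eq_square field_simps)
  also have "\<dots> = eps * ((sn L)^2 * cs s * cs t + sn s * sn t * (1 - (cs L)^2))"
    by (simp add: sn_diff power2_eq_square algebra_simps)
  also have "1 - (cs L)^2 = eps * (sn L)^2" by (simp add: pyth')
  also have "eps * ((sn L)^2 * cs s * cs t + sn s * sn t * (eps * (sn L)^2)) = ip (s - t) * (sn L)^2"
    by (simp add: ip_def cs_diff algebra_simps)
  finally show ?thesis using snL by simp
qed

lemma skpath_in: 
  assumes "P \<in> SK_set K" "Q \<in> SK_set K" "P \<noteq> Q" "0 \<le> s" "s \<le> skd P Q"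
  shows "skpath P Q s \<in> SK_set K"
proof -
  define L where "L = skd P Q"
  interpret S: Metric_space "SK_set K" skd by (rule SK_metric)
  have L: "L > 0" "adm L" using S.mdist_pos_less assms skd_ip by (auto simp: L_def)
  have sl: "0 \<le> s" "s \<le> L" using assms by (auto simp: L_def)
  have snL: "sn L > 0" using L sn_pos by auto
  have nn: "sn (L - s) \<ge> 0" "sn s \<ge> 0" "sn (L - s) > 0 \<or> sn s > 0"
    using adm_mono[OF L(2)] sn_nonneg sn_pos[of s] sn_pos[of "L - s"] sl L by (auto, fastforce)
  have P3: "P$3 > 0" "Q$3 > 0" using assms by (auto simp: SK_set_iff)
  have "0 < sn (L - s) * P$3 + sn s * Q$3"
    using nn(3)
  proof
    assume "sn (L - s) > 0"
    then show ?thesis using nn(2) P3 by (intro add_pos_nonneg mult_pos_pos mult_nonneg_nonneg) auto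
  next
    assume "sn s > 0"
    then show ?thesis using nn(1) P3 by (intro add_nonneg_pos mult_pos_pos mult_nonneg_nonneg) auto
  qed
  then have "0 < (sn (L - s) * P$3 + sn s * Q$3) / sn L" using snL by simp
  also have "\<dots> = (skpath P Q s)$3" by (simp add: skpath_def L_def add_divide_distrib)
  finally show ?thesis using skpath_form[OF assms(1-3), of s s] by (simp add: SK_set_iff ip_0)
qed

lemma skpath_isopath:
  assumes "P \<in> SK_set K" "Q \<in> SK_set K" "P \<noteq> Q"
  shows "isopath (SK_set K) skd (skpath P Q) P Q"
proof -
  define L where "L = skd P Q"
  interpret S: Metric_space "SK_set K" skd by (rule SK_metric)
  have L: "L > 0" "adm L" using S.mdist_pos_less assms skd_ip by (auto simp: L_def)
  have snL: "sn L > 0" using L sn_pos by auto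
  have "skd (skpath P Q s) (skpath P Q t) = \<bar>s - t\<bar>" if "s \<in> {0..L}" "t \<in> {0..L}" for s t
    using that skpath_form[OF assms, of s t] skpath_in[OF assms] adm_mono[OF L(2), of "\<bar>s - t\<bar>"]
    by (intro skd_eqI) (auto simp: L_def)
  then show ?thesis
    unfolding isopath_def using skpath_in[OF assms] snL by (auto simp: L_def skpath_def)
qed

text \<open>Pairing R with the point of the arc at the same distance from P gives
  \<open>eps\<close>, so the two coincide. Betweenness thus becomes a linear relation, and pairing
  that relation with Y yields equality in the concavity.\<close>

lemma SK_between:
  assumes "P \<in> SK_set K" "Q \<in> SK_set K" "R \<in> SK_set K" "skd P R + skd R Q = skd P Q"
  shows "sn (skd P Q) *\<^sub>R R = sn (skd R Q) *\<^sub>R P + sn (skd P R) *\<^sub>R Q"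
proof (cases "P = Q")
  case True
  interpret S: Metric_space "SK_set K" skd by (rule SK_metric)
  show ?thesis using assms True S.commute[of R Q] by auto
next
  case False
  interpret S: Metric_space "SK_set K" skd by (rule SK_metric)
  define L s where "L = skd P Q" and "s = skd P R"
  have L: "L > 0" "adm L" using S.mdist_pos_less assms False skd_ip by (auto simp: L_def)
  have snL: "sn L > 0" using L sn_pos by auto
  have s: "skd R Q = L - s" "0 \<le> s" "s \<le> skd P Q" using assms by (auto simp: L_def s_def simp flip: assms(4))
  have fs: "form R P = eps * cs s" "form R Q = eps * cs (L - s)"
    using skd_ip(2)[of P R] skd_ip(2)[of R Q] assms s form_commute[of R P] by (auto simp: ip_def s_def)
  have "form R (skpath P Q s) * sn L = eps * (sn (L - s) * cs s + sn s * cs (L - s))"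
    using snL fs by (simp add: skpath_def L_def[symmetric] field_simps)
  also have "\<dots> = eps * sn L"
    using sn_add[of "L - s" s] by (simp add: algebra_simps)
  finally have "form R (skpath P Q s) = eps" using snL by simp
  then have "R = skpath P Q s" using SK_form_range[OF assms(3) skpath_in[OF assms(1,2) False s(2,3)]] by auto
  then have "sn L *\<^sub>R R = sn L *\<^sub>R skpath P Q s" by simp
  also have "\<dots> = sn (L - s) *\<^sub>R P + sn s *\<^sub>R Q"
    using snL unfolding skpath_def L_def[symmetric] by (simp add: scaleR_add_right)
  finally show ?thesis using s by (simp add: L_def s_def)
qed

lemma SK_cat_eq:
  assumes "P \<in> SK_set K" "Q \<in> SK_set K" "R \<in> SK_set K" "Y \<in> SK_set K" "skd P R + skd R Q = skd P Q"
  shows "sn (skd R Q) * ip (skd Y P) + sn (skd P R) * ip (skd Y Q) = sn (skd P Q) * ip (skd Y R)"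
proof -
  have "form Y (sn (skd P Q) *\<^sub>R R) = form Y (sn (skd R Q) *\<^sub>R P + sn (skd P R) *\<^sub>R Q)"
    using SK_between[OF assms(1-3,5)] by simp
  then show ?thesis using skd_ip(2) assms by simp
qed

lemma SK_cat_space: "cat_space K (SK_set K) skd"
proof -
  interpret S: Metric_space "SK_set K" skd by (rule SK_metric)
  show ?thesis
  proof
    show "\<exists>c. isopath (SK_set K) skd c P Q" if "P \<in> SK_set K" "Q \<in> SK_set K" for P Q
    proof (cases "P = Q")
      case True
      then show ?thesis using that by (intro exI[of _ "\<lambda>_. P"]) (auto simp: isopath_def)
    qed (use skpath_isopath that in blast)
  qed (use skd_ip SK_cat_eq in auto)
qed

text \<open>The arc from P to Q contains a positive multiple of every nonzero nonnegative
  combination of P and Q, and the normalization of R makes the factor 1.\<close>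

lemma SK_between_comb:
  assumes "P \<in> SK_set K" "Q \<in> SK_set K" "R \<in> SK_set K" "R = \<alpha> *\<^sub>R P + \<beta> *\<^sub>R Q" "0 \<le> \<alpha>" "0 \<le> \<beta>"
  shows "skd P R + skd R Q = skd P Q"
proof (cases "P = Q")
  case True
  interpret S: Metric_space "SK_set K" skd by (rule SK_metric)
  have R: "R = (\<alpha> + \<beta>) *\<^sub>R P" using assms True by (simp add: scaleR_add_left)
  have "form R R = eps" "form P P = eps" using assms(1,3) by (auto simp: SK_set_iff)
  then have "eps = (\<alpha> + \<beta>)^2 * eps" unfolding R by (simp add: power2_eq_square)
  then have "(\<alpha> + \<beta>)^2 = 1" using eps_cases by auto
  then have "\<alpha> + \<beta> = 1" using assms(5,6) unfolding power2_eq_1_iff by linarith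
  then show ?thesis using R True assms by auto
next
  case False
  interpret S: Metric_space "SK_set K" skd by (rule SK_metric)
  define L where "L = skd P Q"
  have L: "L > 0" "adm L" using S.mdist_pos_less assms False skd_ip by (auto simp: L_def)
  have snL: "sn L > 0" using L sn_pos by auto
  \<comment> \<open>A zero of h is a point of the arc whose coefficients sn (L - s) and sn s are in
    the ratio of \<alpha> and \<beta>.\<close>
  define h where "h = (\<lambda>s. \<alpha> * sn s - \<beta> * sn (L - s))"
  have "\<exists>s\<ge>0. s \<le> L \<and> h s = 0"
  proof (rule IVT')
    show "continuous_on {0..L} h" unfolding h_def by (intro continuous_intros)
    show "h 0 \<le> 0" "0 \<le> h L" using assms snL L by (auto simp: h_def)
  qed (use L in auto)
  then obtain s where s: "0 \<le> s" "s \<le> L" "\<alpha> * sn s = \<beta> * sn (L - s)" by (auto simp: h_def)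
  have nn: "sn (L - s) \<ge> 0" "sn s \<ge> 0" "sn (L - s) + sn s > 0"
    using adm_mono[OF L(2)] sn_nonneg sn_pos[of s] sn_pos[of "L - s"] s L by (auto, fastforce)
  define c where "c = skpath P Q s"
  have c: "c \<in> SK_set K" using skpath_in[OF assms(1,2) False s(1)] s by (auto simp: c_def L_def)
  have "(sn (L - s) + sn s) *\<^sub>R R = ((\<alpha> + \<beta>) * sn (L - s)) *\<^sub>R P + ((\<alpha> + \<beta>) * sn s) *\<^sub>R Q"
  proof -
    have "(sn (L - s) + sn s) * \<alpha> = (\<alpha> + \<beta>) * sn (L - s)" "(sn (L - s) + sn s) * \<beta> = (\<alpha> + \<beta>) * sn s"
      using s(3) by (simp_all add: algebra_simps)
    then show ?thesis by (simp add: assms(4) scaleR_add_right)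
  qed
  also have "\<dots> = ((\<alpha> + \<beta>) * sn L) *\<^sub>R c"
    using snL by (simp add: c_def skpath_def L_def[symmetric] scaleR_add_right)
  finally have "R = (((\<alpha> + \<beta>) * sn L) / (sn (L - s) + sn s)) *\<^sub>R c"
    using nn by (metis (no_types, lifting) divide_inverse_commute less_irrefl pth_7(1) scaleR_scaleR real_vector_eq_affinity scaleR_left_imp_eq divideR_right mult.commute divide_inverse)
  then obtain r where r: "R = r *\<^sub>R c" "r \<ge> 0" using nn assms snL by (metis add_nonneg_nonneg divide_nonneg_pos less_imp_le mult_nonneg_nonneg)
  have "eps = r^2 * eps" using assms(3) c r by (simp add: SK_set_iff power2_eq_square)
  then have "r^2 = 1" using eps_cases by auto
  then have "R = c" using r by (simp add: power2_eq_1_iff)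
  then show ?thesis
    using S.isopath_dist_start[OF skpath_isopath[OF assms(1,2) False], of s]
      S.isopath_dist_end[OF skpath_isopath[OF assms(1,2) False], of s] s by (simp add: c_def L_def)
qed

end

section \<open>Rigidity of parallelograms\<close>

context ktrig
begin

text \<open>Since \<open>eps * form P Q\<close> exceeds -1, nonzero nonnegative combinations remain
  in the cone over the model plane and can be projected back to it.\<close>

lemma SK_normalize:
  assumes "P \<in> SK_set K" "Q \<in> SK_set K" "0 \<le> \<alpha>" "0 \<le> \<beta>" "0 < \<alpha> + \<beta>"
  shows "\<exists>x\<in>SK_set K. \<exists>\<rho>>0. \<alpha> *\<^sub>R P + \<beta> *\<^sub>R Q = \<rho> *\<^sub>R x"
proof -
  define z where "z = \<alpha> *\<^sub>R P + \<beta> *\<^sub>R Q"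
  have PQ: "form P P = eps" "form Q Q = eps" "P$3 > 0" "Q$3 > 0" using assms by (auto simp: SK_set_iff)
  define f where "f = eps * form P Q"
  have f: "f > -1" using SK_form_range(1,2)[OF assms(1,2)] eps_cases by (auto simp: f_def)
  have zz: "eps * form z z = \<alpha>\<^sup>2 + \<beta>\<^sup>2 + 2 * \<alpha> * \<beta> * f"
    using PQ form_commute[of Q P] by (simp add: z_def f_def algebra_simps power2_eq_square)
  have "0 < \<alpha>\<^sup>2 + \<beta>\<^sup>2 + 2 * \<alpha> * \<beta> * f"
  proof (cases "\<alpha> * \<beta> = 0")
    case True
    then show ?thesis using assms by auto
  next
    case False
    then have "\<alpha> * \<beta> > 0" using assms by (simp add: less_le)
    then have "\<alpha> * \<beta> * (-1) < \<alpha> * \<beta> * f" using f by (intro mult_strict_left_mono) auto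
    moreover have "0 \<le> (\<alpha> - \<beta>)\<^sup>2" by simp
    ultimately show ?thesis by (simp add: power2_diff)
  qed
  then have pos: "eps * form z z > 0" using zz by simp
  define \<rho> where "\<rho> = sqrt (eps * form z z)"
  have \<rho>: "\<rho> > 0" "\<rho>\<^sup>2 = eps * form z z" using pos by (auto simp: \<rho>_def)
  have z3: "z$3 > 0" using assms PQ
    by (cases "\<alpha> = 0") (auto simp: z_def intro!: add_pos_nonneg mult_pos_pos)
  have fz: "form z z = eps * \<rho>\<^sup>2" using \<rho> by simp
  have "(1/\<rho>) *\<^sub>R z \<in> SK_set K"
    using z3 \<rho>(1) by (simp add: SK_set_iff fz power2_eq_square)
  moreover have "z = \<rho> *\<^sub>R ((1/\<rho>) *\<^sub>R z)" using \<rho> by simp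
  ultimately show ?thesis using \<rho> z_def by blast
qed

lemma SK_collinear_eq:
  assumes "P \<in> SK_set K" "Q \<in> SK_set K" "P = t *\<^sub>R Q"
  shows "P = Q"
proof -
  have *: "form P P = eps" "form Q Q = eps" "P$3 > 0" "Q$3 > 0" using assms by (auto simp: SK_set_iff)
  then have "t > 0" using assms(3) by (simp add: zero_less_mult_iff)
  have "t\<^sup>2 * eps = eps" using *(1,2) unfolding assms(3) by (simp add: power2_eq_square)
  then have "t\<^sup>2 = 1" using eps_cases by auto
  then have "t = 1" using \<open>t > 0\<close> unfolding power2_eq_1_iff by linarith
  then show ?thesis using assms by simp
qed

lemma SK_comb_neq:
  assumes "P \<in> SK_set K" "Q \<in> SK_set K" "P \<noteq> Q" "x = \<alpha> *\<^sub>R P + \<beta> *\<^sub>R Q" "\<beta> \<noteq> 0"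
  shows "x \<noteq> P"
proof
  assume "x = P"
  then have e: "\<beta> *\<^sub>R Q = (1 - \<alpha>) *\<^sub>R P" using assms(4) by (simp add: algebra_simps)
  have "Q = (inverse \<beta>) *\<^sub>R (\<beta> *\<^sub>R Q)" using assms(5) by simp
  also have "\<dots> = (inverse \<beta> * (1 - \<alpha>)) *\<^sub>R P" unfolding e by simp
  finally show False using SK_collinear_eq[OF assms(2,1)] assms(3) by auto
qed

end

section \<open>Transfer of distances between a segment and its copy in the model plane\<close>

context cat_space
begin

lemma between_dist:
  assumes M: "P \<in> M" "Q \<in> M" "R \<in> M" "R' \<in> M"
    and b: "d P R + d R Q = d P Q" "d P R' + d R' Q = d P Q"
  shows "d R R' = \<bar>d P R - d P R'\<bar>"
proof -
  obtain c where c: "isopath M d c P Q" using geodesic M by blast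
  have *: "X = c (d P X)" if "X \<in> M" "d P X + d X Q = d P Q" for X
  proof (rule between_unique[OF M(1,2) that(1) _ that(2)])
    have r: "0 \<le> d P X" "d P X \<le> d P Q" using that(2) nonneg[of P X] nonneg[of X Q] by linarith+
    show "c (d P X) \<in> M" "d P (c (d P X)) + d (c (d P X)) Q = d P Q" "d P X = d P (c (d P X))"
      using isopath_mem[OF c] isopath_dist_start[OF c] isopath_dist_end[OF c] r by auto
  qed
  have r: "d P R \<le> d P Q" "d P R' \<le> d P Q" using b nonneg[of R Q] nonneg[of R' Q] by linarith+
  have "d (c (d P R)) (c (d P R')) = \<bar>d P R - d P R'\<bar>"
    using isopath_dist[OF c] r by auto
  then show ?thesis using *[OF M(3) b(1)] *[OF M(4) b(2)] by simp
qed

text \<open>The usual comparison point on a side of a comparison triangle: r divides pq as R divides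
  PQ, and equal lengths of the whole sides follow.\<close>

definition matched :: "'a \<Rightarrow> 'a \<Rightarrow> 'a \<Rightarrow> real^3 \<Rightarrow> real^3 \<Rightarrow> real^3 \<Rightarrow> bool" where
  "matched P Q R p q r \<longleftrightarrow> {P, Q, R} \<subseteq> M \<and> {p, q, r} \<subseteq> SK_set K \<and>
     d P R + d R Q = d P Q \<and> skd p r + skd r q = skd p q \<and> d P R = skd p r \<and> d R Q = skd r q"

lemma skd_commute: "skd x y = skd y x"
  using Metric_space.commute[OF SK_metric] by blast

lemma matched_commute: "matched P Q R p q r \<Longrightarrow> matched Q P R q p r"
  unfolding matched_def using commute skd_commute by (auto simp: add.commute)

text \<open>The defect is nonnegative at the two ends, concave in M and interpolated exactly in the
  model, so it is nonnegative at R.\<close>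

lemma matched_nonexpanding:
  assumes m: "matched P Q R p q r" and Y: "Y \<in> M" "y \<in> SK_set K" and le: "d Y P \<le> skd y p" "d Y Q \<le> skd y q"
  shows "d Y R \<le> skd y r"
proof -
  interpret S: cat_space K "SK_set K" skd by (rule SK_cat_space)
  have M: "P \<in> M" "Q \<in> M" "R \<in> M" and N: "p \<in> SK_set K" "q \<in> SK_set K" "r \<in> SK_set K"
    and e: "d P R + d R Q = d P Q" "skd p r + skd r q = skd p q" "d P R = skd p r" "d R Q = skd r q"
    using m by (auto simp: matched_def)
  show ?thesis
  proof (cases "P = Q")
    case True
    then have "d P R = 0" using e(1) M commute[of R Q] nonneg[of P R] by auto
    then have "P = R" "p = r" using e M N by auto
    then show ?thesis using le by simp
  next
    case False
    have pos: "sn (d P Q) > 0" using False M dist_adm by (auto simp: mdist_pos_less intro!: sn_pos)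
    have nn: "0 \<le> sn (d R Q)" "0 \<le> sn (d P R)" using dist_adm M by (auto intro!: sn_nonneg)
    have PQ: "d P Q = skd p q" using e by simp
    have "sn (d P Q) * ip (skd y r) = sn (d R Q) * ip (skd y p) + sn (d P R) * ip (skd y q)"
      using SK_cat_eq[OF N Y(2) e(2)] e PQ by simp
    also have "\<dots> \<le> sn (d R Q) * ip (d Y P) + sn (d P R) * ip (d Y Q)"
      using le M N Y nn dist_adm S.dist_adm by (intro add_mono mult_left_mono) (auto simp: ip_le_iff)
    also have "\<dots> \<le> sn (d P Q) * ip (d Y R)" using cat[OF M Y(1) e(1)] .
    finally have "ip (skd y r) \<le> ip (d Y R)" using pos by simp
    then show ?thesis using ip_le_iff[of "skd y r" "d Y R"] dist_adm S.dist_adm M N Y by blast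
  qed
qed

text \<open>The defect \<open>ip (d Y _) - ip (skd y _)\<close> is nonnegative and concave along a geodesic, so it
  vanishes everywhere as soon as it vanishes at an interior point.\<close>
lemma matched_exact:
  assumes m: "matched P Q R p q r" and Y: "Y \<in> M" "y \<in> SK_set K" and le: "d Y P \<le> skd y p" "d Y Q \<le> skd y q"
    and ex: "d Y R = skd y r" and pos: "0 < d P R"
  shows "d Y Q = skd y q"
proof -
  interpret S: cat_space K "SK_set K" skd by (rule SK_cat_space)
  have M: "P \<in> M" "Q \<in> M" "R \<in> M" and N: "p \<in> SK_set K" "q \<in> SK_set K" "r \<in> SK_set K"
    and e: "d P R + d R Q = d P Q" "skd p r + skd r q = skd p q" "d P R = skd p r" "d R Q = skd r q"
    using m by (auto simp: matched_def)
  have sp: "0 < sn (d P R)" "0 \<le> sn (d R Q)" using pos dist_adm M by (auto intro!: sn_pos sn_nonneg)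
  have PQ: "d P Q = skd p q" using e by simp
  have "sn (d R Q) * ip (skd y p) + sn (d P R) * ip (d Y Q) \<le> sn (d R Q) * ip (d Y P) + sn (d P R) * ip (d Y Q)"
    using le M N Y sp dist_adm S.dist_adm by (intro add_mono mult_left_mono) (auto simp: ip_le_iff)
  also have "\<dots> \<le> sn (d P Q) * ip (d Y R)" using cat[OF M Y(1) e(1)] .
  also have "\<dots> = sn (d R Q) * ip (skd y p) + sn (d P R) * ip (skd y q)"
    using SK_cat_eq[OF N Y(2) e(2)] e PQ ex by simp
  finally have "ip (d Y Q) \<le> ip (skd y q)" using sp by simp
  then have "skd y q \<le> d Y Q" using ip_le_iff[of "d Y Q" "skd y q"] dist_adm S.dist_adm M N Y by blast
  then show ?thesis using le by simp
qed

lemma matched_dist: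
  assumes "matched P Q R p q r" "matched P Q R' p q r'"
  shows "d R R' = skd r r'"
proof -
  interpret S: cat_space K "SK_set K" skd by (rule SK_cat_space)
  show ?thesis using between_dist[of P Q R R'] S.between_dist[of p q r r'] assms by (auto simp: matched_def)
qed

lemma matched_sub:
  assumes m: "matched P Q R p q r" "matched P Q R' p q r'" and le: "d P R \<le> d P R'"
  shows "matched R Q R' r q r'" "matched P R' R p r' r"
proof -
  interpret S: cat_space K "SK_set K" skd by (rule SK_cat_space)
  have "d R R' = d P R' - d P R" "skd r r' = d P R' - d P R"
    using between_dist[of P Q R R'] matched_dist[OF m] m le by (auto simp: matched_def)
  then show "matched R Q R' r q r'" "matched P R' R p r' r"
    using m unfolding matched_def by auto
qed

text \<open>\<open>matched_exact\<close> carries exactness from an interior point to an end. Cutting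
  the segment at R', on whichever side of R it lies, makes R' an end with R still interior.\<close>

lemma matched_spread:
  assumes m: "matched P Q R p q r" and Y: "Y \<in> M" "y \<in> SK_set K" and le: "d Y P \<le> skd y p" "d Y Q \<le> skd y q"
    and ex: "d Y R = skd y r" and pos: "0 < d P R" "0 < d R Q" and m': "matched P Q R' p q r'"
  shows "d Y R' = skd y r'"
proof -
  have le': "d Y R' \<le> skd y r'" using matched_nonexpanding[OF m' Y le] .
  show ?thesis
  proof (cases "d P R' \<le> d P R")
    case True
    from matched_commute[OF matched_sub(1)[OF m' m True]] show ?thesis
      using matched_exact[of Q R' R q r' r Y y] Y le le' ex pos commute[of R Q] by auto
  next
    case False
    then have "matched P R' R p r' r" using matched_sub(2)[OF m m'] by simp
    then show ?thesis using matched_exact[of P R' R p r' r Y y] Y le le' ex pos by auto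
  qed
qed

lemma matched_extend:
  assumes "matched P Q R p q r" "matched P R T p r t"
  shows "matched T Q R t q r"
proof -
  interpret S: cat_space K "SK_set K" skd by (rule SK_cat_space)
  have M: "P \<in> M" "Q \<in> M" "R \<in> M" "T \<in> M" and N: "p \<in> SK_set K" "q \<in> SK_set K" "r \<in> SK_set K" "t \<in> SK_set K"
    using assms by (auto simp: matched_def)
  show ?thesis
    using triangle[of T R Q] triangle[of P T Q] S.triangle[of t r q] S.triangle[of p t q] M N assms
    unfolding matched_def by auto
qed

lemma matched_point:
  assumes "P \<in> M" "Q \<in> M" "p \<in> SK_set K" "q \<in> SK_set K" "r \<in> SK_set K" "d P Q = skd p q" "skd p r + skd r q = skd p q"
  shows "\<exists>R. matched P Q R p q r"
proof -
  interpret S: cat_space K "SK_set K" skd by (rule SK_cat_space)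
  have "0 \<le> skd p r" "skd p r \<le> d P Q" using assms S.nonneg[of p r] S.nonneg[of r q] by linarith+
  then obtain R where "R \<in> M" "d P R = skd p r" "d R Q = d P Q - skd p r"
    using point_at[OF assms(1,2)] by blast
  then show ?thesis using assms by (intro exI[of _ R]) (auto simp: matched_def)
qed

lemma matched_ends:
  assumes "P \<in> M" "Q \<in> M" "p \<in> SK_set K" "q \<in> SK_set K" "d P Q = skd p q"
  shows "matched P Q P p q p" "matched P Q Q p q q"
proof -
  interpret S: cat_space K "SK_set K" skd by (rule SK_cat_space)
  show "matched P Q P p q p" "matched P Q Q p q q" using assms by (auto simp: matched_def)
qed

end

text \<open>The data that equality produces. By \<open>uv\<close> both diagonals have the midpoint
  direction m', which is the only way in which the shape enters the linear algebra; collinear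
  vertices are allowed.\<close>

locale parallelogram = cat_space K M d for K and M :: "'a set" and d +
  fixes A B C D m :: 'a and A' B' C' D' m' :: "real^3" and u v :: real
  assumes AC: "matched A C m A' C' m'" "0 < d A m" "0 < d m C"
    and BD: "matched B D m B' D' m'" "0 < d B m" "0 < d m D"
    and sides: "d A B = skd A' B'" "d B C = skd B' C'" "d C D = skd C' D'" "d A D = skd A' D'"
    and uv: "0 < u" "0 < v" "A' + C' = u *\<^sub>R m'" "B' + D' = v *\<^sub>R m'"
begin

text \<open>V is one of the two vertices off the diagonal AC, and W the opposite one, so that the
  two triangles are treated alike.\<close>

definition vertex :: "'a \<Rightarrow> real^3 \<Rightarrow> 'a \<Rightarrow> real^3 \<Rightarrow> bool" where
  "vertex V V' W W' \<longleftrightarrow> (V, V', W, W') = (B, B', D, D') \<or> (V, V', W, W') = (D, D', B, B')"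

definition ruled :: "'a \<Rightarrow> real^3 \<Rightarrow> 'a \<Rightarrow> real^3 \<Rightarrow> bool" where
  "ruled V V' W w \<longleftrightarrow> (\<exists>X x. matched A C X A' C' x \<and> matched V X W V' x w)"

text \<open>Rulings that meet AC in its interior: only these can be prolonged beyond the diagonal
  inside the parallelogram.\<close>

definition iruled :: "'a \<Rightarrow> real^3 \<Rightarrow> 'a \<Rightarrow> real^3 \<Rightarrow> bool" where
  "iruled V V' W w \<longleftrightarrow> (\<exists>X x. matched A C X A' C' x \<and> 0 < d A X \<and> 0 < d X C \<and> matched V X W V' x w)"

lemma in_M: "A \<in> M" "B \<in> M" "C \<in> M" "D \<in> M" "m \<in> M"
  and in_SK: "A' \<in> SK_set K" "B' \<in> SK_set K" "C' \<in> SK_set K" "D' \<in> SK_set K" "m' \<in> SK_set K"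
  using AC BD by (auto simp: matched_def)

lemma vertex_in: "vertex V V' W W' \<Longrightarrow> V \<in> M \<and> V' \<in> SK_set K \<and> W \<in> M \<and> W' \<in> SK_set K"
  using in_M in_SK by (auto simp: vertex_def)

lemma vertex_commute: "vertex V V' W W' \<Longrightarrow> vertex W W' V V'"
  by (auto simp: vertex_def)

lemma diagonals: "d A C = skd A' C'" "d B D = skd B' D'" "A' \<noteq> C'"
proof -
  interpret S: cat_space K "SK_set K" skd by (rule SK_cat_space)
  show 1: "d A C = skd A' C'" "d B D = skd B' D'" using AC BD by (auto simp: matched_def)
  have "d A m + d m C = d A C" using AC(1) by (simp add: matched_def)
  then have "d A C > 0" using AC(2,3) by linarith
  then show "A' \<noteq> C'" using 1 in_SK by auto
qed

text \<open>The common midpoint m is interior to BD and lies with X on the same diagonal AC, so its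
  distance to X is exact; exactness then spreads along BD.\<close>

lemma cross_exact:
  assumes "matched A C X A' C' x" "matched B D Y B' D' y"
  shows "d X Y = skd x y"
proof -
  have X: "X \<in> M" "x \<in> SK_set K" using assms by (auto simp: matched_def)
  have "d B X \<le> skd B' x" "d D X \<le> skd D' x"
    using matched_nonexpanding[OF assms(1), of B B'] matched_nonexpanding[OF assms(1), of D D']
      sides in_M in_SK commute skd_commute by auto
  then show ?thesis
    using matched_spread[OF BD(1) X _ _ _ BD(2,3) assms(2)] matched_dist[OF assms(1) AC(1)] commute skd_commute by auto
qed

lemma vertex_exact:
  assumes "matched A C X A' C' x" "vertex V V' W W'"
  shows "d V X = skd V' x"
proof -
  have "matched B D V B' D' V'"
    using assms(2) matched_ends[of B D B' D'] in_M in_SK diagonals by (auto simp: vertex_def)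
  then show ?thesis using cross_exact[OF assms(1)] commute skd_commute by auto
qed

text \<open>Two comparisons in succession: from the foot Y of the second ruling along the first one,
  and from the resulting W along the second one.\<close>

lemma ruled_nonexpanding_same:
  assumes "ruled V V' W w" "ruled V V' T t" "vertex V V' V2 V2'"
  shows "d W T \<le> skd w t"
proof -
  obtain X x where X: "matched A C X A' C' x" "matched V X W V' x w" using assms by (auto simp: ruled_def)
  obtain Y y where Y: "matched A C Y A' C' y" "matched V Y T V' y t" using assms by (auto simp: ruled_def)
  have mem: "Y \<in> M" "y \<in> SK_set K" "W \<in> M" "w \<in> SK_set K" using X Y by (auto simp: matched_def)
  have "d Y V \<le> skd y V'" "d Y X \<le> skd y x"
    using vertex_exact[OF Y(1) assms(3)] matched_dist[OF Y(1) X(1)] commute skd_commute by auto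
  then have "d Y W \<le> skd y w" by (rule matched_nonexpanding[OF X(2) mem(1,2)])
  moreover have "d W V \<le> skd w V'" using X(2) commute skd_commute by (auto simp: matched_def)
  ultimately show ?thesis using matched_nonexpanding[OF Y(2) mem(3,4)] commute skd_commute by auto
qed

lemma ruled_diagonal:
  assumes "matched A C X A' C' x" "vertex V V' V2 V2'"
  shows "ruled V V' X x"
  using assms matched_ends(2)[of V X V' x] vertex_exact[OF assms] vertex_in[OF assms(2)]
  unfolding ruled_def by (meson matched_def insert_subset)

lemma iruled_vertex:
  assumes "vertex V V' V2 V2'"
  shows "iruled V V' V V'"
  using AC matched_ends(1)[of V m V' m'] vertex_exact[OF AC(1) assms] vertex_in[OF assms] in_M in_SK
  unfolding iruled_def by blast

lemma iruled_ruled: "iruled V V' W w \<Longrightarrow> ruled V V' W w"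
  by (auto simp: iruled_def ruled_def)

lemma ruled_in: "ruled V V' W w \<Longrightarrow> W \<in> M \<and> w \<in> SK_set K"
  by (auto simp: ruled_def matched_def)

lemma between_comb:
  assumes "P \<in> SK_set K" "Q \<in> SK_set K" "R \<in> SK_set K" "skd P R + skd R Q = skd P Q"
  shows "\<exists>\<alpha>\<ge>0. \<exists>\<beta>\<ge>0. R = \<alpha> *\<^sub>R P + \<beta> *\<^sub>R Q \<and> (skd P R > 0 \<longrightarrow> \<beta> > 0) \<and> (skd R Q > 0 \<longrightarrow> \<alpha> > 0)"
proof -
  interpret S: cat_space K "SK_set K" skd by (rule SK_cat_space)
  show ?thesis
  proof (cases "P = Q")
    case True
    have "skd P Q = 0" using True assms(2) by simp
    then have "skd P R = 0" "skd R Q = 0" using assms(4) S.nonneg[of P R] S.nonneg[of R Q] by linarith+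
    then have "R = P" using assms by auto
    then show ?thesis using \<open>skd P R = 0\<close> \<open>skd R Q = 0\<close> by (intro exI[of _ 1] conjI exI[of _ 0]) auto
  next
    case False
    have pos: "sn (skd P Q) > 0" using False assms S.dist_adm by (auto simp: S.mdist_pos_less intro!: sn_pos)
    define \<alpha> \<beta> where "\<alpha> = sn (skd R Q) / sn (skd P Q)" and "\<beta> = sn (skd P R) / sn (skd P Q)"
    have "R = (1 / sn (skd P Q)) *\<^sub>R (sn (skd P Q) *\<^sub>R R)" using pos by simp
    also have "\<dots> = \<alpha> *\<^sub>R P + \<beta> *\<^sub>R Q"
      unfolding SK_between[OF assms] by (simp add: scaleR_add_right \<alpha>_def \<beta>_def)
    finally have "R = \<alpha> *\<^sub>R P + \<beta> *\<^sub>R Q" .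
    moreover have "0 \<le> \<alpha>" "0 \<le> \<beta>" using pos assms S.dist_adm by (auto simp: \<alpha>_def \<beta>_def intro!: divide_nonneg_pos sn_nonneg)
    moreover have "skd P R > 0 \<longrightarrow> \<beta> > 0" "skd R Q > 0 \<longrightarrow> \<alpha> > 0"
      using pos assms S.dist_adm by (auto simp: \<alpha>_def \<beta>_def intro!: divide_pos_pos sn_pos)
    ultimately show ?thesis by blast
  qed
qed

lemma ruled_comb:
  assumes "ruled V V' W w"
  shows "\<exists>\<alpha>\<ge>0. \<exists>\<gamma>\<ge>0. \<exists>\<beta>\<ge>0. w = \<alpha> *\<^sub>R A' + \<gamma> *\<^sub>R C' + \<beta> *\<^sub>R V'"
proof -
  obtain X x where X: "matched A C X A' C' x" "matched V X W V' x w" using assms by (auto simp: ruled_def)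
  obtain \<alpha> \<gamma> where 1: "\<alpha> \<ge> 0" "\<gamma> \<ge> 0" "x = \<alpha> *\<^sub>R A' + \<gamma> *\<^sub>R C'"
    using between_comb[of A' C' x] X by (auto simp: matched_def)
  obtain \<beta> \<tau> where 2: "\<beta> \<ge> 0" "\<tau> \<ge> 0" "w = \<beta> *\<^sub>R V' + \<tau> *\<^sub>R x"
    using between_comb[of V' x w] X by (auto simp: matched_def)
  have "w = (\<tau> * \<alpha>) *\<^sub>R A' + (\<tau> * \<gamma>) *\<^sub>R C' + \<beta> *\<^sub>R V'" unfolding 2(3) 1(3) by (simp add: algebra_simps)
  moreover have "0 \<le> \<tau> * \<alpha>" "0 \<le> \<tau> * \<gamma>" using 1 2 by simp_all
  ultimately show ?thesis using 2(1) by blast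
qed

text \<open>Projecting away from V' gives the foot on A'C'. Positive coefficients of A' and C' put
  it in the interior; if both vanish, the point is V' itself, which lies on every ruling.\<close>

lemma comb_ruled:
  assumes w: "w \<in> SK_set K" "w = \<alpha> *\<^sub>R A' + \<gamma> *\<^sub>R C' + \<beta> *\<^sub>R V'" "0 \<le> \<alpha>" "0 \<le> \<gamma>" "0 \<le> \<beta>"
    and V: "vertex V V' V2 V2'"
  shows "\<exists>W. ruled V V' W w" "0 < \<alpha> \<Longrightarrow> 0 < \<gamma> \<Longrightarrow> \<exists>W. iruled V V' W w"
proof -
  interpret S: cat_space K "SK_set K" skd by (rule SK_cat_space)
  have "\<exists>W. ruled V V' W w \<and> (0 < \<alpha> \<and> 0 < \<gamma> \<longrightarrow> iruled V V' W w)"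
  proof (cases "\<alpha> + \<gamma> = 0")
    case True
    then have "\<alpha> = 0" "\<gamma> = 0" using assms by auto
    then have "w = V'" using SK_collinear_eq[OF w(1), of V' \<beta>] w vertex_in[OF V] by simp
    then show ?thesis using iruled_vertex[OF V] iruled_ruled by blast
  next
    case False
    then have "0 < \<alpha> + \<gamma>" using w(3,4) by linarith
    then obtain x \<rho> where x: "x \<in> SK_set K" "\<rho> > 0" "\<alpha> *\<^sub>R A' + \<gamma> *\<^sub>R C' = \<rho> *\<^sub>R x"
      using SK_normalize[OF in_SK(1,3) w(3,4)] by blast
    have xc: "x = (\<alpha> / \<rho>) *\<^sub>R A' + (\<gamma> / \<rho>) *\<^sub>R C'"
    proof -
      have "x = (1/\<rho>) *\<^sub>R (\<alpha> *\<^sub>R A' + \<gamma> *\<^sub>R C')" using x by simp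
      then show ?thesis by (simp add: scaleR_add_right)
    qed
    have "skd A' x + skd x C' = skd A' C'"
      using SK_between_comb[OF in_SK(1,3) x(1) xc] x w by simp
    then obtain X where X: "matched A C X A' C' x"
      using matched_point[of A C A' C' x] in_M in_SK x diagonals by auto
    have w': "w = \<beta> *\<^sub>R V' + \<rho> *\<^sub>R x" using w(2) x(3) by (simp add: algebra_simps)
    have "skd V' w + skd w x = skd V' x"
      using SK_between_comb[OF _ x(1) w(1) w'] vertex_in[OF V] x w by simp
    then obtain W where W: "matched V X W V' x w"
      using matched_point[of V X V' x w] vertex_in[OF V] X x w vertex_exact[OF X V] by (auto simp: matched_def)
    have "0 < d A X \<and> 0 < d X C" if "0 < \<alpha>" "0 < \<gamma>"
    proof -
      have "x \<noteq> A'" using SK_comb_neq[OF in_SK(1,3) diagonals(3) xc] that x by auto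
      moreover have "x \<noteq> C'"
        using SK_comb_neq[OF in_SK(3,1) diagonals(3)[symmetric], of x "\<gamma> / \<rho>" "\<alpha> / \<rho>"] xc that x by (auto simp: add.commute)
      ultimately have "0 < skd A' x" "0 < skd x C'" using S.mdist_pos_less in_SK x(1) by auto
      then show ?thesis using X by (auto simp: matched_def)
    qed
    then show ?thesis using X W unfolding ruled_def iruled_def by blast
  qed
  then show "\<exists>W. ruled V V' W w" "0 < \<alpha> \<Longrightarrow> 0 < \<gamma> \<Longrightarrow> \<exists>W. iruled V V' W w" by auto
qed

lemma vertex_sum: 
  assumes "vertex V V' V2 V2'"
  shows "V' + V2' = (v / u) *\<^sub>R (A' + C')"
  using assms uv by (auto simp: vertex_def add.commute)

text \<open>Weight w and t so that V' and V2' receive the same coefficient. The multiple of V' + V2'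
  is then a multiple of A' + C', and the combination lies in the cone over the diagonal.\<close>

lemma crossing:
  assumes "ruled V V' W w" "ruled V2 V2' T t" "vertex V V' V2 V2'"
  shows "\<exists>x\<in>SK_set K. skd A' x + skd x C' = skd A' C' \<and> skd w x + skd x t = skd w t"
proof -
  interpret S: cat_space K "SK_set K" skd by (rule SK_cat_space)
  obtain \<alpha> \<gamma> \<beta> where w: "\<alpha> \<ge> 0" "\<gamma> \<ge> 0" "\<beta> \<ge> 0" "w = \<alpha> *\<^sub>R A' + \<gamma> *\<^sub>R C' + \<beta> *\<^sub>R V'"
    using ruled_comb[OF assms(1)] by blast
  obtain \<alpha>2 \<gamma>2 \<beta>2 where t: "\<alpha>2 \<ge> 0" "\<gamma>2 \<ge> 0" "\<beta>2 \<ge> 0" "t = \<alpha>2 *\<^sub>R A' + \<gamma>2 *\<^sub>R C' + \<beta>2 *\<^sub>R V2'"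
    using ruled_comb[OF assms(2)] by blast
  have wt: "w \<in> SK_set K" "t \<in> SK_set K" using ruled_in assms by auto
  consider "\<beta> = 0" | "\<beta>2 = 0" | "\<beta> > 0" "\<beta>2 > 0" using w t by linarith
  then show ?thesis
  proof cases
    case 1
    then have "skd A' w + skd w C' = skd A' C'" using SK_between_comb[OF in_SK(1,3) wt(1)] w by simp
    then show ?thesis using wt by (intro bexI[of _ w]) auto
  next
    case 2
    then have "skd A' t + skd t C' = skd A' C'" using SK_between_comb[OF in_SK(1,3) wt(2)] t by simp
    then show ?thesis using wt by (intro bexI[of _ t]) auto
  next
    case 3
    then obtain x \<rho> where x: "x \<in> SK_set K" "\<rho> > 0" "\<beta>2 *\<^sub>R w + \<beta> *\<^sub>R t = \<rho> *\<^sub>R x"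
      using SK_normalize[OF wt, of \<beta>2 \<beta>] by (meson add_pos_pos less_imp_le)
    have x1: "x = (\<beta>2 / \<rho>) *\<^sub>R w + (\<beta> / \<rho>) *\<^sub>R t"
    proof -
      have "x = (1/\<rho>) *\<^sub>R (\<beta>2 *\<^sub>R w + \<beta> *\<^sub>R t)" using x by simp
      then show ?thesis by (simp add: scaleR_add_right)
    qed
    define k where "k = \<beta> * \<beta>2 * (v / u)"
    have k: "k \<ge> 0" using 3 uv by (simp add: k_def)
    have "\<rho> *\<^sub>R x = (\<beta>2 * \<alpha> + \<beta> * \<alpha>2) *\<^sub>R A' + (\<beta>2 * \<gamma> + \<beta> * \<gamma>2) *\<^sub>R C' + (\<beta> * \<beta>2) *\<^sub>R (V' + V2')"
      unfolding x(3)[symmetric] w(4) t(4) by (simp add: algebra_simps)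
    also have "\<dots> = (\<beta>2 * \<alpha> + \<beta> * \<alpha>2 + k) *\<^sub>R A' + (\<beta>2 * \<gamma> + \<beta> * \<gamma>2 + k) *\<^sub>R C'"
      unfolding vertex_sum[OF assms(3)] k_def by (simp add: algebra_simps)
    finally have "(1/\<rho>) *\<^sub>R (\<rho> *\<^sub>R x) = (1/\<rho>) *\<^sub>R ((\<beta>2 * \<alpha> + \<beta> * \<alpha>2 + k) *\<^sub>R A' + (\<beta>2 * \<gamma> + \<beta> * \<gamma>2 + k) *\<^sub>R C')" by simp
    then have x2: "x = ((\<beta>2 * \<alpha> + \<beta> * \<alpha>2 + k) / \<rho>) *\<^sub>R A' + ((\<beta>2 * \<gamma> + \<beta> * \<gamma>2 + k) / \<rho>) *\<^sub>R C'"
      using x(2) by (simp add: scaleR_add_right)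
    have "skd A' x + skd x C' = skd A' C'"
      by (rule SK_between_comb[OF in_SK(1,3) x(1) x2]) (use w t k x(2) 3 in auto)
    moreover have "skd w x + skd x t = skd w t"
      by (rule SK_between_comb[OF wt x(1) x1]) (use x(2) 3 in auto)
    ultimately show ?thesis using x by blast
  qed
qed

text \<open>For points in different triangles the model segment is cut where it crosses A'C'; each
  piece stays in one triangle, and the triangle inequality in M joins the images.\<close>

lemma ruled_nonexpanding:
  assumes "ruled V V' W w" "vertex V V' V2 V2'" "ruled T T' Y y" "vertex T T' T2 T2'"
  shows "d W Y \<le> skd w y"
proof (cases "V = T \<and> V' = T'")
  case True
  then show ?thesis using ruled_nonexpanding_same[OF assms(1) _ assms(2)] assms(3) by simp
next
  case False
  then have V2: "T = V2" "T' = V2'" using assms(2,4) by (auto simp: vertex_def)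
  obtain x where x: "x \<in> SK_set K" "skd A' x + skd x C' = skd A' C'" "skd w x + skd x y = skd w y"
    using crossing[OF assms(1) _ assms(2), of Y y] assms(3) V2 by blast
  obtain X where X: "matched A C X A' C' x"
    using matched_point[of A C A' C' x] in_M in_SK x diagonals by auto
  have "d W X \<le> skd w x" using ruled_nonexpanding_same[OF assms(1) ruled_diagonal[OF X assms(2)] assms(2)] .
  moreover have "d X Y \<le> skd x y"
    using ruled_nonexpanding_same[OF ruled_diagonal[OF X assms(4)] assms(3,4)] .
  moreover have "d W Y \<le> d W X + d X Y"
    using ruled_in[OF assms(1)] ruled_in[OF assms(3)] X by (intro triangle) (auto simp: matched_def)
  ultimately show ?thesis using x(3) by linarith
qed

text \<open>Distances along its own ruling are exact, so W is exact at an interior point X of AC and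
  hence on all of AC. This contains m, which is interior to BD, so exactness spreads to BD as
  well.\<close>

lemma iruled_exact:
  assumes "iruled V V' W w" "vertex V V' V2 V2'"
  shows "matched A C Y A' C' y \<Longrightarrow> d W Y = skd w y"
    "matched B D Y B' D' y \<Longrightarrow> d W Y = skd w y"
proof -
  obtain X x where X: "matched A C X A' C' x" "0 < d A X" "0 < d X C" "matched V X W V' x w"
    using assms by (auto simp: iruled_def)
  have W: "W \<in> M" "w \<in> SK_set K" "ruled V V' W w" using X iruled_ruled[OF assms(1)] by (auto simp: matched_def)
  have ends: "matched A C A A' C' A'" "matched A C C A' C' C'" "matched B D B B' D' B'" "matched B D D B' D' D'"
    using matched_ends in_M in_SK diagonals by auto
  have "d W A \<le> skd w A'" "d W C \<le> skd w C'"
    using ruled_nonexpanding_same[OF W(3) ruled_diagonal[OF _ assms(2)] assms(2)] ends by auto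
  moreover have "d W X = skd w x" using X(4) by (auto simp: matched_def)
  ultimately have AC': "d W Y = skd w y" if "matched A C Y A' C' y" for Y y
    using matched_spread[OF X(1) W(1,2) _ _ _ X(2,3) that] by blast
  then show "matched A C Y A' C' y \<Longrightarrow> d W Y = skd w y" .
  have vv: "vertex B B' D D'" "vertex D D' B B'" by (auto simp: vertex_def)
  have "d W B \<le> skd w B'" "d W D \<le> skd w D'"
    using ruled_nonexpanding[OF W(3) assms(2) iruled_ruled[OF iruled_vertex]] vv by auto
  then show "matched B D Y B' D' y \<Longrightarrow> d W Y = skd w y"
    using matched_spread[OF BD(1) W(1,2) _ _ AC'[OF AC(1)] BD(2,3)] by blast
qed

lemma iruled_vertex_exact:
  assumes "iruled V V' W w" "vertex V V' V2 V2'" "vertex T T' T2 T2'"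
  shows "d W T = skd w T'"
proof -
  have "matched B D T B' D' T'"
    using assms(3) matched_ends[of B D B' D'] in_M in_SK diagonals by (auto simp: vertex_def)
  then show ?thesis using iruled_exact(2)[OF assms(1,2)] by blast
qed

text \<open>Prolong the ruling from w through its foot x to a point n of the opposite triangle. Then
  X is interior to the segment from N to W, the distance from Y to X is exact, and the defects at
  both ends are nonnegative; so the one at W vanishes.\<close>

lemma iruled_isometric:
  assumes W: "iruled V V' W w" "vertex V V' V2 V2'" and T: "iruled T T' Y y" "vertex T T' T2 T2'"
  shows "d Y W = skd y w"
proof (cases "w = V'")
  case True
  interpret S: cat_space K "SK_set K" skd by (rule SK_cat_space)
  have "W = V" using True W(1) vertex_in[OF W(2)] commute[of W V] by (auto simp: iruled_def matched_def)
  then show ?thesis using True iruled_vertex_exact[OF T W(2)] by simp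
next
  case False
  interpret S: cat_space K "SK_set K" skd by (rule SK_cat_space)
  obtain X x where X: "matched A C X A' C' x" "0 < d A X" "0 < d X C" "matched V X W V' x w"
    using W by (auto simp: iruled_def)
  have x: "x \<in> SK_set K" "X \<in> M" using X by (auto simp: matched_def)
  have Vx: "V' \<noteq> x"
  proof
    assume "V' = x"
    then have "skd V' w + skd w x = 0" using X(4) x by (simp add: matched_def)
    then have "skd V' w = 0" using S.nonneg[of V' w] S.nonneg[of w x] by linarith
    then show False using False vertex_in[OF W(2)] X(4) by (auto simp: matched_def)
  qed
  obtain \<alpha> \<gamma> where a: "\<alpha> > 0" "\<gamma> > 0" "x = \<alpha> *\<^sub>R A' + \<gamma> *\<^sub>R C'"
    using between_comb[of A' C' x] X by (auto simp: matched_def)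
  define k where "k = v / u"
  have k: "k > 0" using uv by (simp add: k_def)
  \<comment> \<open>The prolonged point is a multiple of x - t V'. Replacing -V' by V2' - k (A' +
    C') leaves the coefficients \<alpha> - t k and \<gamma> - t k, and this t keeps both positive,
    so n lies on an interior ruling.\<close>
  define t where "t = min \<alpha> \<gamma> / (2 * k)"
  have t: "t > 0" "t * k < \<alpha>" "t * k < \<gamma>" using a k by (auto simp: t_def min_def)
  obtain x1 \<rho>1 where x1: "x1 \<in> SK_set K" "\<rho>1 > 0" "(\<alpha> - t * k) *\<^sub>R A' + (\<gamma> - t * k) *\<^sub>R C' = \<rho>1 *\<^sub>R x1"
    using SK_normalize[OF in_SK(1,3), of "\<alpha> - t * k" "\<gamma> - t * k"] t
    by (meson add_pos_pos diff_gt_0_iff_gt less_imp_le)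
  obtain n \<rho> where n: "n \<in> SK_set K" "\<rho> > 0" "\<rho>1 *\<^sub>R x1 + t *\<^sub>R V2' = \<rho> *\<^sub>R n"
    using SK_normalize[OF x1(1), of V2' \<rho>1 t] vertex_in[OF W(2)] t(1) x1(2)
    by (meson add_pos_pos less_imp_le)
  have V2k: "V' + V2' = k *\<^sub>R (A' + C')" using vertex_sum[OF W(2)] by (simp add: k_def)
  have nx: "x = \<rho> *\<^sub>R n + t *\<^sub>R V'"
  proof -
    have "\<rho> *\<^sub>R n + t *\<^sub>R V' = \<rho>1 *\<^sub>R x1 + t *\<^sub>R (V' + V2')" unfolding n(3)[symmetric] by (simp add: algebra_simps)
    also have "\<dots> = x" unfolding V2k x1(3)[symmetric] a(3) by (simp add: algebra_simps)
    finally show ?thesis ..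
  qed
  have nc: "n = ((\<alpha> - t * k) / \<rho>) *\<^sub>R A' + ((\<gamma> - t * k) / \<rho>) *\<^sub>R C' + (t / \<rho>) *\<^sub>R V2'"
  proof -
    have "n = (1/\<rho>) *\<^sub>R (\<rho>1 *\<^sub>R x1 + t *\<^sub>R V2')" using n by simp
    then show ?thesis unfolding x1(3)[symmetric] by (simp add: scaleR_add_right)
  qed
  have V2: "vertex V2 V2' V V'" using vertex_commute W(2) by blast
  obtain N where N: "iruled V2 V2' N n"
    using comb_ruled(2)[OF n(1) nc _ _ _ V2] t n by auto
  have NM: "N \<in> M" using ruled_in iruled_ruled N by blast
  have "n \<noteq> x"
  proof
    assume "n = x"
    then have "x = t *\<^sub>R V' + \<rho> *\<^sub>R x" using nx by (simp add: add.commute)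
    then show False using SK_comb_neq[OF x(1), of V' x \<rho> t] vertex_in[OF W(2)] Vx t by (auto simp: add.commute)
  qed
  have between: "skd V' x + skd x n = skd V' n"
    using SK_between_comb[OF n(1) _ x(1) nx] vertex_in[OF W(2)] n t S.commute by (simp add: add.commute)
  have dd: "d V N = skd V' n" "d X N = skd x n" "d V X = skd V' x"
    using iruled_vertex_exact[OF N V2 W(2)] iruled_exact(1)[OF N V2 X(1)] vertex_exact[OF X(1) W(2)]
      commute skd_commute by auto
  have "matched V N X V' n x"
    unfolding matched_def using between dd vertex_in[OF W(2)] NM n x by auto
  then have mt: "matched N W X n w x" using matched_commute[OF matched_extend[OF _ X(4)]] by blast
  have Y: "Y \<in> M" "y \<in> SK_set K" "ruled T T' Y y" using ruled_in iruled_ruled T(1) by blast+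
  show ?thesis
  proof (rule matched_exact[OF mt Y(1,2)])
    show "d Y N \<le> skd y n" using ruled_nonexpanding[OF Y(3) T(2) iruled_ruled[OF N] V2] .
    show "d Y W \<le> skd y w" using ruled_nonexpanding[OF Y(3) T(2) iruled_ruled[OF W(1)] W(2)] .
    show "d Y X = skd y x" using iruled_exact(1)[OF T X(1)] .
    show "0 < d N X" using dd(2) \<open>n \<noteq> x\<close> S.mdist_pos_less[of x n] n x commute[of N X] by auto
  qed
qed

text \<open>Any step towards m' makes the coefficients of A' and C' positive, since those of m' are
  1/u.\<close>

lemma ruled_approx:
  assumes "ruled V V' W w" "vertex V V' V2 V2'" "e > 0"
  shows "\<exists>T t. iruled V V' T t \<and> skd w t < e"
proof (cases "w = m'")
  case True
  interpret S: cat_space K "SK_set K" skd by (rule SK_cat_space)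
  have "\<exists>T. iruled V V' T m'"
  proof (rule comb_ruled(2)[OF in_SK(5) _ _ _ _ assms(2)])
    have "m' = (1/u) *\<^sub>R (A' + C')" using uv by simp
    then show "m' = (1/u) *\<^sub>R A' + (1/u) *\<^sub>R C' + 0 *\<^sub>R V'" by (simp add: scaleR_add_right)
  qed (use uv in auto)
  moreover have "skd w m' < e" using True assms(3) in_SK by simp
  ultimately show ?thesis by blast
next
  case False
  interpret S: cat_space K "SK_set K" skd by (rule SK_cat_space)
  have w: "w \<in> SK_set K" using ruled_in assms by blast
  define L where "L = skd w m'"
  have L: "L > 0" using False w in_SK by (auto simp: L_def S.mdist_pos_less)
  define s where "s = min (L/2) (e/2)"
  have s: "0 < s" "s < L" "s < e" using L assms by (auto simp: s_def)
  obtain t where t: "t \<in> SK_set K" "skd w t = s" "skd t m' = L - s"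
    using S.point_at[OF w in_SK(5), of s] s by (auto simp: L_def)
  obtain \<sigma> \<tau> where st: "\<sigma> > 0" "\<tau> > 0" "t = \<sigma> *\<^sub>R w + \<tau> *\<^sub>R m'"
    using between_comb[OF w in_SK(5) t(1)] t s by (auto simp: L_def)
  obtain \<alpha> \<gamma> \<beta> where c: "\<alpha> \<ge> 0" "\<gamma> \<ge> 0" "\<beta> \<ge> 0" "w = \<alpha> *\<^sub>R A' + \<gamma> *\<^sub>R C' + \<beta> *\<^sub>R V'"
    using ruled_comb[OF assms(1)] by blast
  have m'c: "m' = (1/u) *\<^sub>R (A' + C')" using uv by simp
  have tc: "t = (\<sigma> * \<alpha> + \<tau> / u) *\<^sub>R A' + (\<sigma> * \<gamma> + \<tau> / u) *\<^sub>R C' + (\<sigma> * \<beta>) *\<^sub>R V'"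
    unfolding st(3) c(4) m'c by (simp add: algebra_simps)
  have "\<tau> / u > 0" "\<sigma> * \<alpha> \<ge> 0" "\<sigma> * \<gamma> \<ge> 0" "\<sigma> * \<beta> \<ge> 0" using uv st c by auto
  then have "\<exists>T. iruled V V' T t"
    by (intro comb_ruled(2)[OF t(1) tc _ _ _ assms(2)]) auto
  then show ?thesis using t s by auto
qed

text \<open>Interior rulings are dense and the map is nonexpanding, so the lower bound passes to the
  limit; four errors of e/4 arise, two in M and two in the model.\<close>

lemma ruled_isometric:
  assumes W: "ruled V V' W w" "vertex V V' V2 V2'" and T: "ruled T T' Y y" "vertex T T' T2 T2'"
  shows "d W Y = skd w y"
proof (rule antisym)
  interpret S: cat_space K "SK_set K" skd by (rule SK_cat_space)
  show "d W Y \<le> skd w y" using ruled_nonexpanding[OF W T] .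
  show "skd w y \<le> d W Y"
  proof (rule field_le_epsilon)
    fix e :: real assume "e > 0"
    then have e4: "e/4 > 0" by simp
    obtain W1 w1 where 1: "iruled V V' W1 w1" "skd w w1 < e/4" using ruled_approx[OF W e4] by blast
    obtain Y1 y1 where 2: "iruled T T' Y1 y1" "skd y y1 < e/4" using ruled_approx[OF T e4] by blast
    note r1 = iruled_ruled[OF 1(1)] note r2 = iruled_ruled[OF 2(1)]
    have M: "W \<in> M" "Y \<in> M" "W1 \<in> M" "Y1 \<in> M" and N: "w \<in> SK_set K" "y \<in> SK_set K" "w1 \<in> SK_set K" "y1 \<in> SK_set K"
      using ruled_in W T r1 r2 by blast+
    have "d W W1 \<le> skd w w1" "d Y Y1 \<le> skd y y1"
      using ruled_nonexpanding[OF W r1 W(2)] ruled_nonexpanding[OF T r2 T(2)] by auto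
    moreover have "d W1 Y1 = skd w1 y1" using iruled_isometric[OF 2(1) T(2) 1(1) W(2)] .
    moreover have "d W1 Y1 \<le> d W1 W + d W Y + d Y Y1"
      using triangle[of W1 W Y1] triangle[of W Y Y1] M by linarith
    moreover have "skd w y \<le> skd w w1 + skd w1 y1 + skd y1 y"
      using S.triangle[of w w1 y] S.triangle[of w1 y1 y] N by linarith
    ultimately show "skd w y \<le> d W Y + e" using 1 2 commute[of W1 W] S.commute[of y1 y] by linarith
  qed
qed

end

section \<open>Geodesic hulls under isometric maps\<close>

context cat_space
begin

text \<open>By uniqueness of the point at a given distance along a segment, an isometric map of a
  convex set takes all points between p and q onto all points between their images, and so commutes
  with each stage of the hull.\<close>

lemma geo_hull_image:
  assumes R: "R \<subseteq> SK_set K" "\<And>x y z. x \<in> R \<Longrightarrow> y \<in> R \<Longrightarrow> z \<in> SK_set K \<Longrightarrow> skd x z + skd z y = skd x y \<Longrightarrow> z \<in> R"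
    and F: "F ` R \<subseteq> M" "\<And>x y. x \<in> R \<Longrightarrow> y \<in> R \<Longrightarrow> d (F x) (F y) = skd x y" and S: "S \<subseteq> R"
  shows "geo_hull (SK_set K) skd S \<subseteq> R" "geo_hull M d (F ` S) = F ` geo_hull (SK_set K) skd S"
proof -
  interpret S: cat_space K "SK_set K" skd by (rule SK_cat_space)
  have seg: "geo_seg (SK_set K) skd p q \<subseteq> R" "geo_seg M d (F p) (F q) = F ` geo_seg (SK_set K) skd p q"
    if "p \<in> R" "q \<in> R" for p q
  proof -
    have pq: "p \<in> SK_set K" "q \<in> SK_set K" "F p \<in> M" "F q \<in> M" using that R(1) F(1) by auto
    have s1: "geo_seg (SK_set K) skd p q = {z \<in> SK_set K. skd p z + skd z q = skd p q}"
      using S.geo_seg_between pq by blast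
    have s2: "geo_seg M d (F p) (F q) = {Z \<in> M. d (F p) Z + d Z (F q) = d (F p) (F q)}"
      using geo_seg_between pq by blast
    show sub: "geo_seg (SK_set K) skd p q \<subseteq> R" unfolding s1 using R(2) that by blast
    show "geo_seg M d (F p) (F q) = F ` geo_seg (SK_set K) skd p q"
    proof (intro equalityI subsetI)
      fix Z assume "Z \<in> geo_seg M d (F p) (F q)"
      then have Z: "Z \<in> M" "d (F p) Z + d Z (F q) = d (F p) (F q)" unfolding s2 by auto
      have e: "d (F p) (F q) = skd p q" using F(2) that by blast
      have "0 \<le> d (F p) Z" "d (F p) Z \<le> skd p q" using Z(2) e nonneg[of Z "F q"] nonneg[of "F p" Z] by linarith+
      then obtain z where z: "z \<in> SK_set K" "skd p z = d (F p) Z" "skd z q = skd p q - d (F p) Z"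
        using S.point_at[OF pq(1,2)] by blast
      then have zs: "z \<in> geo_seg (SK_set K) skd p q" unfolding s1 by auto
      then have zR: "z \<in> R" using sub by blast
      have "Z = F z"
      proof (rule between_unique[OF pq(3,4) Z(1) _ Z(2)])
        show "F z \<in> M" using zR F(1) by blast
        show "d (F p) (F z) + d (F z) (F q) = d (F p) (F q)" "d (F p) Z = d (F p) (F z)"
          using F(2)[OF that(1) zR] F(2)[OF zR that(2)] z e by auto
      qed
      then show "Z \<in> F ` geo_seg (SK_set K) skd p q" using zs by blast
    next
      fix Z assume "Z \<in> F ` geo_seg (SK_set K) skd p q"
      then obtain z where z: "Z = F z" "z \<in> geo_seg (SK_set K) skd p q" by blast
      then have zR: "z \<in> R" using sub by blast
      then show "Z \<in> geo_seg M d (F p) (F q)"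
        using z F(1) F(2)[OF that(1) zR] F(2)[OF zR that(2)] F(2)[OF that] unfolding s1 s2 by auto
    qed
  qed
  have step: "geo_step (SK_set K) skd T \<subseteq> R" "geo_step M d (F ` T) = F ` geo_step (SK_set K) skd T" if "T \<subseteq> R" for T
  proof -
    show "geo_step (SK_set K) skd T \<subseteq> R" unfolding geo_step_def using seg(1) that by blast
    have "geo_step M d (F ` T) = (\<Union>p\<in>T. \<Union>q\<in>T. geo_seg M d (F p) (F q))" by (simp add: geo_step_def)
    also have "\<dots> = (\<Union>p\<in>T. \<Union>q\<in>T. F ` geo_seg (SK_set K) skd p q)"
      using seg(2) that by (intro SUP_cong refl) blast
    also have "\<dots> = F ` geo_step (SK_set K) skd T" by (simp add: geo_step_def image_UN)
    finally show "geo_step M d (F ` T) = F ` geo_step (SK_set K) skd T" .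
  qed
  have it: "(geo_step (SK_set K) skd ^^ n) S \<subseteq> R \<and> (geo_step M d ^^ n) (F ` S) = F ` (geo_step (SK_set K) skd ^^ n) S" for n
    by (induction n) (use S step in auto)
  show "geo_hull (SK_set K) skd S \<subseteq> R" unfolding geo_hull_def using it by blast
  show "geo_hull M d (F ` S) = F ` geo_hull (SK_set K) skd S"
    unfolding geo_hull_def image_UN using it by simp
qed

text \<open>The midpoint case of concavity; sn (2 p) = 2 sn p cs p leaves the cosine of half the
  diagonal that appears in the theorem.\<close>

lemma median:
  assumes "A \<in> M" "C \<in> M" "N \<in> M" "Y \<in> M" "d A N = p" "d N C = p" "d A C = 2 * p" "0 < p"
  shows "ip (d Y A) + ip (d Y C) \<le> 2 * cs p * ip (d Y N)"
proof -
  have "adm p" using dist_adm[of A N] assms by auto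
  then have s: "sn p > 0" using sn_pos assms by auto
  have "sn p * ip (d Y A) + sn p * ip (d Y C) \<le> sn (2 * p) * ip (d Y N)"
    using cat[OF assms(1-4)] assms(5-7) by simp
  also have "sn (2 * p) = sn p * (2 * cs p)" using sn_add[of p p] by (simp add: algebra_simps)
  finally have "sn p * (ip (d Y A) + ip (d Y C)) \<le> sn p * (2 * cs p * ip (d Y N))" by (simp add: algebra_simps)
  then show ?thesis using s by simp
qed

end

context parallelogram
begin

definition region :: "(real^3) set" where
  "region = {w. \<exists>V V' V2 V2' W. vertex V V' V2 V2' \<and> ruled V V' W w}"

lemma vertices: "vertex B B' D D'" "vertex D D' B B'"
  by (auto simp: vertex_def)

text \<open>In this form convexity is linear algebra. For the converse the smaller of the
  coefficients of B' and D' is traded, as a multiple of B' + D', for A' and C'.\<close>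

lemma region_iff:
  "w \<in> region \<longleftrightarrow> w \<in> SK_set K \<and> (\<exists>\<alpha>\<ge>0. \<exists>\<beta>\<ge>0. \<exists>\<gamma>\<ge>0. \<exists>\<delta>\<ge>0. w = \<alpha> *\<^sub>R A' + \<beta> *\<^sub>R B' + \<gamma> *\<^sub>R C' + \<delta> *\<^sub>R D')"
  (is "_ \<longleftrightarrow> _ \<and> ?c w")
proof
  assume "w \<in> region"
  then obtain V V' V2 V2' W where w: "vertex V V' V2 V2'" "ruled V V' W w" by (auto simp: region_def)
  obtain \<alpha> \<gamma> \<beta> where c: "\<alpha> \<ge> 0" "\<gamma> \<ge> 0" "\<beta> \<ge> 0" "w = \<alpha> *\<^sub>R A' + \<gamma> *\<^sub>R C' + \<beta> *\<^sub>R V'"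
    using ruled_comb[OF w(2)] by blast
  have "V' = B' \<or> V' = D'" using w(1) by (auto simp: vertex_def)
  then have "?c w"
  proof
    assume "V' = B'"
    then have "w = \<alpha> *\<^sub>R A' + \<beta> *\<^sub>R B' + \<gamma> *\<^sub>R C' + 0 *\<^sub>R D'" using c by (simp add: algebra_simps)
    then show ?thesis using c by blast
  next
    assume "V' = D'"
    then have "w = \<alpha> *\<^sub>R A' + 0 *\<^sub>R B' + \<gamma> *\<^sub>R C' + \<beta> *\<^sub>R D'" using c by (simp add: algebra_simps)
    then show ?thesis using c by blast
  qed
  then show "w \<in> SK_set K \<and> ?c w" using ruled_in[OF w(2)] by blast
next
  assume "w \<in> SK_set K \<and> ?c w"
  then obtain \<alpha> \<beta> \<gamma> \<delta> where c: "w \<in> SK_set K" "\<alpha> \<ge> 0" "\<beta> \<ge> 0" "\<gamma> \<ge> 0" "\<delta> \<ge> 0"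
    "w = \<alpha> *\<^sub>R A' + \<beta> *\<^sub>R B' + \<gamma> *\<^sub>R C' + \<delta> *\<^sub>R D'" by blast
  define k where "k = v / u"
  have k: "k > 0" "B' + D' = k *\<^sub>R (A' + C')" using uv vertex_sum[OF vertices(1)] by (auto simp: k_def)
  have "\<exists>V V' V2 V2' W. vertex V V' V2 V2' \<and> ruled V V' W w"
  proof (cases "\<delta> \<le> \<beta>")
    case True
    have "w = \<alpha> *\<^sub>R A' + \<gamma> *\<^sub>R C' + (\<beta> - \<delta>) *\<^sub>R B' + \<delta> *\<^sub>R (B' + D')" unfolding c(6) by (simp add: algebra_simps)
    also have "\<dots> = (\<alpha> + \<delta> * k) *\<^sub>R A' + (\<gamma> + \<delta> * k) *\<^sub>R C' + (\<beta> - \<delta>) *\<^sub>R B'" unfolding k(2) by (simp add: algebra_simps)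
    finally show ?thesis using comb_ruled(1)[OF c(1) _ _ _ _ vertices(1)] vertices(1) c k True
      by (metis add_nonneg_nonneg diff_ge_0_iff_ge less_imp_le mult_nonneg_nonneg)
  next
    case False
    have "w = \<alpha> *\<^sub>R A' + \<gamma> *\<^sub>R C' + (\<delta> - \<beta>) *\<^sub>R D' + \<beta> *\<^sub>R (B' + D')" unfolding c(6) by (simp add: algebra_simps)
    also have "\<dots> = (\<alpha> + \<beta> * k) *\<^sub>R A' + (\<gamma> + \<beta> * k) *\<^sub>R C' + (\<delta> - \<beta>) *\<^sub>R D'" unfolding k(2) by (simp add: algebra_simps)
    finally show ?thesis using comb_ruled(1)[OF c(1) _ _ _ _ vertices(2)] vertices(2) c k False
      by (metis add_nonneg_nonneg diff_ge_0_iff_ge less_imp_le linorder_not_le mult_nonneg_nonneg)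
  qed
  then show "w \<in> region" by (simp add: region_def)
qed

lemma region_convex:
  assumes "x \<in> region" "y \<in> region" "z \<in> SK_set K" "skd x z + skd z y = skd x y"
  shows "z \<in> region"
proof -
  obtain \<alpha> \<beta> \<gamma> \<delta> where x: "x \<in> SK_set K" "\<alpha> \<ge> 0" "\<beta> \<ge> 0" "\<gamma> \<ge> 0" "\<delta> \<ge> 0"
    "x = \<alpha> *\<^sub>R A' + \<beta> *\<^sub>R B' + \<gamma> *\<^sub>R C' + \<delta> *\<^sub>R D'" using assms(1) unfolding region_iff by blast
  obtain \<alpha>2 \<beta>2 \<gamma>2 \<delta>2 where y: "y \<in> SK_set K" "\<alpha>2 \<ge> 0" "\<beta>2 \<ge> 0" "\<gamma>2 \<ge> 0" "\<delta>2 \<ge> 0"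
    "y = \<alpha>2 *\<^sub>R A' + \<beta>2 *\<^sub>R B' + \<gamma>2 *\<^sub>R C' + \<delta>2 *\<^sub>R D'" using assms(2) unfolding region_iff by blast
  obtain s t where st: "s \<ge> 0" "t \<ge> 0" "z = s *\<^sub>R x + t *\<^sub>R y" using between_comb[OF x(1) y(1) assms(3,4)] by blast
  have "z = (s * \<alpha> + t * \<alpha>2) *\<^sub>R A' + (s * \<beta> + t * \<beta>2) *\<^sub>R B' + (s * \<gamma> + t * \<gamma>2) *\<^sub>R C' + (s * \<delta> + t * \<delta>2) *\<^sub>R D'"
    unfolding st(3) x(6) y(6) by (simp add: algebra_simps)
  moreover have "0 \<le> s * \<alpha> + t * \<alpha>2" "0 \<le> s * \<beta> + t * \<beta>2" "0 \<le> s * \<gamma> + t * \<gamma>2" "0 \<le> s * \<delta> + t * \<delta>2"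
    using x y st by auto
  ultimately show ?thesis unfolding region_iff using assms(3) by blast
qed

text \<open>The isometry is the inverse of the ruling map on the model hull.\<close>

lemma hull_isometry:
  "\<exists>f. f A = A' \<and> f B = B' \<and> f C = C' \<and> f D = D' \<and>
     f ` geo_hull M d {A, B, C, D} = geo_hull (SK_set K) skd {A', B', C', D'} \<and>
     (\<forall>x\<in>geo_hull M d {A, B, C, D}. \<forall>y\<in>geo_hull M d {A, B, C, D}. skd (f x) (f y) = d x y) \<and>
     geo_hull M d {A, B, C, D} \<subseteq> M"
proof -
  interpret S: cat_space K "SK_set K" skd by (rule SK_cat_space)
  define rel where "rel = (\<lambda>w W. \<exists>V V' V2 V2'. vertex V V' V2 V2' \<and> ruled V V' W w)"
  have iso: "d W Y = skd w y" if "rel w W" "rel y Y" for w W y Y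
    using that ruled_isometric unfolding rel_def by blast
  have relM: "W \<in> M \<and> w \<in> SK_set K" if "rel w W" for w W
    using that ruled_in unfolding rel_def by blast
  \<comment> \<open>A point may lie on several rulings, but its images have distance
    \<open>skd w w\<close> = 0, so the choice is immaterial.\<close>
  define F where "F = (\<lambda>w. SOME W. rel w W)"
  have F: "rel w (F w)" if "w \<in> region" for w
    using that someI_ex[of "rel w"] unfolding F_def region_def rel_def by blast
  have Feq: "F w = W" "w \<in> region" if "rel w W" for w W
  proof -
    show r: "w \<in> region" using that by (auto simp: region_def rel_def)
    have "d (F w) W = 0" using iso[OF F[OF r] that] relM[OF that] by simp
    then show "F w = W" using relM[OF that] relM[OF F[OF r]] by simp
  qed
  have ends: "matched A C A A' C' A'" "matched A C C A' C' C'"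
    using matched_ends in_M in_SK diagonals by auto
  have rels: "rel A' A" "rel B' B" "rel C' C" "rel D' D"
    using ruled_diagonal[OF ends(1) vertices(1)] ruled_diagonal[OF ends(2) vertices(1)]
      iruled_ruled[OF iruled_vertex[OF vertices(1)]] iruled_ruled[OF iruled_vertex[OF vertices(2)]] vertices
    unfolding rel_def by blast+
  have im: "F ` {A', B', C', D'} = {A, B, C, D}" using Feq(1)[OF rels(1)] Feq(1)[OF rels(2)] Feq(1)[OF rels(3)] Feq(1)[OF rels(4)] by simp
  have SR: "{A', B', C', D'} \<subseteq> region" using Feq(2) rels by blast
  have rSK: "region \<subseteq> SK_set K" using region_iff by blast
  have FM: "F ` region \<subseteq> M" using F relM by blast
  have Fiso: "d (F x) (F y) = skd x y" if "x \<in> region" "y \<in> region" for x y using iso F that by blast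
  define H where "H = geo_hull (SK_set K) skd {A', B', C', D'}"
  have H: "H \<subseteq> region" "geo_hull M d {A, B, C, D} = F ` H"
    using geo_hull_image[OF rSK region_convex FM Fiso SR] unfolding im H_def by auto
  have inj: "inj_on F H"
  proof (rule inj_onI)
    fix x y assume "x \<in> H" "y \<in> H" "F x = F y"
    then have "x \<in> region" "y \<in> region" "F x = F y" using H by auto
    then have "skd x y = 0" using Fiso[of x y] FM by (metis zero image_subset_iff)
    then show "x = y" using \<open>x \<in> region\<close> \<open>y \<in> region\<close> rSK S.zero by blast
  qed
  have AH: "{A', B', C', D'} \<subseteq> H"
  proof -
    have "(geo_step (SK_set K) skd ^^ 0) {A', B', C', D'} \<subseteq> H" unfolding H_def geo_hull_def by blast
    then show ?thesis by simp
  qed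
  define f where "f = inv_into H F"
  have fF: "f (F w) = w" if "w \<in> H" for w using that inj by (simp add: f_def)
  have "f A = A'" "f B = B'" "f C = C'" "f D = D'"
    using fF AH Feq(1)[OF rels(1)] Feq(1)[OF rels(2)] Feq(1)[OF rels(3)] Feq(1)[OF rels(4)] by auto
  moreover have "f ` F ` H = H" using fF by (force simp: image_image)
  moreover have "\<forall>x\<in>F ` H. \<forall>y\<in>F ` H. skd (f x) (f y) = d x y"
    using fF Fiso H(1) by (simp add: subset_iff)
  moreover have "F ` H \<subseteq> M" using FM H(1) by blast
  ultimately show ?thesis unfolding H(2) H_def[symmetric] by blast
qed

end

section \<open>The equality case\<close>

context ktrig
begin

lemma cs_half_pos:
  assumes "adm (2 * t)" "0 \<le> t"
  shows "cs t > 0"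
proof -
  have "0 \<le> kap * t" "K > 0 \<longrightarrow> 2 * (kap * t) < pi"
    using assms kap_pos by (auto simp: adm_def mult.left_commute)
  moreover have "0 < pi" by simp
  ultimately have "K > 0 \<longrightarrow> 0 < cos (kap * t)" by (intro impI cos_gt_zero_pi) linarith+
  then show ?thesis by (simp add: cs_def)
qed

lemma cs_double: "cs (2 * t) = 2 * cs t ^ 2 - 1"
  using cs_add[of t t] pyth[of t] by (simp add: power2_eq_square algebra_simps)

text \<open>Applied with s, t the distances of B and D from the midpoint of AC and 2 q = BD. The sum
  is 2 \<open>ip h\<close> \<open>cs e\<close> for the half sum h and half difference e, so equality
  needs h = q and e = 0.\<close>

lemma ip_sum:
  assumes s: "adm s" "adm t" and q: "adm (2 * q)" "0 \<le> q" "2 * q \<le> s + t"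
  shows "ip s + ip t \<le> 2 * ip q" "ip s + ip t = 2 * ip q \<Longrightarrow> s = q \<and> t = q"
proof -
  define h e where "h = (s + t) / 2" and "e = (s - t) / 2"
  have st: "s = h + e" "t = h - e" by (auto simp: h_def e_def field_simps)
  have id: "ip s + ip t = 2 * (ip h * cs e)"
    unfolding st ip_def by (simp add: cs_add cs_diff algebra_simps)
  have "kap * s < pi \<and> kap * t < pi \<and> 2 * (kap * h) = kap * s + kap * t" if "K > 0"
    using s that by (auto simp: adm_def h_def field_simps)
  then have h: "adm h" using s by (auto simp: adm_def h_def)
  have "2 * \<bar>e\<bar> = \<bar>s - t\<bar>" by (simp add: e_def)
  then have "adm (2 * \<bar>e\<bar>)"
    using s adm_mono[of s "\<bar>s - t\<bar>"] adm_mono[of t "\<bar>s - t\<bar>"] adm_nonneg by (cases "s \<le> t") auto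
  then have e: "adm \<bar>e\<bar>" "cs e > 0" using adm_mono[of "2 * \<bar>e\<bar>" "\<bar>e\<bar>"] cs_half_pos[of "\<bar>e\<bar>"] by auto
  have aq: "adm q" using adm_mono[OF q(1)] q by auto
  have hq: "ip h \<le> ip q" using q h aq by (subst ip_le_iff) (auto simp: h_def)
  have ce: "eps * cs e \<le> eps" "cs e = 1 \<Longrightarrow> e = 0"
  proof -
    have a0: "adm 0" using kap_pos by (simp add: adm_def)
    show "eps * cs e \<le> eps" using ip_le_iff[OF e(1) a0] by (simp add: ip_def)
    assume "cs e = 1"
    then have "ip \<bar>e\<bar> = ip 0" by (simp add: ip_def)
    then show "e = 0" using ip_eq_iff[OF e(1) a0] by simp
  qed
  have "ip h * cs e \<le> ip q \<and> (ip h * cs e = ip q \<longrightarrow> ip h = ip q \<and> cs e = 1)"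
  proof (cases "K > 0")
    case True
    then have 1: "cs e \<le> 1" using ce eps_cases by auto
    have iq: "ip q > 0" using cs_half_pos[OF q(1,2)] True eps_cases by (auto simp: ip_def)
    show ?thesis
    proof (cases "ip h > 0")
      case pos: True
      have le: "ip h * cs e \<le> ip h * 1" using pos 1 by (intro mult_left_mono) auto
      moreover have "cs e = 1" if "ip h * cs e = ip q"
      proof -
        have "ip h * 1 \<le> ip h * cs e" using that hq by simp
        then have "1 \<le> cs e" using pos by (subst (asm) mult_le_cancel_left) auto
        then show ?thesis using 1 by simp
      qed
      ultimately show ?thesis using hq by auto
    next
      \<comment> \<open>A large half sum reverses the effect of \<open>cs e\<close>, but then the
        left side is at most 0 while \<open>ip q\<close> is positive, as 2 q is admissible.\<close>
      case False
      then have "ip h * cs e \<le> 0" using e(2) by (simp add: mult_nonpos_nonneg)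
      then show ?thesis using iq by auto
    qed
  next
    case False
    then have 1: "cs e \<ge> 1" using ce eps_cases by auto
    have neg: "ip h < 0" using False eps_cases cs_half_pos by (auto simp: ip_def cs_def)
    have le: "ip h * cs e \<le> ip h * 1" using neg 1 by (intro mult_left_mono_neg) auto
    moreover have "cs e = 1" if "ip h * cs e = ip q"
    proof -
      have "ip h * 1 \<le> ip h * cs e" using that hq by simp
      then have "cs e \<le> 1" using neg by (subst (asm) mult_le_cancel_left) auto
      then show ?thesis using 1 by simp
    qed
    ultimately show ?thesis using hq by auto
  qed
  then have r: "ip h * cs e \<le> ip q" "ip h * cs e = ip q \<Longrightarrow> h = q \<and> e = 0"
    using ip_eq_iff[OF h aq] ce(2) by auto
  show "ip s + ip t \<le> 2 * ip q" using r(1) id by simp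
  show "s = q \<and> t = q" if "ip s + ip t = 2 * ip q"
    using r(2) that id st by auto
qed

text \<open>With equal sides x the terms in \<open>cs x ^ 2\<close> combine by Pythagoras, and
  clearing denominators leaves a relation between the sides and the diagonals.\<close>

lemma cosq_iff:
  assumes "sn x \<noteq> 0" "1 + cs a \<noteq> 0"
  shows "cosq K x x a b e f = -1 \<longleftrightarrow> (1 + cs b) * (1 + cs a) = (cs x + cs e) * (cs x + cs f)"
proof -
  define P where "P = (cs x + cs e) * (cs x + cs f)"
  have c: "cosq K x x a b e f = eps * ((cs b + cs x ^ 2) / sn x ^ 2 - P / ((1 + cs a) * sn x ^ 2))"
    using eps_cases by (auto simp: cosq_def Let_def cs_def sn_def kap_def P_def power2_eq_square mult.assoc)
  have "cosq K x x a b e f = -1 \<longleftrightarrow> (cs b + cs x ^ 2) / sn x ^ 2 - P / ((1 + cs a) * sn x ^ 2) = - eps"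
    unfolding c using eps_cases by auto
  also have "\<dots> \<longleftrightarrow> (cs b + cs x ^ 2) * (1 + cs a) - P = - eps * sn x ^ 2 * (1 + cs a)"
  proof -
    have "N / X - P / (Y * X) = E \<longleftrightarrow> N * Y - P = E * X * Y" if "X \<noteq> 0" "Y \<noteq> 0" for N X Y E :: real
      using that by (auto simp: field_simps)
    then show ?thesis using assms by simp
  qed
  also have "- eps * sn x ^ 2 = cs x ^ 2 - 1" using pyth[of x] by simp
  also have "(cs b + cs x ^ 2) * (1 + cs a) - P = (cs x ^ 2 - 1) * (1 + cs a) \<longleftrightarrow> (1 + cs b) * (1 + cs a) = P"
    by (auto simp: algebra_simps)
  finally show ?thesis by (simp add: P_def)
qed

text \<open>With \<open>A + C\<close>, \<open>B\<close>, \<open>D\<close> and the hypothesis on \<open>cosq\<close>, the Gram determinant becomes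
  \<open>- (P - Q)\<^sup>2\<close>, where \<open>P\<close>, \<open>Q\<close> are the products of \<open>A + C\<close> with \<open>B\<close> and \<open>D\<close>.\<close>
lemma SK_parallelogram_equality:
  assumes in_SK: "A \<in> SK_set K" "B \<in> SK_set K" "C \<in> SK_set K" "D \<in> SK_set K"
    and eq: "skd A D = skd B C" "A \<noteq> D" and cosq: "cosqSK K A D C B = -1"
    and per: "K > 0 \<Longrightarrow> kap * (skd A B + skd B C + skd C D + skd D A) < 2 * pi"
  shows "ip (skd A B) + ip (skd B C) + ip (skd C D) + ip (skd D A) = 4 * cs (skd A C / 2) * ip (skd B D / 2)"
proof -
  interpret S: cat_space K "SK_set K" skd by (rule SK_cat_space)
  define p q where "p = skd A C / 2" and "q = skd B D / 2"
  have pq: "skd A C = 2 * p" "skd B D = 2 * q" "p \<ge> 0" "q \<ge> 0" by (auto simp: p_def q_def)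
  have cp: "cs p > 0" "cs q > 0" using S.dist_adm[OF in_SK(1,3)] S.dist_adm[OF in_SK(2,4)] cs_half_pos pq by auto
  define P Q where "P = cs (skd A B) + cs (skd B C)" and "Q = cs (skd C D) + cs (skd A D)"
  define x where "x = skd A D"
  have x: "sn x > 0" using S.dist_adm[OF in_SK(1,4)] in_SK eq(2) by (auto simp: x_def S.mdist_pos_less intro!: sn_pos)
  have a: "1 + cs (2 * p) = 2 * cs p ^ 2" "1 + cs (2 * q) = 2 * cs q ^ 2" by (auto simp: cs_double)
  have "cosq K x x (2 * p) (2 * q) (skd C D) (skd A B) = -1"
    using cosq in_SK eq(1) pq S.commute[of D C] S.commute[of C B] S.commute[of D B]
    by (simp add: cosqSK_def Let_def skd_def x_def)
  then have "(1 + cs (2 * q)) * (1 + cs (2 * p)) = (cs x + cs (skd C D)) * (cs x + cs (skd A B))"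
    using x cp a(1) by (subst (asm) cosq_iff) auto
  \<comment> \<open>As AD = BC = x, the two factors are Q and P.\<close>
  then have PQ: "P * Q = 4 * cs p ^ 2 * cs q ^ 2"
    unfolding a using eq(1) by (simp add: P_def Q_def x_def algebra_simps)
  have f: "form X Y = eps * cs (skd X Y)" if "X \<in> SK_set K" "Y \<in> SK_set K" for X Y
    using skd_ip(2)[OF that] by (simp add: ip_def)
  have fAC: "form A C = eps * (2 * cs p ^ 2 - 1)" and fBD: "form B D = eps * (2 * cs q ^ 2 - 1)"
    using f in_SK pq cs_double by simp_all
  have u: "form (A + C) (A + C) = eps * (4 * cs p ^ 2)" "form (A + C) B = eps * P" "form (A + C) D = eps * Q"
    "form B D = eps * (2 * cs q ^ 2 - 1)" "form B B = eps" "form D D = eps"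
  proof -
    have self: "form A A = eps" "form B B = eps" "form C C = eps" "form D D = eps" using in_SK by (auto simp: SK_set_iff)
    then show "form (A + C) (A + C) = eps * (4 * cs p ^ 2)" "form B B = eps" "form D D = eps"
      using fAC form_commute[of C A] by (simp_all add: algebra_simps)
    show "form (A + C) B = eps * P" "form (A + C) D = eps * Q"
      using f in_SK S.commute[of C B] by (simp_all add: P_def Q_def distrib_left)
  qed (rule fBD)
  have "0 \<le> - ((P - Q)\<^sup>2)"
  proof -
    define c where "c = 2 * cs q ^ 2 - 1"
    have "0 \<le> eps * (eps * (4 * cs p ^ 2) * eps * eps + 2 * (eps * P) * (eps * c) * (eps * Q)
      - eps * (4 * cs p ^ 2) * (eps * c)^2 - eps * (eps * Q)^2 - eps * (eps * P)^2)"
      using gram[of "A + C" B D] unfolding u c_def .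
    also have "\<dots> = 4 * cs p ^ 2 * (1 + c) * (1 - c) + 2 * (P * Q) * c - Q^2 - P^2"
      using eps_cases by (auto simp: power2_eq_square algebra_simps)
    also have "4 * cs p ^ 2 * (1 + c) = 2 * (P * Q)" unfolding PQ by (simp add: c_def)
    finally show ?thesis by (simp add: power2_eq_square algebra_simps)
  qed
  then have "P = Q" by simp
  then have "P ^ 2 = (2 * cs p * cs q)^2" using PQ by (simp add: power2_eq_square)
  then have "P = 2 * cs p * cs q \<or> P = - (2 * cs p * cs q)" by (simp only: power2_eq_iff)
  \<comment> \<open>The square leaves the sign open. For K > 0 one of the two half perimeters is
    below pi / kap, and there the sum of the two cosines is positive.\<close>
  moreover have "P > 0"
  proof (cases "K > 0")
    case True
    have pos: "cs s + cs t > 0" if "adm s" "adm t" "kap * (s + t) < pi" for s t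
    proof -
      have b: "0 \<le> kap * s" "0 \<le> kap * t" "kap * s < pi" "kap * t < pi" using that True kap_pos by (auto simp: adm_def)
      have 1: "cos ((kap * s + kap * t) / 2) > 0" using that b by (intro cos_gt_zero_pi) (auto simp: distrib_left)
      have 2: "cos ((kap * s - kap * t) / 2) > 0" using b by (intro cos_gt_zero_pi) auto
      show ?thesis using 1 2 True by (simp add: cs_def cos_plus_cos)
    qed
    have "kap * (skd A B + skd B C) < pi \<or> kap * (skd C D + skd A D) < pi"
      using per[OF True] S.commute[of D A] by (auto simp: distrib_left)
    then have "P > 0 \<or> Q > 0" using pos S.dist_adm in_SK unfolding P_def Q_def by blast
    then show ?thesis using \<open>P = Q\<close> by auto
  next
    case False
    then show ?thesis by (simp add: P_def cs_def add_pos_pos)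
  qed
  moreover have "cs p * cs q > 0" using cp by simp
  ultimately have P: "P = 2 * cs p * cs q" by linarith
  have "ip (skd A B) + ip (skd B C) + ip (skd C D) + ip (skd D A) = eps * (P + Q)"
    using S.commute[of D A] by (simp add: ip_def P_def Q_def algebra_simps)
  also have "\<dots> = 4 * cs p * ip q" using P \<open>P = Q\<close> by (simp add: ip_def)
  finally show ?thesis by (simp add: p_def q_def)
qed

end

context cat_space
begin

text \<open>For the midpoint N of AC the medians from B and D, followed by \<open>ip_sum\<close>,
  prove the inequality of the theorem; equality forces every link, so N is the midpoint of BD as
  well.\<close>

lemma equality_midpoint:
  assumes M: "A \<in> M" "B \<in> M" "C \<in> M" "D \<in> M" and ne: "A \<noteq> C" "B \<noteq> D"
    and eq: "ip (d A B) + ip (d B C) + ip (d C D) + ip (d D A) = 4 * cs (d A C / 2) * ip (d B D / 2)"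
  defines "p \<equiv> d A C / 2" and "q \<equiv> d B D / 2"
  shows "\<exists>N\<in>M. d A N = p \<and> d N C = p \<and> d B N = q \<and> d N D = q" "d A B = d C D" "d B C = d A D"
    "ip (d A B) + ip (d B C) = 2 * cs p * ip q"
proof -
  have pq: "d A C = 2 * p" "d B D = 2 * q" "0 < p" "0 < q"
    using M ne by (auto simp: p_def q_def mdist_pos_less)
  have cp: "cs p > 0" "cs q > 0"
    using dist_adm[OF M(1,3)] dist_adm[OF M(2,4)] cs_half_pos[of p] cs_half_pos[of q] pq by auto
  obtain N where N: "N \<in> M" "d A N = p" "d N C = p" using point_at[OF M(1,3), of p] pq by auto
  have mB: "ip (d A B) + ip (d B C) \<le> 2 * cs p * ip (d B N)"
    using median[OF M(1,3) N(1) M(2) N(2,3) pq(1,3)] unfolding commute[of B A] .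
  have mD: "ip (d C D) + ip (d D A) \<le> 2 * cs p * ip (d D N)"
    using median[OF M(1,3) N(1) M(4) N(2,3) pq(1,3)] unfolding commute[of D C] by linarith
  have tri: "2 * q \<le> d B N + d D N"
    using triangle[OF M(2) N(1) M(4)] pq(2) unfolding commute[of N D] by linarith
  have aq: "adm (2 * q)" using dist_adm[OF M(2,4)] pq by simp
  have s: "ip (d B N) + ip (d D N) \<le> 2 * ip q"
    "ip (d B N) + ip (d D N) = 2 * ip q \<Longrightarrow> d B N = q \<and> d D N = q"
    using ip_sum[OF dist_adm dist_adm aq _ tri] M N pq by auto
  have "2 * cs p * (2 * ip q) = 4 * cs (d A C / 2) * ip (d B D / 2)" by (simp add: p_def q_def)
  then have "2 * cs p * (2 * ip q) \<le> 2 * cs p * (ip (d B N) + ip (d D N))" using eq mB mD by (simp add: distrib_left)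
  then have "2 * ip q \<le> ip (d B N) + ip (d D N)" using cp by simp
  then have BN: "d B N = q" "d D N = q" using s by auto
  then have ND: "d N D = q" using commute[of N D] by simp
  then show "\<exists>N\<in>M. d A N = p \<and> d N C = p \<and> d B N = q \<and> d N D = q" using N BN by blast
  have e1: "ip (d A B) + ip (d B C) = 2 * cs p * ip q" "ip (d C D) + ip (d D A) = 2 * cs p * ip q"
    using mB mD eq unfolding BN by (auto simp: p_def q_def)
  then show "ip (d A B) + ip (d B C) = 2 * cs p * ip q" by simp
  \<comment> \<open>With the diagonals exchanged, the median inequality has the same right-hand
    side.\<close>
  have sw: "cs q * ip p = cs p * ip q" by (simp add: ip_def)
  have mA: "ip (d A B) + ip (d D A) \<le> 2 * cs p * ip q"
    using median[OF M(2,4) N(1) M(1) BN(1) ND pq(2,4)] sw unfolding N(2) commute[of A D] by simp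
  have mC: "ip (d B C) + ip (d C D) \<le> 2 * cs p * ip q"
    using median[OF M(2,4) N(1) M(3) BN(1) ND pq(2,4)] sw unfolding commute[of C B] commute[of C N] N(3) by simp
  \<comment> \<open>The two sums e1 equal the common bound, so mA and mC, which add up to the same
    total, are equalities too; subtracting gives equality of opposite sides.\<close>
  have "ip (d B C) = ip (d A D)" using e1 mA mC unfolding commute[of A D] by linarith
  then show "d B C = d A D" using ip_eq_iff[OF dist_adm[OF M(2,3)] dist_adm[OF M(1,4)]] by simp
  have "ip (d A B) = ip (d C D)" using e1 mA mC by linarith
  then show "d A B = d C D" using ip_eq_iff[OF dist_adm[OF M(1,2)] dist_adm[OF M(3,4)]] by simp
qed

text \<open>The model parallelogram is written down in coordinates with its centre N' on the axis of
  the hemisphere or hyperboloid.\<close>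

lemma equality_isometry:
  assumes M: "A \<in> M" "B \<in> M" "C \<in> M" "D \<in> M" and ne: "distinct [A, B, C, D]"
    and eq: "ip (d A B) + ip (d B C) + ip (d C D) + ip (d D A) = 4 * cs (d A C / 2) * ip (d B D / 2)"
  shows "\<exists>f A' B' C' D'. {A', B', C', D'} \<subseteq> SK_set K \<and> f A = A' \<and> f B = B' \<and> f C = C' \<and> f D = D' \<and>
     cosqSK K A' D' C' B' = -1 \<and> skd A' D' = skd B' C' \<and>
     f ` geo_hull M d {A, B, C, D} = geo_hull (SK_set K) skd {A', B', C', D'} \<and>
     (\<forall>x\<in>geo_hull M d {A, B, C, D}. \<forall>y\<in>geo_hull M d {A, B, C, D}. skd (f x) (f y) = d x y)"
proof -
  interpret S: cat_space K "SK_set K" skd by (rule SK_cat_space)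
  define p q where "p = d A C / 2" and "q = d B D / 2"
  have neAC: "A \<noteq> C" "B \<noteq> D" "A \<noteq> B" "A \<noteq> D" using ne by auto
  note em = equality_midpoint[OF M neAC(1,2) eq, folded p_def q_def]
  obtain N where N: "N \<in> M" "d A N = p" "d N C = p" "d B N = q" "d N D = q" using em(1) by blast
  have pq: "d A C = 2 * p" "d B D = 2 * q" "0 < p" "0 < q"
    using M neAC by (auto simp: p_def q_def mdist_pos_less)
  have a2: "adm (2 * p)" "adm (2 * q)" using dist_adm[OF M(1,3)] dist_adm[OF M(2,4)] pq by auto
  have a1: "adm p" "adm q" using a2 pq adm_mono[OF a2(1), of p] adm_mono[OF a2(2), of q] by auto
  have cp: "cs p > 0" "cs q > 0" "sn p > 0" "sn q > 0"
    using cs_half_pos a1 a2 sn_pos pq by auto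
  have id: "ip (d A B) + ip (d B C) = 2 * cs p * ip q" by (rule em(4))
  \<comment> \<open>The cosine of the comparison angle at N of the triangle N A B, taken as the
    angle between the model diagonals. For r = 1 or -1 the parallelogram degenerates to a
    segment.\<close>
  define r where "r = rat p q (d A B)"
  have "- 1 \<le> r" "r \<le> 1"
  proof -
    have t: "d A B \<le> p + q" "p \<le> q + d A B" "q \<le> p + d A B"
      using triangle[of A N B] triangle[of A B N] triangle[of B A N] M N commute[of N B] commute[of B A] by auto
    have "kap * (p + q + d A B) < 2 * pi" if "K > 0"
      using a2 dist_adm[OF M(1,2)] that by (auto simp: adm_def distrib_left)
    then show "- 1 \<le> r" "r \<le> 1"
      using rat_bounds[of p q "d A B"] t a1 dist_adm[OF M(1,2)] pq unfolding r_def by auto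
  qed
  then have r2: "r\<^sup>2 \<le> 1" by (simp add: abs_square_le_1 abs_le_iff)
  define s where "s = sqrt (1 - r\<^sup>2)"
  have s: "r * r + s * s = 1" using r2 by (simp add: s_def power2_eq_square)
  have AB: "ip (d A B) = eps * cs p * cs q + sn p * sn q * r"
    using rat_law[of p q "d A B"] cp by (simp add: r_def)
  \<comment> \<open>The supplementary angle at N; the sum \<open>id\<close> of the two adjacent
    sides forces it.\<close>
  have BC: "ip (d B C) = eps * cs p * cs q - sn p * sn q * r"
    using id AB by (simp add: ip_def algebra_simps)
  \<comment> \<open>Polar coordinates about N': distance p in the directions of the first axis and
    its opposite, distance q in the directions (r, s) and (-r, -s).\<close>
  define A' :: "real^3" where "A' = (1/kap) *\<^sub>R vector [sn p, 0, cs p]"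
  define C' :: "real^3" where "C' = (1/kap) *\<^sub>R vector [- sn p, 0, cs p]"
  define B' :: "real^3" where "B' = (1/kap) *\<^sub>R vector [sn q * r, sn q * s, cs q]"
  define D' :: "real^3" where "D' = (1/kap) *\<^sub>R vector [- (sn q * r), - (sn q * s), cs q]"
  define N' :: "real^3" where "N' = (1/kap) *\<^sub>R vector [0, 0, 1]"
  have form_vec: "form ((1/kap) *\<^sub>R vector [x1, x2, x3]) ((1/kap) *\<^sub>R vector [y1, y2, y3]) = x1 * y1 + x2 * y2 + eps * (x3 * y3)"
    for x1 x2 x3 y1 y2 y3
    using kap_pos by (simp add: form_def vector_3 power2_eq_square field_simps)
  note defs = A'_def B'_def C'_def D'_def N'_def
  have snq: "sn q * r * (sn q * r) + sn q * s * (sn q * s) = sn q * sn q"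
  proof -
    have "sn q * r * (sn q * r) + sn q * s * (sn q * s) = sn q * sn q * (r * r + s * s)" by (simp add: algebra_simps)
    then show ?thesis using s by simp
  qed
  have py: "sn t * sn t + eps * (cs t * cs t) = eps" for t
    using pyth'[of t] by (simp add: power2_eq_square algebra_simps)
  have self: "form A' A' = eps" "form B' B' = eps" "form C' C' = eps" "form D' D' = eps" "form N' N' = eps"
    unfolding defs form_vec using snq py by simp_all
  have in_SK: "A' \<in> SK_set K" "B' \<in> SK_set K" "C' \<in> SK_set K" "D' \<in> SK_set K" "N' \<in> SK_set K"
    using self cp kap_pos unfolding SK_set_iff by (auto simp: defs vector_3)
  have ip2: "ip (2 * t) = eps * (cs t * cs t) - sn t * sn t" for t
  proof -
    have "cs (2 * t) = cs t * cs t - eps * sn t * sn t" using cs_add[of t t] by simp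
    then show ?thesis by (simp add: ip_def right_diff_distrib mult.assoc)
  qed
  have cross: "form A' B' = ip (d A B)" "form C' D' = ip (d A B)" "form B' C' = ip (d B C)" "form A' D' = ip (d B C)"
    "form A' C' = ip (2 * p)" "form B' D' = ip (2 * q)" "form A' N' = ip p" "form N' C' = ip p" "form B' N' = ip q" "form N' D' = ip q"
    unfolding defs form_vec AB BC ip2 using snq by (simp_all add: ip_def algebra_simps)
  have dd: "skd A' B' = d A B" "skd C' D' = d A B" "skd B' C' = d B C" "skd A' D' = d B C"
    "skd A' C' = 2 * p" "skd B' D' = 2 * q" "skd A' N' = p" "skd N' C' = p" "skd B' N' = q" "skd N' D' = q"
    using cross in_SK a1 a2 dist_adm M by (auto intro!: skd_eqI)
  interpret parallelogram K M d A B C D N A' B' C' D' N' "2 * cs p" "2 * cs q"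
  proof
    show "matched A C N A' C' N'" "matched B D N B' D' N'"
      unfolding matched_def using M N in_SK dd pq by auto
    show "0 < d A N" "0 < d N C" "0 < d B N" "0 < d N D" using N pq by auto
    show "d A B = skd A' B'" "d B C = skd B' C'" "d C D = skd C' D'" "d A D = skd A' D'"
      using dd em(2,3) by auto
    show "0 < 2 * cs p" "0 < 2 * cs q" using cp by auto
    show "A' + C' = (2 * cs p) *\<^sub>R N'" "B' + D' = (2 * cs q) *\<^sub>R N'"
      by (simp_all add: defs vec_eq_iff forall_3 vector_3)
  qed
  have "cosqSK K A' D' C' B' = cosq K (skd A' D') (skd C' B') (skd A' C') (skd D' B') (skd D' C') (skd A' B')"
    using in_SK by (simp add: cosqSK_def Let_def skd_def)
  also have "\<dots> = cosq K (d B C) (d B C) (2 * p) (2 * q) (d A B) (d A B)"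
    using dd S.commute[of C' B'] S.commute[of D' B'] S.commute[of D' C'] by simp
  also have "\<dots> = -1"
  proof -
    have "sn (d B C) > 0" using M ne dist_adm by (auto simp: mdist_pos_less intro!: sn_pos)
    moreover have "1 + cs (2 * p) > 0" using cp by (simp add: cs_double)
    moreover have "cs (d B C) + cs (d A B) = 2 * cs p * cs q"
    proof -
      have "eps * (cs (d B C) + cs (d A B)) = eps * (2 * cs p * cs q)" using id by (simp add: ip_def algebra_simps)
      then show ?thesis using eps_cases by auto
    qed
    ultimately show ?thesis by (subst cosq_iff) (auto simp: cs_double power2_eq_square)
  qed
  finally have cq: "cosqSK K A' D' C' B' = -1" .
  have sk: "skd A' D' = skd B' C'" using dd by simp
  show ?thesis using hull_isometry cq sk in_SK by blast
qed

end

theorem mainTheorem19: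
  fixes K :: real and M :: "'a set" and d :: "'a \<Rightarrow> 'a \<Rightarrow> real" and A B C D :: 'a
  assumes "K \<noteq> 0"
    and "RK_domain K M d"
    and "A \<in> M" "B \<in> M" "C \<in> M" "D \<in> M"
    and "distinct [A, B, C, D]"
    and "K > 0 \<longrightarrow> d A B + d B C + d C D + d D A < 2 * pi / sqrt K"
  shows "(if K > 0 then
            cos (sqrt \<bar>K\<bar> * d A B) + cos (sqrt \<bar>K\<bar> * d B C) + cos (sqrt \<bar>K\<bar> * d C D)
              + cos (sqrt \<bar>K\<bar> * d D A)
            = 4 * cos (sqrt \<bar>K\<bar> * d B D / 2) * cos (sqrt \<bar>K\<bar> * d A C / 2)
          else
            cosh (sqrt \<bar>K\<bar> * d A B) + cosh (sqrt \<bar>K\<bar> * d B C) + cosh (sqrt \<bar>K\<bar> * d C D)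
              + cosh (sqrt \<bar>K\<bar> * d D A)
            = 4 * cosh (sqrt \<bar>K\<bar> * d B D / 2) * cosh (sqrt \<bar>K\<bar> * d A C / 2))
   \<longleftrightarrow>
   (\<exists>f A' B' C' D'.
      A' \<in> SK_set K \<and> B' \<in> SK_set K \<and> C' \<in> SK_set K \<and> D' \<in> SK_set K \<and>
      f A = A' \<and> f B = B' \<and> f C = C' \<and> f D = D' \<and>
      cosqSK K A' D' C' B' = -1 \<and> SK_dist K A' D' = SK_dist K B' C' \<and>
      f ` geo_hull M d {A, B, C, D} = geo_hull (SK_set K) (SK_dist K) {A', B', C', D'} \<and>
      (\<forall>x\<in>geo_hull M d {A, B, C, D}. \<forall>y\<in>geo_hull M d {A, B, C, D}.
         SK_dist K (f x) (f y) = d x y))"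
  (is "?eq \<longleftrightarrow> ?iso")
proof -
  interpret ktrig K by unfold_locales fact
  interpret Metric_space M d using assms(2) by (simp add: RK_domain_def)
  interpret rk_space K M d by unfold_locales fact
  define H where "H = geo_hull M d {A, B, C, D}"
  have AH: "{A, B, C, D} \<subseteq> H"
  proof -
    have "(geo_step M d ^^ 0) {A, B, C, D} \<subseteq> H" unfolding H_def geo_hull_def by blast
    then show ?thesis by simp
  qed
  \<comment> \<open>The statement uses \<open>SK_dist\<close>, the argument \<open>skd\<close>; they
    agree on the model plane.\<close>
  have hull: "geo_hull (SK_set K) (SK_dist K) S = geo_hull (SK_set K) skd S" for S
    by (rule geo_hull_cong) (simp add: skd_def)
  have eq: "?eq \<longleftrightarrow> ip (d A B) + ip (d B C) + ip (d C D) + ip (d D A) = 4 * cs (d A C / 2) * ip (d B D / 2)"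
  proof (cases "K > 0")
    case True
    then have "ip t = cos (sqrt \<bar>K\<bar> * t)" "cs t = cos (sqrt \<bar>K\<bar> * t)" for t
      using eps_cases by (auto simp: ip_def cs_def kap_def)
    then show ?thesis using True by (simp add: mult_ac)
  next
    case False
    then have "eps = -1" using eps_cases by auto
    then have "ip t = - cosh (sqrt \<bar>K\<bar> * t)" "cs t = cosh (sqrt \<bar>K\<bar> * t)" for t
      using False by (auto simp: ip_def cs_def kap_def)
    then show ?thesis using False by (simp add: mult_ac) (intro iffI; linarith)
  qed
  show ?thesis
  proof
    assume ?eq
    then have e: "ip (d A B) + ip (d B C) + ip (d C D) + ip (d D A) = 4 * cs (d A C / 2) * ip (d B D / 2)"
      by (simp only: eq)
    obtain f A' B' C' D' where f0: "{A', B', C', D'} \<subseteq> SK_set K \<and> f A = A' \<and> f B = B' \<and> f C = C' \<and> f D = D' \<and>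
        cosqSK K A' D' C' B' = -1 \<and> skd A' D' = skd B' C' \<and>
        f ` H = geo_hull (SK_set K) skd {A', B', C', D'} \<and> (\<forall>x\<in>H. \<forall>y\<in>H. skd (f x) (f y) = d x y)"
      using equality_isometry[OF assms(3-7) e, folded H_def] by (elim exE) (rule that)
    then have f: "{A', B', C', D'} \<subseteq> SK_set K" "f A = A'" "f B = B'" "f C = C'" "f D = D'"
      "cosqSK K A' D' C' B' = -1" "skd A' D' = skd B' C'"
      "f ` H = geo_hull (SK_set K) skd {A', B', C', D'}"
      "\<And>x y. x \<in> H \<Longrightarrow> y \<in> H \<Longrightarrow> skd (f x) (f y) = d x y"
      by simp_all
    \<comment> \<open>Needed to read the distances of images in \<open>skd\<close> as values of
      \<open>SK_dist\<close>.\<close>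
    have "f ` H \<subseteq> SK_set K"
    proof -
      interpret S: cat_space K "SK_set K" skd by (rule SK_cat_space)
      have "geo_step (SK_set K) skd T \<subseteq> SK_set K" for T
        by (auto simp: geo_step_def geo_seg_def shortest_def curve_in_def)
      then have "(geo_step (SK_set K) skd ^^ n) {A', B', C', D'} \<subseteq> SK_set K" for n
        using f(1) by (cases n) auto
      then show ?thesis unfolding f(8) geo_hull_def by blast
    qed
    then have "f x \<in> SK_set K" if "x \<in> H" for x using that by blast
    then have "SK_dist K (f x) (f y) = d x y" if "x \<in> H" "y \<in> H" for x y
      using f(9)[OF that] that by (simp add: skd_def)
    moreover have "SK_dist K A' D' = SK_dist K B' C'" using f(1,7) by (simp add: skd_def)
    ultimately show ?iso
      unfolding hull H_def[symmetric] using f(1-6,8)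
      by (intro exI[of _ f] exI[of _ A'] exI[of _ B'] exI[of _ C'] exI[of _ D']) simp
  next
    assume ?iso
    then obtain f where f: "f A \<in> SK_set K" "f B \<in> SK_set K" "f C \<in> SK_set K" "f D \<in> SK_set K"
      "cosqSK K (f A) (f D) (f C) (f B) = -1" "SK_dist K (f A) (f D) = SK_dist K (f B) (f C)"
      "\<And>x y. x \<in> H \<Longrightarrow> y \<in> H \<Longrightarrow> SK_dist K (f x) (f y) = d x y"
      unfolding H_def by blast
    have dd: "skd (f x) (f y) = d x y" if "x \<in> {A, B, C, D}" "y \<in> {A, B, C, D}" for x y
      using f(7)[of x y] AH that f(1-4) by (auto simp: skd_def)
    have per: "kap * (skd (f A) (f B) + skd (f B) (f C) + skd (f C) (f D) + skd (f D) (f A)) < 2 * pi" if "K > 0"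
      using assms(8) that kap_pos by (simp add: dd kap_def pos_less_divide_eq mult.commute)
    have sk: "skd (f A) (f D) = skd (f B) (f C)" using f(1-4,6) by (simp add: skd_def)
    have "f A \<noteq> f D"
    proof
      interpret S: cat_space K "SK_set K" skd by (rule SK_cat_space)
      assume "f A = f D"
      then have "d A D = 0" using dd[of A D] f(1) by simp
      then show False using assms(3,6,7) by auto
    qed
    from SK_parallelogram_equality[OF f(1-4) sk this f(5) per] show ?eq
      unfolding eq by (simp add: dd)
  qed
qed

end
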